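(* Let $n\in\mathbb N$ and let $X_1,\dots,X_n$ be independent random variables with symmetric distributions and $0<{\sf E}X_i^2<\infty$. Assume $L_n(1)>0$ and put $\gamma=M_n(1)/L_n(1)$. Then for each pair $(\gamma_0,c)$ in the list $(0,\,1.5769)$, $(0.1,\,1.5749)$, $(0.5,\,1.4532)$, $(1,\,1.3033)$, $(2,\,1.1115)$, $(5,\,0.8729)$, $(10,\,0.7433)$, $(100,\,0.5808)$, if $\gamma\ge\gamma_0$ then $\Delta_n\le (1+\gamma)\,c\,L_n(1)=c\,(L_n(1)+M_n(1))$.
   Context: $B_n^2=\sum_{i=1}^n{\sf E}X_i^2$, $S_n=X_1+\dots+X_n$, $\Phi$ is the standard normal distribution function, $\Delta_n=\sup_{x}|{\sf P}(S_n<xB_n)-\Phi(x)|$. For $\varepsilon>0$, $L_n(\varepsilon)=B_n^{-2}\sum_{i=1}^n{\sf E}X_i^2\mathbb I(|X_i|\ge\varepsilon B_n)$, $M_n(\varepsilon)=B_n^{-3}\sum_{i=1}^n{\sf E}|X_i|^3\mathbb I(|X_i|<\varepsilon B_n)$. *)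

theory Defs
  imports "HOL-Probability.Probability"
begin

definition Phi :: "real \<Rightarrow> real" where
  "Phi x = measure (density lborel std_normal_density) {..<x}"

definition Bn2 :: "'a measure \<Rightarrow> (nat \<Rightarrow> 'a \<Rightarrow> real) \<Rightarrow> nat \<Rightarrow> real" where
  "Bn2 M X n = (\<Sum>i=1..n. integral\<^sup>L M (\<lambda>\<omega>. (X i \<omega>)\<^sup>2))"

definition Bn :: "'a measure \<Rightarrow> (nat \<Rightarrow> 'a \<Rightarrow> real) \<Rightarrow> nat \<Rightarrow> real" where
  "Bn M X n = sqrt (Bn2 M X n)"

definition Sn :: "(nat \<Rightarrow> 'a \<Rightarrow> real) \<Rightarrow> nat \<Rightarrow> 'a \<Rightarrow> real" where
  "Sn X n \<omega> = (\<Sum>i=1..n. X i \<omega>)"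

definition Delta_n :: "'a measure \<Rightarrow> (nat \<Rightarrow> 'a \<Rightarrow> real) \<Rightarrow> nat \<Rightarrow> real" where
  "Delta_n M X n = (SUP x::real. \<bar>measure M {\<omega> \<in> space M. Sn X n \<omega> < x * Bn M X n} - Phi x\<bar>)"

definition Ln :: "'a measure \<Rightarrow> (nat \<Rightarrow> 'a \<Rightarrow> real) \<Rightarrow> nat \<Rightarrow> real \<Rightarrow> real" where
  "Ln M X n \<epsilon> = (\<Sum>i=1..n. integral\<^sup>L M (\<lambda>\<omega>.
       (X i \<omega>)\<^sup>2 * indicator {\<omega>. \<bar>X i \<omega>\<bar> \<ge> \<epsilon> * Bn M X n} \<omega>)) / Bn2 M X n"

definition Mn :: "'a measure \<Rightarrow> (nat \<Rightarrow> 'a \<Rightarrow> real) \<Rightarrow> nat \<Rightarrow> real \<Rightarrow> real" where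
  "Mn M X n \<epsilon> = (\<Sum>i=1..n. integral\<^sup>L M (\<lambda>\<omega>.
       \<bar>X i \<omega>\<bar> ^ 3 * indicator {\<omega>. \<bar>X i \<omega>\<bar> < \<epsilon> * Bn M X n} \<omega>)) / (Bn M X n ^ 3)"

end

theory Submission
  imports Defs
begin

text \<open>Truncate every $X_i$ at $B_n$. By symmetry, on the event that some $|X_i|$ reaches $B_n$, which has probability
at most $L_n(1)$, both the original and the truncated sum put at least half of the mass on each closed half line, so
truncation changes the distribution function by at most $L_n(1)/2$. The truncated sum has variance $1 - L_n(1)$ in
units of $B_n^2$; it is compared with the normal law by a Berry--Esseen bound $0.57\,m$ for symmetric summands, where $m$
is the Lyapunov ratio. Together this gives $\Delta_n \le 0.5708\,M_n(1) + 1.5769\,L_n(1)$ unless the right-hand side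
is at least $1/2$, where symmetry alone suffices, and this one inequality implies all listed pairs because
$M_n(1) \ge \gamma_0 L_n(1)$.

The Berry--Esseen bound comes from Prawitz's smoothing inequality with cutoff $T = 2.6/m$. Near the origin, as long as
$m t^3 \le 7$, the product of the (real) characteristic functions differs from $e^{-t^2/2}$ by at most
$e^{-t^2/2} (m t^3/10 + 0.055\,(m t^3)^2)$; further out it is at most $e^{-t^2/2 + 0.1905\,m t^3}$, and the resulting
tail integral is estimated by chords of convex functions on a mesh, for twelve ranges of $m$ up to $0.88$.\<close>

section \<open>Elementary estimates\<close>

text \<open>The pair with \<gamma>0 = 0 fixes the coefficient 1.5769 of L = L_n(1); given it, the
  pair with \<gamma>0 = 100 allows at most (101 * 0.5808 - 1.5769) / 100 = 0.57083... for M_n(1). So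
  the Berry-Esseen constant has to be close to 0.57, and most of the work goes there. Of 1.5769 L,
  half pays for truncation, the other 1.0769 L for restoring unit variance.

  After division by m, the smoothing bound tends to sqrt (pi/2) (1/2.6 + 1.034/(10 pi)) = 0.523 as m
  -> 0, which leaves about 0.047 for second-order terms and the tail. A larger T would lower the
  first term, but the tail exponent must stay negative up to T, that is 0.381 m T < 1; the choice
  2.6 gives 0.9906. The price is that near t = T there is hardly any damping, and only the vanishing
  of Prawitz's kernel keeps the tail small.

  Symmetry makes the characteristic functions real, so each factor is controlled by pointwise
  inequalities for cosine: from above by cubic bounds, from below by the two-point law of the same
  variance.\<close>

lemma nonneg_from_deriv:
  fixes f f' :: "real \<Rightarrow> real"
  assumes "f a \<ge> 0" "a \<le> x" "\<And>t. a \<le> t \<Longrightarrow> t \<le> x \<Longrightarrow> (f has_real_derivative f' t) (at t)"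
    and "\<And>t. a \<le> t \<Longrightarrow> t \<le> x \<Longrightarrow> f' t \<ge> 0"
  shows "f x \<ge> 0"
proof -
  have "f a \<le> f x"
    by (rule DERIV_nonneg_imp_nondecreasing[OF assms(2)]) (use assms in blast)
  with assms(1) show ?thesis by simp
qed

section \<open>Taylor polynomials of sine and cosine, and rational bounds for pi\<close>

lemma sin_upper1: "0 \<le> (x::real) \<Longrightarrow> sin x \<le> x"
  by (rule sin_x_le_x)

text \<open>The derivative of the difference is the difference in the preceding bound. So each
  member of this ladder integrates the one before it from 0, where both sides agree.\<close>

lemma cos_lower2: "0 \<le> (x::real) \<Longrightarrow> 1 - x^2/2 \<le> cos x"
  using nonneg_from_deriv[of "\<lambda>x. cos x - (1 - x^2/2)" 0 x "\<lambda>x. x - sin x"] sin_upper1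
  by (fastforce intro!: derivative_eq_intros)

lemma sin_lower3: "0 \<le> (x::real) \<Longrightarrow> x - x^3/6 \<le> sin x"
  using nonneg_from_deriv[of "\<lambda>x. sin x - (x - x^3/6)" 0 x "\<lambda>x. cos x - (1 - x^2/2)"] cos_lower2
  by (fastforce intro!: derivative_eq_intros)

lemma cos_upper4: "0 \<le> (x::real) \<Longrightarrow> cos x \<le> 1 - x^2/2 + x^4/24"
  using nonneg_from_deriv[of "\<lambda>x. (1 - x^2/2 + x^4/24) - cos x" 0 x "\<lambda>x. sin x - (x - x^3/6)"] sin_lower3
  by (fastforce intro!: derivative_eq_intros)

lemma sin_upper5: "0 \<le> (x::real) \<Longrightarrow> sin x \<le> x - x^3/6 + x^5/120"
  using nonneg_from_deriv[of "\<lambda>x. (x - x^3/6 + x^5/120) - sin x" 0 x "\<lambda>x. (1 - x^2/2 + x^4/24) - cos x"] cos_upper4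
  by (fastforce intro!: derivative_eq_intros)

lemma cos_lower6: "0 \<le> (x::real) \<Longrightarrow> 1 - x^2/2 + x^4/24 - x^6/720 \<le> cos x"
  using nonneg_from_deriv[of "\<lambda>x. cos x - (1 - x^2/2 + x^4/24 - x^6/720)" 0 x "\<lambda>x. (x - x^3/6 + x^5/120) - sin x"] sin_upper5
  by (fastforce intro!: derivative_eq_intros)

lemma sin_lower7: "0 \<le> (x::real) \<Longrightarrow> x - x^3/6 + x^5/120 - x^7/5040 \<le> sin x"
  using nonneg_from_deriv[of "\<lambda>x. sin x - (x - x^3/6 + x^5/120 - x^7/5040)" 0 x "\<lambda>x. cos x - (1 - x^2/2 + x^4/24 - x^6/720)"] cos_lower6
  by (fastforce intro!: derivative_eq_intros)

lemma cos_upper8: "0 \<le> (x::real) \<Longrightarrow> cos x \<le> 1 - x^2/2 + x^4/24 - x^6/720 + x^8/40320"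
  using nonneg_from_deriv[of "\<lambda>x. (1 - x^2/2 + x^4/24 - x^6/720 + x^8/40320) - cos x" 0 x "\<lambda>x. sin x - (x - x^3/6 + x^5/120 - x^7/5040)"] sin_lower7
  by (fastforce intro!: derivative_eq_intros)

lemma sin_upper9: "0 \<le> (x::real) \<Longrightarrow> sin x \<le> x - x^3/6 + x^5/120 - x^7/5040 + x^9/362880"
  using nonneg_from_deriv[of "\<lambda>x. (x - x^3/6 + x^5/120 - x^7/5040 + x^9/362880) - sin x" 0 x "\<lambda>x. (1 - x^2/2 + x^4/24 - x^6/720 + x^8/40320) - cos x"] cos_upper8
  by (fastforce intro!: derivative_eq_intros)

lemma cos_lower10: "0 \<le> (x::real) \<Longrightarrow> 1 - x^2/2 + x^4/24 - x^6/720 + x^8/40320 - x^10/3628800 \<le> cos x"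
  using nonneg_from_deriv[of "\<lambda>x. cos x - (1 - x^2/2 + x^4/24 - x^6/720 + x^8/40320 - x^10/3628800)" 0 x "\<lambda>x. (x - x^3/6 + x^5/120 - x^7/5040 + x^9/362880) - sin x"] sin_upper9
  by (fastforce intro!: derivative_eq_intros)

text \<open>Monotonicity of cosine turns the sign of cos (6283/4000) into a comparison with pi/2.
  That argument is only about 5e-5 below pi/2; the degree-10 polynomial resolves this, while the
  degree-6 one is off by about 1e-3.\<close>

lemma pi_lower: "(6283/2000) < pi"
proof (rule ccontr)
  assume "\<not> (6283/2000) < pi"
  then have "cos ((6283/2000)/2) \<le> cos (pi/2)"
    by (intro cos_monotone_0_pi_le) (use pi_ge_two in auto)
  moreover have "cos ((6283/2000)/2) > (0::real)"
    using cos_lower10[of "(6283/2000)/2"] by (simp add: power_divide)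
  ultimately show False by simp
qed

lemma pi_upper: "pi < (1571/500)"
proof (rule ccontr)
  assume a: "\<not> pi < (1571/500)"
  then have "cos ((1571/500)/2) \<ge> cos (pi/2)"
    by (intro cos_monotone_0_pi_le) auto
  moreover have "cos ((1571/500)/2) < (0::real)"
    using cos_upper8[of "(1571/500)/2"] by (simp add: power_divide)
  ultimately show False by simp
qed

text \<open>The best constant is about 0.0992, attained near x = 4, so 1/10 loses little. Up to 2.4
  one has x^4/24 <= x^3/10 and the quartic Taylor bound suffices; beyond, cos x = -cos (x - pi)
  brings the critical point to a small argument.\<close>

lemma cos_cubic_upper: "cos (x::real) \<le> 1 - x^2/2 + \<bar>x\<bar>^3/10"
proof -
  have *: "cos x \<le> 1 - x^2/2 + x^3/10" if x: "x \<ge> 0" for x :: real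
  proof (cases "x \<le> (12/5)")
    case True
    have "x^4/24 \<le> x^3/10" using mult_left_mono[OF True, of "x^3"] x by (simp add: eval_nat_numeral algebra_simps)
    then show ?thesis using cos_upper4[OF x] by linarith
  next
    case False
    have "cos x = - cos \<bar>x - pi\<bar>" by (simp add: cos_diff)
    then have "cos x \<le> -1 + (x-pi)^2/2" using cos_lower2[of "\<bar>x-pi\<bar>"] by simp
    moreover have "2 - x^2/2 + x^3/10 - (x-pi)^2/2 \<ge> 0"
    proof -
      have "2 - x^2/2 + x^3/10 - (x-pi)^2/2 = 2 - x^2 + pi*x - pi^2/2 + x^3/10"
        by (simp add: power2_eq_square field_simps)
      moreover have "pi*x - pi^2/2 \<ge> (6283/2000)*x - (1571/500)^2/2"
      proof -
        have "pi^2 \<le> (1571/500)^2" by (rule power_mono) (use pi_upper in auto)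
        moreover have "(6283/2000) * x \<le> pi * x" using pi_lower x by (intro mult_right_mono) auto
        ultimately show ?thesis by linarith
      qed
      moreover have "2 - x^2 + (6283/2000)*x - (1571/500)^2/2 + x^3/10 \<ge> 0"
      proof -
        \<comment> \<open>The double root 4.135 is close to the local minimum of the cubic, and 1.73
          = 10 - 2 * 4.135 matches the quadratic coefficient, so that only a linear remainder is
          left.\<close>
        have "2 - x^2 + (6283/2000)*x - (1571/500)^2/2 + x^3/10 = (x - (173/100))*(x-(827/200))^2/10 + (2 - (1571/500)^2/2 + (173/100)*(827/200)^2/10) + x*((6283/2000) - ((827/200)^2+2*(173/100)*(827/200))/10)"
          by (simp add: power2_eq_square power3_eq_cube field_simps)
        moreover have "(x - (173/100))*(x-(827/200))^2/10 \<ge> 0" using False by simp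
        ultimately show ?thesis using False by (simp add: power2_eq_square)
      qed
      ultimately show ?thesis by linarith
    qed
    ultimately show ?thesis by linarith
  qed
  show ?thesis using *[of "\<bar>x\<bar>"] by simp
qed

text \<open>The best constant is about 0.19, attained near x = 2.31. With
  \<open>cos_cubic_upper\<close> it bounds the modulus of a characteristic function. From 2.625,
  just above 1/0.381, the cubic term dominates x^2/2 and -cos x <= 1 suffices.\<close>

lemma neg_cos_cubic_upper: "- cos (x::real) \<le> 1 - x^2/2 + (381/2000)*\<bar>x\<bar>^3"
proof -
  have *: "- cos x \<le> 1 - x^2/2 + (381/2000)*x^3" if x: "x \<ge> 0" for x :: real
  proof (cases "x \<le> (21/8)")
    case False
    have "x^2/2 \<le> (381/2000)*x^3" using mult_left_mono[of "(21/8)" x "(381/2000)*x^2"] False x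
      by (simp add: power2_eq_square power3_eq_cube)
    then show ?thesis using cos_ge_minus_one[of x] by linarith
  next
    case True
    have "- cos x = cos (pi - x)" by (simp add: cos_diff)
    also have "\<dots> \<le> 1 - (pi-x)^2/2 + (pi-x)^4/24"
      using True pi_lower by (intro cos_upper4) auto
    finally have 1: "- cos x \<le> 1 - (pi-x)^2/2 + (pi-x)^4/24" .
    \<comment> \<open>Replaces pi by 3.1415. The allowance 0.0033 covers the change of the quartic
      term; the quadratic term moves in the favourable direction.\<close>
    have "(pi-x)^4/24 - (pi-x)^2/2 \<le> ((6283/2000)-x)^4/24 - ((6283/2000)-x)^2/2 + (33/10000)"
    proof -
      define p q where "p = pi - x" and "q = (6283/2000) - x"
      have pq: "0 \<le> q" "q \<le> p" "p - q \<le> (1/2000)" "p \<le> (1571/500)" "q \<le> (6283/2000)"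
        using pi_lower pi_upper x True by (auto simp: p_def q_def)
      have "p^4 - q^4 = (p-q)*((p+q)*(p^2+q^2))" by (simp add: power2_eq_square power4_eq_xxxx algebra_simps)
      also have "\<dots> \<le> (1/2000) * (((1571/500)+(6283/2000))*((1571/500)^2+(6283/2000)^2))"
        using pq by (intro mult_mono add_mono power_mono mult_nonneg_nonneg) auto
      finally have "p^4 - q^4 \<le> (7/100)" by (simp add: power2_eq_square)
      moreover have "q^2 \<le> p^2" using pq by (intro power_mono) auto
      ultimately show ?thesis unfolding p_def[symmetric] q_def[symmetric] by (simp add: field_simps)
    qed
    moreover have "((6283/2000)-x)^4/24 - ((6283/2000)-x)^2/2 + (33/10000) \<le> (381/2000)*x^3 - x^2/2"
    proof -
      \<comment> \<open>Extracts a square at 2.308, where the inequality is almost an equality; its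
        cofactor and the linear remainder are both nonnegative up to 2.625.\<close>
      have "(381/2000)*x^3 - x^2/2 - (((6283/2000)-x)^4/24 - ((6283/2000)-x)^2/2 + (33/10000))
        = (x-(577/250))^2*((1565713/9600000) + (2087/4000)*x - x*x/24) + ((1609860702799/384000000000000) + (-33058789/48000000000)*x)"
        by (simp add: power2_eq_square power3_eq_cube power4_eq_xxxx field_simps)
      moreover have "x*x \<le> (21/8)*x" using x True by (intro mult_right_mono) auto
      then have "(x-(577/250))^2*((1565713/9600000) + (2087/4000)*x - x*x/24) \<ge> 0"
        using x True by (intro mult_nonneg_nonneg) auto
      moreover have "(1609860702799/384000000000000) + (-33058789/48000000000)*x \<ge> 0" using x True by simp
      ultimately show ?thesis by linarith
    qed
    ultimately show ?thesis using 1 by linarith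
  qed
  show ?thesis using *[of "\<bar>x\<bar>"] by simp
qed

lemma sinc_mono:
  fixes x s :: real
  assumes "0 < x" "x \<le> s" "s \<le> pi"
  shows "sin s / s \<le> sin x / x"
proof (rule DERIV_nonpos_imp_nonincreasing[OF assms(2)])
  fix t assume t: "x \<le> t" "t \<le> s"
  have "sin t - t * cos t \<ge> 0"
    by (rule nonneg_from_deriv[of _ 0 _ "\<lambda>t. t * sin t"])
      (use t assms in \<open>auto intro!: derivative_eq_intros mult_nonneg_nonneg sin_ge_zero\<close>)
  then have "(t * cos t - sin t) / (t * t) \<le> 0"
    using t assms by (simp add: divide_nonpos_pos)
  moreover have "((\<lambda>t. sin t / t) has_real_derivative ((t * cos t - sin t) / (t * t))) (at t)"
    using t assms by (auto intro!: derivative_eq_intros simp: field_simps)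
  ultimately show "\<exists>y. ((\<lambda>t. sin t / t) has_real_derivative y) (at t) \<and> y \<le> 0" by blast
qed

text \<open>As a function of u = x^2, cosine has slope -sin x / (2 x), so up to pi this is the
  tangent inequality of a convex function, by \<open>sinc_mono\<close>. Past pi the slope
  oscillates, but s <= 2.1 gives sin s / s >= 2/5, and t * 2/5 > 1 >= sin t there. In expectation,
  with s^2 the second moment, it says that the symmetric two-point law minimises the characteristic
  function.\<close>

lemma cos_tangent_square:
  fixes s x :: real
  assumes s: "0 < s" "s \<le> (21/10)"
  shows "cos s - sin s / (2 * s) * (x^2 - s^2) \<le> cos x"
proof -
  define l where "l = sin s / s"
  have l: "l \<ge> (2/5)"
  proof -
    have "sin (21/10) / (21/10) \<le> l" unfolding l_def using s pi_lower by (intro sinc_mono) auto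
    moreover have "sin ((21/10)::real) / (21/10) \<ge> (2/5)"
      using sin_lower7[of "(21/10)"] by (simp add: power_divide)
    ultimately show ?thesis by linarith
  qed
  have *: "0 \<le> cos x - cos s + l/2 * (x^2 - s^2)" if x: "0 \<le> x" for x
  proof (cases "s \<le> x")
    case True
    show ?thesis
    proof (rule nonneg_from_deriv[OF _ True, of _ "\<lambda>t. t * l - sin t"])
      fix t assume t: "s \<le> t" "t \<le> x"
      show "((\<lambda>x. cos x - cos s + l/2 * (x^2 - s^2)) has_real_derivative t * l - sin t) (at t)"
        by (auto intro!: derivative_eq_intros)
      show "0 \<le> t * l - sin t"
      proof (cases "t \<le> pi")
        case True
        then have "sin t / t \<le> l" unfolding l_def using t s by (intro sinc_mono) auto
        then show ?thesis using t s by (simp add: field_simps)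
      next
        case False
        then have "t * l \<ge> (6283/2000) * (2/5)" using l pi_lower by (intro mult_mono) auto
        then show ?thesis using sin_le_one[of t] by linarith
      qed
    qed simp
  next
    case False
    have "(\<lambda>x. cos x - cos s + l/2 * (x^2 - s^2)) s \<le> (\<lambda>x. cos x - cos s + l/2 * (x^2 - s^2)) x"
    proof (rule DERIV_nonpos_imp_nonincreasing[of x s])
      fix t assume t: "x \<le> t" "t \<le> s"
      have "t * l - sin t \<le> 0"
      proof (cases "t = 0")
        case False
        then have "l \<le> sin t / t" unfolding l_def using t x s pi_lower by (intro sinc_mono) auto
        then show ?thesis using False t x by (simp add: field_simps)
      qed simp
      moreover have "((\<lambda>x. cos x - cos s + l/2 * (x^2 - s^2)) has_real_derivative t * l - sin t) (at t)"
        by (auto intro!: derivative_eq_intros)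
      ultimately show "\<exists>y. ((\<lambda>x. cos x - cos s + l/2 * (x^2 - s^2)) has_real_derivative y) (at t) \<and> y \<le> 0"
        by blast
    qed (use False in simp)
    then show ?thesis by simp
  qed
  show ?thesis using *[of "\<bar>x\<bar>"] by (simp add: l_def field_simps)
qed

lemma interval_step:
  fixes s a b :: real
  assumes "s \<le> a \<Longrightarrow> P" "a \<le> s \<Longrightarrow> s \<le> b \<Longrightarrow> P" "s \<le> b"
  shows P
  using assms by linarith

section \<open>Rational bounds for the exponential function\<close>

lemma exp_ge_taylor4:
  assumes "0 \<le> (x::real)"
  shows "1 + x + x^2/2 + x^3/6 + x^4/24 \<le> exp x"
proof -
  obtain t where "exp x = (\<Sum>m<5. x ^ m / fact m) + exp t / fact 5 * x ^ 5"
    using Maclaurin_exp_le[of x 5] by blast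
  moreover have "exp t / fact 5 * x ^ 5 \<ge> 0" using assms by simp
  ultimately show ?thesis by (simp add: eval_nat_numeral)
qed

lemma power_chain_mono:
  fixes t u v :: real
  assumes "0 \<le> u" "u \<le> t" "t^2 \<le> v"
  shows "u^2 \<le> v"
  using power_mono[OF assms(2,1), of 2] assms(3) by linarith

lemma power_chain_mono':
  fixes t u v :: real
  assumes "0 \<le> t" "t \<le> u" "v \<le> t^2"
  shows "v \<le> u^2"
  using power_mono[OF assms(2,1), of 2] assms(3) by linarith

lemma exp_square: "exp (x::real) = exp (x/2)^2"
  by (simp flip: exp_of_nat_mult)

text \<open>Numerical bounds for \<open>exp\<close>: a Taylor bound at a small fraction of the argument, squared repeatedly with rounding after each step.\<close>

lemma exp_lower_chain:
  fixes x y t0 t1 t2 t3 :: real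
  assumes "0 \<le> y" "8 * y \<le> x" "0 \<le> t0" "t0 \<le> 1 + y + y^2/2 + y^3/6 + y^4/24"
    "0 \<le> t1" "t1 \<le> t0^2" "0 \<le> t2" "t2 \<le> t1^2" "t3 \<le> t2^2"
  shows "t3 \<le> exp x"
proof -
  have "t0 \<le> exp y" using exp_ge_taylor4[OF assms(1)] assms(4) by simp
  then have "t1 \<le> exp (2*y)" using power_chain_mono'[OF assms(3) _ assms(6)] exp_square[of "2*y"] by simp
  then have "t2 \<le> exp (4*y)" using power_chain_mono'[OF assms(5) _ assms(8)] exp_square[of "4*y"] by simp
  then have "t3 \<le> exp (8*y)" using power_chain_mono'[OF assms(7) _ assms(9)] exp_square[of "8*y"] by simp
  then show ?thesis using assms(2) by (smt (verit) exp_le_cancel_iff)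
qed

lemma exp_neg_ge_taylor3:
  assumes "0 \<le> (x::real)"
  shows "1 - x + x^2/2 - x^3/6 \<le> exp (-x)"
proof -
  have 1: "1 - t \<le> exp (-t)" for t :: real using exp_ge_add_one_self[of "-t"] by simp
  have 2: "exp (-t) \<le> 1 - t + t^2/2" if "0 \<le> t" for t :: real
    using nonneg_from_deriv[of "\<lambda>t. 1 - t + t^2/2 - exp (-t)" 0 t "\<lambda>t. -1 + t + exp (-t)"] that 1
    by (fastforce intro!: derivative_eq_intros simp: algebra_simps)
  show ?thesis
    using nonneg_from_deriv[of "\<lambda>t. exp (-t) - (1 - t + t^2/2 - t^3/6)" 0 x "\<lambda>t. 1 - t + t^2/2 - exp (-t)"] assms 2
    by (fastforce intro!: derivative_eq_intros simp: algebra_simps)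
qed

lemma exp_upper_chain:
  fixes x y t0 t1 t2 t3 t4 :: real
  assumes "0 \<le> y" "x \<le> 16 * y" "0 < 1 - y + y^2/2 - y^3/6" "1 \<le> t0 * (1 - y + y^2/2 - y^3/6)"
    "t0^2 \<le> t1" "t1^2 \<le> t2" "t2^2 \<le> t3" "t3^2 \<le> t4"
  shows "exp x \<le> t4"
proof -
  \<comment> \<open>Truncating the series of exp y would bound it from below, so \<open>t0\<close>
    instead dominates the reciprocal of a lower bound for exp (-y).\<close>
  have "exp y * (1 - y + y^2/2 - y^3/6) \<le> exp y * exp (-y)"
    using exp_neg_ge_taylor3[OF assms(1)] by (intro mult_left_mono) auto
  also have "\<dots> = 1" by (simp add: exp_minus)
  also note assms(4)
  finally have "exp y \<le> t0" using assms(3) by simp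
  then have "exp (2*y) \<le> t1" using power_chain_mono[OF _ _ assms(5)] exp_square[of "2*y"] by simp
  then have "exp (4*y) \<le> t2" using power_chain_mono[OF _ _ assms(6)] exp_square[of "4*y"] by simp
  then have "exp (8*y) \<le> t3" using power_chain_mono[OF _ _ assms(7)] exp_square[of "8*y"] by simp
  then have "exp (16*y) \<le> t4" using power_chain_mono[OF _ _ assms(8)] exp_square[of "16*y"] by simp
  then show ?thesis using assms(2) by (smt (verit) exp_le_cancel_iff)
qed

text \<open>On a short interval each monotone part of the inequality is frozen at the worse endpoint.\<close>

lemma lower_factor_cell1:
  fixes a b s :: real
  assumes s: "a \<le> s" "s \<le> b" "0 \<le> a" "b \<le> 1571/1000"
    and num: "b/12 + b^3/45 + 19/5760*b^5 + 7/11520*b^7 \<le> 1/10 + 28/1000*a^3 + 23/10000*a^6 + 2645/10000000*a^9 + a^6*(1/10+23/1000*a^3)^3/6"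
  shows "s/12 + s^3/45 + 19/5760* s^5 + 7/11520* s^7 \<le> 1/10 + 28/1000* s^3 + 23/10000* s^6 + 2645/10000000* s^9 + s^6*(1/10+23/1000* s^3)^3/6"
proof -
  have "s/12 + s^3/45 + 19/5760* s^5 + 7/11520* s^7 \<le> b/12 + b^3/45 + 19/5760*b^5 + 7/11520*b^7"
    using s by (intro add_mono mult_left_mono divide_right_mono power_mono) auto
  also note num
  also have "1/10 + 28/1000*a^3 + 23/10000*a^6 + 2645/10000000*a^9 + a^6*(1/10+23/1000*a^3)^3/6 \<le> 1/10 + 28/1000* s^3 + 23/10000* s^6 + 2645/10000000* s^9 + s^6*(1/10+23/1000* s^3)^3/6"
    using s by (intro add_mono mult_left_mono divide_right_mono power_mono mult_mono) auto
  finally show ?thesis .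
qed

text \<open>Let C and E be the Taylor polynomials in \<open>lower_factor1'\<close>. The left side
  times s^3 is 1 - C E, apart from a favourable term of order s^12; the right side times s^3 is Y +
  Y^2/2 + Y^3/6 for Y = 0.1 s^3 + 0.023 s^6. The cells are narrowest around s = 1.4, where the
  margin is smallest.\<close>

lemma lower_factor_poly:
  fixes s :: real
  assumes "0 \<le> s" "s \<le> 1571/1000"
  shows "s/12 + s^3/45 + 19/5760* s^5 + 7/11520* s^7 \<le> 1/10 + 28/1000* s^3 + 23/10000* s^6 + 2645/10000000* s^9 + s^6*(1/10+23/1000* s^3)^3/6"
proof -
  have c0: ?thesis if "s \<le> (941/1000)"
    by (rule lower_factor_cell1[of "0" s "(941/1000)"]) (use that assms in \<open>simp_all add: power_divide\<close>)
  have c1: ?thesis if "s \<le> (543/500)"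
    by (rule interval_step[of s "(941/1000)" _ "(543/500)", OF c0 lower_factor_cell1[of "(941/1000)" s "(543/500)"]]) (use that in \<open>simp_all add: power_divide\<close>)
  have c2: ?thesis if "s \<le> (1163/1000)"
    by (rule interval_step[of s "(543/500)" _ "(1163/1000)", OF c1 lower_factor_cell1[of "(543/500)" s "(1163/1000)"]]) (use that in \<open>simp_all add: power_divide\<close>)
  have c3: ?thesis if "s \<le> (303/250)"
    by (rule interval_step[of s "(1163/1000)" _ "(303/250)", OF c2 lower_factor_cell1[of "(1163/1000)" s "(303/250)"]]) (use that in \<open>simp_all add: power_divide\<close>)
  have c4: ?thesis if "s \<le> (1247/1000)"
    by (rule interval_step[of s "(303/250)" _ "(1247/1000)", OF c3 lower_factor_cell1[of "(303/250)" s "(1247/1000)"]]) (use that in \<open>simp_all add: power_divide\<close>)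
  have c5: ?thesis if "s \<le> (637/500)"
    by (rule interval_step[of s "(1247/1000)" _ "(637/500)", OF c4 lower_factor_cell1[of "(1247/1000)" s "(637/500)"]]) (use that in \<open>simp_all add: power_divide\<close>)
  have c6: ?thesis if "s \<le> (162/125)"
    by (rule interval_step[of s "(637/500)" _ "(162/125)", OF c5 lower_factor_cell1[of "(637/500)" s "(162/125)"]]) (use that in \<open>simp_all add: power_divide\<close>)
  have c7: ?thesis if "s \<le> (657/500)"
    by (rule interval_step[of s "(162/125)" _ "(657/500)", OF c6 lower_factor_cell1[of "(162/125)" s "(657/500)"]]) (use that in \<open>simp_all add: power_divide\<close>)
  have c8: ?thesis if "s \<le> (133/100)"
    by (rule interval_step[of s "(657/500)" _ "(133/100)", OF c7 lower_factor_cell1[of "(657/500)" s "(133/100)"]]) (use that in \<open>simp_all add: power_divide\<close>)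
  have c9: ?thesis if "s \<le> (168/125)"
    by (rule interval_step[of s "(133/100)" _ "(168/125)", OF c8 lower_factor_cell1[of "(133/100)" s "(168/125)"]]) (use that in \<open>simp_all add: power_divide\<close>)
  have c10: ?thesis if "s \<le> (339/250)"
    by (rule interval_step[of s "(168/125)" _ "(339/250)", OF c9 lower_factor_cell1[of "(168/125)" s "(339/250)"]]) (use that in \<open>simp_all add: power_divide\<close>)
  have c11: ?thesis if "s \<le> (171/125)"
    by (rule interval_step[of s "(339/250)" _ "(171/125)", OF c10 lower_factor_cell1[of "(339/250)" s "(171/125)"]]) (use that in \<open>simp_all add: power_divide\<close>)
  have c12: ?thesis if "s \<le> (1379/1000)"
    by (rule interval_step[of s "(171/125)" _ "(1379/1000)", OF c11 lower_factor_cell1[of "(171/125)" s "(1379/1000)"]]) (use that in \<open>simp_all add: power_divide\<close>)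
  have c13: ?thesis if "s \<le> (1389/1000)"
    by (rule interval_step[of s "(1379/1000)" _ "(1389/1000)", OF c12 lower_factor_cell1[of "(1379/1000)" s "(1389/1000)"]]) (use that in \<open>simp_all add: power_divide\<close>)
  have c14: ?thesis if "s \<le> (1399/1000)"
    by (rule interval_step[of s "(1389/1000)" _ "(1399/1000)", OF c13 lower_factor_cell1[of "(1389/1000)" s "(1399/1000)"]]) (use that in \<open>simp_all add: power_divide\<close>)
  have c15: ?thesis if "s \<le> (1409/1000)"
    by (rule interval_step[of s "(1399/1000)" _ "(1409/1000)", OF c14 lower_factor_cell1[of "(1399/1000)" s "(1409/1000)"]]) (use that in \<open>simp_all add: power_divide\<close>)
  have c16: ?thesis if "s \<le> (1419/1000)"
    by (rule interval_step[of s "(1409/1000)" _ "(1419/1000)", OF c15 lower_factor_cell1[of "(1409/1000)" s "(1419/1000)"]]) (use that in \<open>simp_all add: power_divide\<close>)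
  have c17: ?thesis if "s \<le> (1429/1000)"
    by (rule interval_step[of s "(1419/1000)" _ "(1429/1000)", OF c16 lower_factor_cell1[of "(1419/1000)" s "(1429/1000)"]]) (use that in \<open>simp_all add: power_divide\<close>)
  have c18: ?thesis if "s \<le> (1439/1000)"
    by (rule interval_step[of s "(1429/1000)" _ "(1439/1000)", OF c17 lower_factor_cell1[of "(1429/1000)" s "(1439/1000)"]]) (use that in \<open>simp_all add: power_divide\<close>)
  have c19: ?thesis if "s \<le> (1449/1000)"
    by (rule interval_step[of s "(1439/1000)" _ "(1449/1000)", OF c18 lower_factor_cell1[of "(1439/1000)" s "(1449/1000)"]]) (use that in \<open>simp_all add: power_divide\<close>)
  have c20: ?thesis if "s \<le> (73/50)"
    by (rule interval_step[of s "(1449/1000)" _ "(73/50)", OF c19 lower_factor_cell1[of "(1449/1000)" s "(73/50)"]]) (use that in \<open>simp_all add: power_divide\<close>)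
  have c21: ?thesis if "s \<le> (184/125)"
    by (rule interval_step[of s "(73/50)" _ "(184/125)", OF c20 lower_factor_cell1[of "(73/50)" s "(184/125)"]]) (use that in \<open>simp_all add: power_divide\<close>)
  have c22: ?thesis if "s \<le> (371/250)"
    by (rule interval_step[of s "(184/125)" _ "(371/250)", OF c21 lower_factor_cell1[of "(184/125)" s "(371/250)"]]) (use that in \<open>simp_all add: power_divide\<close>)
  have c23: ?thesis if "s \<le> (749/500)"
    by (rule interval_step[of s "(371/250)" _ "(749/500)", OF c22 lower_factor_cell1[of "(371/250)" s "(749/500)"]]) (use that in \<open>simp_all add: power_divide\<close>)
  have c24: ?thesis if "s \<le> (1513/1000)"
    by (rule interval_step[of s "(749/500)" _ "(1513/1000)", OF c23 lower_factor_cell1[of "(749/500)" s "(1513/1000)"]]) (use that in \<open>simp_all add: power_divide\<close>)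
  have c25: ?thesis if "s \<le> (153/100)"
    by (rule interval_step[of s "(1513/1000)" _ "(153/100)", OF c24 lower_factor_cell1[of "(1513/1000)" s "(153/100)"]]) (use that in \<open>simp_all add: power_divide\<close>)
  have c26: ?thesis if "s \<le> (31/20)"
    by (rule interval_step[of s "(153/100)" _ "(31/20)", OF c25 lower_factor_cell1[of "(153/100)" s "(31/20)"]]) (use that in \<open>simp_all add: power_divide\<close>)
  have c27: ?thesis if "s \<le> (1571/1000)"
    by (rule interval_step[of s "(31/20)" _ "(1571/1000)", OF c26 lower_factor_cell1[of "(31/20)" s "(1571/1000)"]]) (use that in \<open>simp_all add: power_divide\<close>)
  show ?thesis by (rule c27) (use assms in simp)
qed

text \<open>Here \<open>c\<close> bounds -cos at the right end through the degree-10 Taylor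
  polynomial, while \<open>e\<close> and \<open>r\<close> are rational bounds for the two
  exponentials at the right and the left end. The pair (\<open>p\<close>, \<open>y\<close>) will be
  (1/10, 23/1000) and (207/1000, 0).\<close>

lemma lower_factor_cell2:
  fixes a b s y p c e r :: real
  assumes s: "a \<le> s" "s \<le> b" "157/100 \<le> a" "b \<le> 2" "0 \<le> y" "0 \<le> p"
    and c: "- (1 - b^2/2 + b^4/24 - b^6/720 + b^8/40320 - b^10/3628800) \<le> c" "0 \<le> c"
    and e: "exp (b^2/2) \<le> e" and r: "r \<le> exp (p*a^3 + y*a^6)" and num: "2 + c * e \<le> r"
  shows "2 - cos s * exp (s^2/2) \<le> exp (p* s^3 + y* s^6)"
proof -
  have "- c \<le> cos b" using s c(1) cos_lower10[of b] by linarith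
  also have "cos b \<le> cos s" using s pi_lower by (intro cos_monotone_0_pi_le) auto
  finally have c': "- cos s \<le> c" by simp
  have "s^2 \<le> b^2" using s by (intro power_mono) auto
  then have "exp (s^2/2) \<le> e"
    by (intro order_trans[OF _ e]) auto
  then have "- cos s * exp (s^2/2) \<le> c * e" using c' c(2) by (intro mult_mono) auto
  then have "2 - cos s * exp (s^2/2) \<le> r" using num by linarith
  also note r
  also have "exp (p*a^3 + y*a^6) \<le> exp (p* s^3 + y* s^6)"
    using s by (intro iffD2[OF exp_le_cancel_iff] add_mono mult_left_mono power_mono) auto
  finally show ?thesis .
qed

lemma lower_factor1:
  fixes s :: real
  assumes "157/100 \<le> s" "s \<le> 1669/1000"
  shows "2 - cos s * exp (s^2/2) \<le> exp ((1/10)* s^3 + (23/1000)* s^6)"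
proof -
  consider "(157/100) \<le> s" "s \<le> (1591/1000)"
    | "(1591/1000) \<le> s" "s \<le> (202/125)"
    | "(202/125) \<le> s" "s \<le> (823/500)"
    | "(823/500) \<le> s" "s \<le> (1669/1000)"
    using assms by linarith
  then show ?thesis
  proof cases
    case 1
    have "exp (((1591/1000))^2/2 :: real) \<le> (3545531/1000000)"
      by (rule exp_upper_chain[of "(79103/1000000)" _ "(541159/500000)" "(1171413/1000000)" "(1372209/1000000)" "(941479/500000)"]) (simp_all add: power_divide)
    moreover have "(2078031/1000000) \<le> exp (((1/10)::real) * ((157/100))^3 + (23/1000) * ((157/100))^6)"
      by (rule exp_lower_chain[of "(91429/1000000)" _ "(547869/500000)" "(1200641/1000000)" "(720769/500000)"]) (simp_all add: power_divide)
    ultimately show ?thesis using 1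
      by (intro lower_factor_cell2[of "(157/100)" s "(1591/1000)" _ _ "(20203/1000000)" "(3545531/1000000)" "(2078031/1000000)"]) (simp_all add: power_divide)
  next
    case 2
    have "exp (((202/125))^2/2 :: real) \<le> (3690537/1000000)"
      by (rule exp_upper_chain[of "(10201/125000)" _ "(1085033/1000000)" "(1177297/1000000)" "(1386029/1000000)" "(1921077/1000000)"]) (simp_all add: power_divide)
    moreover have "(217223/100000) \<le> exp (((1/10)::real) * ((1591/1000))^3 + (23/1000) * ((1591/1000))^6)"
      by (rule exp_lower_chain[of "(9697/100000)" _ "(1101827/1000000)" "(607011/500000)" "(1473849/1000000)"]) (simp_all add: power_divide)
    ultimately show ?thesis using 2
      by (intro lower_factor_cell2[of "(1591/1000)" s "(202/125)" _ _ "(45189/1000000)" "(3690537/1000000)" "(217223/100000)"]) (simp_all add: power_divide)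
  next
    case 3
    have "exp (((823/500))^2/2 :: real) \<le> (3875717/1000000)"
      by (rule exp_upper_chain[of "(84667/1000000)" _ "(544179/500000)" "(296131/250000)" "(701549/500000)" "(492171/250000)"]) (simp_all add: power_divide)
    moreover have "(1148517/500000) \<le> exp (((1/10)::real) * ((202/125))^3 + (23/1000) * ((202/125))^6)"
      by (rule exp_lower_chain[of "(103953/1000000)" _ "(277387/250000)" "(153887/125000)" "(1515597/1000000)"]) (simp_all add: power_divide)
    ultimately show ?thesis using 3
      by (intro lower_factor_cell2[of "(202/125)" s "(823/500)" _ _ "(37567/500000)" "(3875717/1000000)" "(1148517/500000)"]) (simp_all add: power_divide)
  next
    case 4
    have "exp (((1669/1000))^2/2 :: real) \<le> (4026239/1000000)"
      by (rule exp_upper_chain[of "(87049/1000000)" _ "(1090953/1000000)" "(1190179/1000000)" "(1416527/1000000)" "(2006549/1000000)"]) (simp_all add: power_divide)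
    moreover have "(2467871/1000000) \<le> exp (((1/10)::real) * ((823/500))^3 + (23/1000) * ((823/500))^6)"
      by (rule exp_lower_chain[of "(2823/25000)" _ "(559771/500000)" "(626687/500000)" "(785473/500000)"]) (simp_all add: power_divide)
    ultimately show ?thesis using 4
      by (intro lower_factor_cell2[of "(823/500)" s "(1669/1000)" _ _ "(98047/1000000)" "(4026239/1000000)" "(2467871/1000000)"]) (simp_all add: power_divide)
  qed
qed

lemma lower_factor2_aux:
  fixes s :: real
  assumes "157/100 \<le> s" "s \<le> 1913/1000"
  shows "2 - cos s * exp (s^2/2) \<le> exp ((207/1000)* s^3 + 0* s^6)"
proof -
  consider "(157/100) \<le> s" "s \<le> (163/100)"
    | "(163/100) \<le> s" "s \<le> (42/25)"
    | "(42/25) \<le> s" "s \<le> (861/500)"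
    | "(861/500) \<le> s" "s \<le> (879/500)"
    | "(879/500) \<le> s" "s \<le> (1789/1000)"
    | "(1789/1000) \<le> s" "s \<le> (227/125)"
    | "(227/125) \<le> s" "s \<le> (46/25)"
    | "(46/25) \<le> s" "s \<le> (931/500)"
    | "(931/500) \<le> s" "s \<le> (941/500)"
    | "(941/500) \<le> s" "s \<le> (19/10)"
    | "(19/10) \<le> s" "s \<le> (1913/1000)"
    using assms by linarith
  then show ?thesis
  proof cases
    case 1
    have "exp (((163/100))^2/2 :: real) \<le> (3775409/1000000)"
      by (rule exp_upper_chain[of "(83029/1000000)" _ "(67911/62500)" "(147581/125000)" "(139393/100000)" "(1943041/1000000)"]) (simp_all add: power_divide)
    moreover have "(2227887/1000000) \<le> exp (((207/1000)::real) * ((157/100))^3 + 0 * ((157/100))^6)"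
      by (rule exp_lower_chain[of "(100133/1000000)" _ "(1105317/1000000)" "(48869/40000)" "(1492611/1000000)"]) (simp_all add: power_divide)
    ultimately show ?thesis using 1
      by (intro lower_factor_cell2[of "(157/100)" s "(163/100)" _ _ "(5917/100000)" "(3775409/1000000)" "(2227887/1000000)"]) (simp_all add: power_divide)
  next
    case 2
    have "exp (((42/25))^2/2 :: real) \<le> (4101099/1000000)"
      by (rule exp_upper_chain[of "(441/5000)" _ "(109221/100000)" "(1192923/1000000)" "(711533/500000)" "(2025117/1000000)"]) (simp_all add: power_divide)
    moreover have "(1225451/500000) \<le> exp (((207/1000)::real) * ((163/100))^3 + 0 * ((163/100))^6)"
      by (rule exp_lower_chain[of "(56029/500000)" _ "(1118577/1000000)" "(625607/500000)" "(48923/31250)"]) (simp_all add: power_divide)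
    ultimately show ?thesis using 2
      by (intro lower_factor_cell2[of "(163/100)" s "(42/25)" _ _ "(27247/250000)" "(4101099/1000000)" "(1225451/500000)"]) (simp_all add: power_divide)
  next
    case 3
    have "exp (((861/500))^2/2 :: real) \<le> (880979/200000)"
      by (rule exp_upper_chain[of "(46333/500000)" _ "(1097099/1000000)" "(1203627/1000000)" "(724359/500000)" "(65587/31250)"]) (simp_all add: power_divide)
    moreover have "(533693/200000) \<le> exp (((207/1000)::real) * ((42/25))^3 + 0 * ((42/25))^6)"
      by (rule exp_lower_chain[of "(122689/1000000)" _ "(282633/250000)" "(639051/500000)" "(204193/125000)"]) (simp_all add: power_divide)
    ultimately show ?thesis using 3
      by (intro lower_factor_cell2[of "(42/25)" s "(861/500)" _ _ "(15063/100000)" "(880979/200000)" "(533693/200000)"]) (simp_all add: power_divide)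
  next
    case 4
    have "exp (((879/500))^2/2 :: real) \<le> (4689729/1000000)"
      by (rule exp_upper_chain[of "(96581/1000000)" _ "(275351/250000)" "(1213091/1000000)" "(147159/100000)" "(1082789/500000)"]) (simp_all add: power_divide)
    moreover have "(1438827/500000) \<le> exp (((207/1000)::real) * ((861/500))^3 + 0 * ((861/500))^6)"
      by (rule exp_lower_chain[of "(132123/1000000)" _ "(17832/15625)" "(651223/500000)" "(339273/200000)"]) (simp_all add: power_divide)
    ultimately show ?thesis using 4
      by (intro lower_factor_cell2[of "(861/500)" s "(879/500)" _ _ "(93057/500000)" "(4689729/1000000)" "(1438827/500000)"]) (simp_all add: power_divide)
  next
    case 5
    have "exp (((1789/1000))^2/2 :: real) \<le> (990953/200000)"
      by (rule exp_upper_chain[of "(100017/1000000)" _ "(221039/200000)" "(76341/62500)" "(298391/200000)" "(222593/100000)"]) (simp_all add: power_divide)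
    moreover have "(1539593/500000) \<le> exp (((207/1000)::real) * ((879/500))^3 + 0 * ((879/500))^6)"
      by (rule exp_lower_chain[of "(17573/125000)" _ "(230189/200000)" "(662337/500000)" "(1754761/1000000)"]) (simp_all add: power_divide)
    ultimately show ?thesis using 5
      by (intro lower_factor_cell2[of "(879/500)" s "(1789/1000)" _ _ "(216479/1000000)" "(990953/200000)" "(1539593/500000)"]) (simp_all add: power_divide)
  next
    case 6
    have "exp (((227/125))^2/2 :: real) \<le> (5201889/1000000)"
      by (rule exp_upper_chain[of "(51529/500000)" _ "(554281/500000)" "(122891/100000)" "(75511/50000)" "(456153/200000)"]) (simp_all add: power_divide)
    moreover have "(3271381/1000000) \<le> exp (((207/1000)::real) * ((1789/1000))^3 + 0 * ((1789/1000))^6)"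
      by (rule exp_lower_chain[of "(148153/1000000)" _ "(1159689/1000000)" "(672439/500000)" "(226087/125000)"]) (simp_all add: power_divide)
    ultimately show ?thesis using 6
      by (intro lower_factor_cell2[of "(1789/1000)" s "(227/125)" _ _ "(242757/1000000)" "(5201889/1000000)" "(3271381/1000000)"]) (simp_all add: power_divide)
  next
    case 7
    have "exp (((46/25))^2/2 :: real) \<le> (2717599/500000)"
      by (rule exp_upper_chain[of "(529/5000)" _ "(555803/500000)" "(308917/250000)" "(381719/250000)" "(2331351/1000000)"]) (simp_all add: power_divide)
    moreover have "(863629/250000) \<le> exp (((207/1000)::real) * ((227/125))^3 + 0 * ((227/125))^6)"
      by (rule exp_lower_chain[of "(77481/500000)" _ "(291903/250000)" "(1363317/1000000)" "(1858633/1000000)"]) (simp_all add: power_divide)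
    ultimately show ?thesis using 7
      by (intro lower_factor_cell2[of "(227/125)" s "(46/25)" _ _ "(265967/1000000)" "(2717599/500000)" "(863629/250000)"]) (simp_all add: power_divide)
  next
    case 8
    have "exp (((931/500))^2/2 :: real) \<le> (2830639/500000)"
      by (rule exp_upper_chain[of "(54173/500000)" _ "(1114441/1000000)" "(1241979/1000000)" "(96407/62500)" "(148709/62500)"]) (simp_all add: power_divide)
    moreover have "(1815467/500000) \<le> exp (((207/1000)::real) * ((46/25))^3 + 0 * ((46/25))^6)"
      by (rule exp_lower_chain[of "(40297/250000)" _ "(146863/125000)" "(1380399/1000000)" "(1905501/1000000)"]) (simp_all add: power_divide)
    ultimately show ?thesis using 8
      by (intro lower_factor_cell2[of "(46/25)" s "(931/500)" _ _ "(287109/1000000)" "(2830639/500000)" "(1815467/500000)"]) (simp_all add: power_divide)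
  next
    case 9
    have "exp (((941/500))^2/2 :: real) \<le> (5877289/1000000)"
      by (rule exp_upper_chain[of "(55343/500000)" _ "(279263/250000)" "(623903/500000)" "(77851/50000)" "(303039/125000)"]) (simp_all add: power_divide)
    moreover have "(3804937/1000000) \<le> exp (((207/1000)::real) * ((931/500))^3 + 0 * ((931/500))^6)"
      by (rule exp_lower_chain[of "(167039/1000000)" _ "(1181799/1000000)" "(174581/125000)" "(3121/1600)"]) (simp_all add: power_divide)
    ultimately show ?thesis using 9
      by (intro lower_factor_cell2[of "(931/500)" s "(941/500)" _ _ "(306209/1000000)" "(5877289/1000000)" "(3804937/1000000)"]) (simp_all add: power_divide)
  next
    case 10
    have "exp (((19/10))^2/2 :: real) \<le> (6080767/1000000)"
      by (rule exp_upper_chain[of "(112813/1000000)" _ "(1119431/1000000)" "(626563/500000)" "(62813/40000)" "(2465921/1000000)"]) (simp_all add: power_divide)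
    moreover have "(3974201/1000000) \<le> exp (((207/1000)::real) * ((941/500))^3 + 0 * ((941/500))^6)"
      by (rule exp_lower_chain[of "(539/3125)" _ "(594123/500000)" "(176491/125000)" "(99677/50000)"]) (simp_all add: power_divide)
    ultimately show ?thesis using 10
      by (intro lower_factor_cell2[of "(941/500)" s "(19/10)" _ _ "(64659/200000)" "(6080767/1000000)" "(3974201/1000000)"]) (simp_all add: power_divide)
  next
    case 11
    have "exp (((1913/1000))^2/2 :: real) \<le> (1558359/250000)"
      by (rule exp_upper_chain[of "(57181/500000)" _ "(1121167/1000000)" "(157127/125000)" "(158009/100000)" "(499337/200000)"]) (simp_all add: power_divide)
    moreover have "(1034063/250000) \<le> exp (((207/1000)::real) * ((19/10))^3 + 0 * ((19/10))^6)"
      by (rule exp_lower_chain[of "(44369/250000)" _ "(1194197/1000000)" "(713053/500000)" "(1016889/500000)"]) (simp_all add: power_divide)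
    ultimately show ?thesis using 11
      by (intro lower_factor_cell2[of "(19/10)" s "(1913/1000)" _ _ "(335569/1000000)" "(1558359/250000)" "(1034063/250000)"]) (simp_all add: power_divide)
  qed
qed

text \<open>The lower half of the estimate of one factor, for the extremal characteristic function
  cos s. Since 2 - cos s exp (s^2/2) = 1 + s^4/12 + ..., the cubic term, whose 1/10 is dictated by
  \<open>cos_cubic_upper\<close>, is enough only for small s. The sextic term covers the rest up to
  1.669, about the cube root of 4.649.\<close>

lemma lower_factor1':
  fixes s :: real
  assumes s: "0 \<le> s" "s \<le> 1669/1000"
  shows "2 - cos s * exp (s^2/2) \<le> exp ((1/10)* s^3 + (23/1000)* s^6)"
proof (cases "157/100 \<le> s")
  case True then show ?thesis using s lower_factor1 by blast
next
  case False
  then have s: "0 \<le> s" "s \<le> 157/100" using s by auto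
  define v where "v = s^2/2"
  let ?E = "1 + v + v^2/2 + v^3/6 + v^4/24"
  let ?C = "1 - s^2/2 + s^4/24 - s^6/720"
  define Y where "Y = (1/10)* s^3 + (23/1000)* s^6"
  have v: "v \<ge> 0" by (simp add: v_def)
  have Y: "Y \<ge> 0" using s by (simp add: Y_def)
  have "cos s \<ge> 0" using s pi_lower by (intro cos_ge_zero) auto
  then have "?C * ?E \<le> cos s * exp v"
    using cos_lower6[OF s(1)] exp_ge_taylor4[OF v] v
    by (intro order_trans[OF mult_right_mono mult_left_mono]) auto
  moreover have "1 + Y + Y^2/2 + Y^3/6 \<le> exp Y" using exp_ge_taylor4[OF Y] Y by (smt (verit) zero_le_power divide_nonneg_nonneg)
  moreover have "2 - ?C * ?E \<le> 1 + Y + Y^2/2 + Y^3/6"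
  proof -
    have "s^3 * (s/12 + s^3/45 + 19/5760* s^5 + 7/11520* s^7) \<le> s^3 * (1/10 + 28/1000* s^3 + 23/10000* s^6 + 2645/10000000* s^9 + s^6*(1/10+23/1000* s^3)^3/6)"
      using s by (intro mult_left_mono lower_factor_poly) auto
    moreover have "s^3 * (1/10 + 28/1000* s^3 + 23/10000* s^6 + 2645/10000000* s^9 + s^6*(1/10+23/1000* s^3)^3/6) = Y + Y^2/2 + Y^3/6"
    proof -
      define a where "a = s^3"
      define q where "q = 1/10 + 23/1000 * a"
      have a: "s^6 = a^2" "s^9 = a^3" by (simp_all add: a_def flip: power_mult)
      have Yq: "Y = a * q" by (simp add: Y_def a a_def[symmetric] q_def power2_eq_square algebra_simps)
      have "q^2 = 1/100 + 46/10000 * a + 529/1000000 * a^2" by (simp add: q_def power2_eq_square algebra_simps)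
      then have "Y + Y^2/2 = a * (1/10 + 28/1000*a + 23/10000*a^2 + 2645/10000000*a^3)"
        unfolding Yq power_mult_distrib by (simp add: q_def power2_eq_square power3_eq_cube field_simps)
      moreover have "Y^3/6 = a * (a^2 * q^3/6)" unfolding Yq power_mult_distrib by (simp add: power2_eq_square power3_eq_cube)
      ultimately show ?thesis unfolding a a_def[symmetric] q_def[symmetric] by (simp add: algebra_simps)
    qed
    moreover have "1 - ?C * ?E = s^3 * (s/12 + s^3/45 + 19/5760* s^5 + 7/11520* s^7) - s^12 * (11/138240 - s^2/276480)"
    proof -
      have e: "s^4 = (s^2)^2" "s^6 = (s^2)^3" "s^12 = (s^2)^6" "s^3*(s/12 + s^3/45 + 19/5760* s^5 + 7/11520* s^7) = (s^2)^2/12 + (s^2)^3/45 + 19/5760*(s^2)^4 + 7/11520*(s^2)^5"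
        by (simp_all add: eval_nat_numeral algebra_simps)
      show ?thesis unfolding e v_def by (simp add: eval_nat_numeral field_simps)
    qed
    moreover have "s^12 * (11/138240 - s^2/276480) \<ge> 0"
    proof -
      have "s^2 \<le> 2^2" using s by (intro power_mono) auto
      then show ?thesis using s by (intro mult_nonneg_nonneg) auto
    qed
    ultimately show ?thesis by linarith
  qed
  ultimately show ?thesis unfolding v_def Y_def by linarith
qed

text \<open>With z = s^3, the exponents 0.1 z + 0.023 z^2 and 0.207 z cross near z = 4.65. Beyond
  that the linear one is smaller; it serves up to z = 7, which 1.913^3 just exceeds.\<close>

lemma lower_factor2:
  fixes s :: real
  assumes s: "0 \<le> s" "s \<le> 1913/1000"
  shows "2 - cos s * exp (s^2/2) \<le> exp ((207/1000)* s^3)"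
proof (cases "157/100 \<le> s")
  case True then show ?thesis using lower_factor2_aux[of s] s by simp
next
  case False
  have "s^3 \<le> (157/100)^3" using s False by (intro power_mono) auto
  then have "(23/1000)* s^3* s^3 \<le> (107/1000)* s^3" using s by (intro mult_right_mono) (auto simp: power_divide)
  then have "(1/10)* s^3 + (23/1000)* s^6 \<le> (207/1000)* s^3" by (simp add: eval_nat_numeral algebra_simps)
  then have "exp ((1/10)* s^3 + (23/1000)* s^6) \<le> exp ((207/1000)* s^3)" by simp
  then show ?thesis using lower_factor1'[of s] s False by linarith
qed

text \<open>Errors of the form exp e - 1 are stable under products, because (exp a - 1)(exp b - 1) +
  (exp a - 1) + (exp b - 1) = exp (a + b) - 1. This is why the error of a single factor is measured
  in this form.\<close>

lemma prod_near_one: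
  fixes a e :: "'i \<Rightarrow> real"
  assumes "finite I" "\<And>i. i \<in> I \<Longrightarrow> \<bar>a i - 1\<bar> \<le> exp (e i) - 1"
  shows "\<bar>(\<Prod>i\<in>I. a i) - 1\<bar> \<le> exp (\<Sum>i\<in>I. e i) - 1"
  using assms
proof (induction rule: finite_induct)
  case (insert j I)
  define p where "p = (\<Prod>i\<in>I. a i)"
  define E where "E = exp (\<Sum>i\<in>I. e i)"
  have p: "\<bar>p - 1\<bar> \<le> E - 1" and j: "\<bar>a j - 1\<bar> \<le> exp (e j) - 1"
    using insert by (auto simp: p_def E_def)
  have "\<bar>a j * p - 1\<bar> = \<bar>(a j - 1) * (p - 1) + (a j - 1) + (p - 1)\<bar>" by (simp add: algebra_simps)
  also have "\<dots> \<le> \<bar>a j - 1\<bar> * \<bar>p - 1\<bar> + \<bar>a j - 1\<bar> + \<bar>p - 1\<bar>"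
    by (simp add: abs_mult[symmetric])
  also have "\<dots> \<le> (exp (e j) - 1) * (E - 1) + (exp (e j) - 1) + (E - 1)"
    using p j by (intro add_mono mult_mono) linarith+
  also have "\<dots> = exp (e j) * E - 1" by (simp add: algebra_simps)
  finally show ?case using insert by (simp add: p_def E_def exp_add)
qed simp

lemma exp_neg_le_taylor2: "0 \<le> (t::real) \<Longrightarrow> exp (-t) \<le> 1 - t + t^2/2"
proof -
  assume t: "0 \<le> t"
  have 1: "1 - t \<le> exp (-t)" for t :: real using exp_ge_add_one_self[of "-t"] by simp
  show ?thesis
    using nonneg_from_deriv[of "\<lambda>t. 1 - t + t^2/2 - exp (-t)" 0 t "\<lambda>t. -1 + t + exp (-t)"] t 1
    by (fastforce intro!: derivative_eq_intros simp: algebra_simps)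
qed

text \<open>Of the coefficient 0.055, the part 0.023 is already in the exponent, and 0.032 pays for
  the powers of Y = y q from the second on, where q <= 0.207.\<close>

lemma exp_growth1:
  fixes y :: real
  assumes "0 \<le> y" "y \<le> 4649/1000"
  shows "exp (1/10*y + 23/1000*y^2) - 1 \<le> 1/10*y + 55/1000*y^2"
proof -
  define q where "q = 1/10 + 23/1000*y"
  have q: "0 \<le> q" "q \<le> 207/1000" using assms by (auto simp: q_def)
  define Y where "Y = y * q"
  have Y: "0 \<le> Y" "Y \<le> 1" using assms q mult_mono[of y "4649/1000" q "207/1000"] by (auto simp: Y_def)
  \<comment> \<open>1/15 = 1/24 + 3/120: the Lagrange remainder is at most 3 Y^5/120, and Y <=
    1.\<close>
  have up: "exp Y \<le> 1 + Y + Y^2/2 + Y^3/6 + Y^4/15"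
  proof -
    obtain t where t: "\<bar>t\<bar> \<le> \<bar>Y\<bar>" "exp Y = (\<Sum>m<5. Y ^ m / fact m) + exp t / fact 5 * Y ^ 5"
      using Maclaurin_exp_le[of Y 5] by blast
    have "exp t \<le> exp 1" using t Y by simp
    then have "exp t \<le> 3" using exp_le by linarith
    moreover have "Y^5 \<le> Y^4" using Y by (intro power_decreasing) auto
    ultimately have "exp t / fact 5 * Y ^ 5 \<le> 3 / fact 5 * Y^4"
      using Y by (intro mult_mono divide_right_mono) auto
    moreover have "0 \<le> Y^4" using Y by simp
    ultimately show ?thesis using t by (simp add: eval_nat_numeral fact_numeral field_simps)
  qed
  have "Y^2/2 \<le> y^2 * ((207/1000)^2/2)"
    using q by (simp add: Y_def power_mult_distrib mult_left_mono power_mono)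
  moreover have "Y^3/6 \<le> y^2 * ((4649/1000)*(207/1000)^3/6)"
  proof -
    have "y*q^3 \<le> (4649/1000)*(207/1000)^3" using q assms by (intro mult_mono power_mono) auto
    from mult_left_mono[OF this, of "y^2"] show ?thesis
      by (simp add: Y_def power_mult_distrib power2_eq_square power3_eq_cube mult_ac)
  qed
  moreover have "Y^4/15 \<le> y^2 * ((4649/1000)^2*(207/1000)^4/15)"
  proof -
    have "y^2*q^4 \<le> (4649/1000)^2*(207/1000)^4" using q assms by (intro mult_mono power_mono) auto
    from mult_left_mono[OF this, of "y^2"] show ?thesis
      by (simp add: Y_def power_mult_distrib power2_eq_square power4_eq_xxxx mult_ac)
  qed
  ultimately have "exp Y - 1 \<le> Y + y^2 * ((207/1000)^2/2 + (4649/1000)*(207/1000)^3/6 + (4649/1000)^2*(207/1000)^4/15)"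
    using up by (simp only: distrib_left)
  also have "\<dots> \<le> Y + y^2 * (32/1000)" by (intro add_left_mono mult_left_mono) (simp_all add: power_divide)
  finally show ?thesis unfolding Y_def q_def by (simp add: power2_eq_square algebra_simps)
qed

lemma exp_growth2:
  fixes y :: real
  assumes y: "4649/1000 \<le> y" "y \<le> 7"
  shows "exp (207/1000*y) - 1 \<le> 1/10*y + 55/1000*y^2"
proof -
  \<comment> \<open>Centring at 6/5 keeps the shifted exponent within 1/4 of zero on the whole range
    of y.\<close>
  define t where "t = 207/1000*y - 6/5"
  have t: "t \<le> 1/4" "-1/4 \<le> t" using y by (auto simp: t_def)
  have et: "exp t \<le> 1 + t + 56/100*t^2"
  proof (cases "0 \<le> t")
    case True
    obtain u where u: "\<bar>u\<bar> \<le> \<bar>t\<bar>" "exp t = (\<Sum>m<3. t ^ m / fact m) + exp u / fact 3 * t ^ 3"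
      using Maclaurin_exp_le[of t 3] by blast
    have "exp u \<le> exp (1/4)" using u t True by simp
    also have "exp (1/4::real) \<le> 13/10"
      by (rule exp_upper_chain[of "1/64" _ "10158/10000" "10320/10000" "1066/1000" "1138/1000"]) (simp_all add: power_divide)
    finally have "exp u \<le> 13/10" .
    then have "exp u / fact 3 * t ^ 3 \<le> (13/10) / fact 3 * (1/4 * t^2)"
      using t True mult_right_mono[OF t(1), of "t^2"] by (intro mult_mono divide_right_mono) (auto simp: power2_eq_square power3_eq_cube)
    also have "\<dots> \<le> 6/100 * t^2" by (simp add: fact_numeral)
    finally have "exp u / fact 3 * t ^ 3 \<le> 6/100 * t^2" .
    moreover have "exp t = 1 + t + t^2/2 + exp u / fact 3 * t ^ 3"
      using u(2) by (simp add: eval_nat_numeral)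
    ultimately show ?thesis by linarith
  next
    case False
    then have "exp (-(-t)) \<le> 1 - (-t) + (-t)^2/2" by (intro exp_neg_le_taylor2) simp
    then have "exp t \<le> 1 + t + t^2/2" by simp
    then show ?thesis using zero_le_power2[of t] by linarith
  qed
  have "exp (6/5::real) \<le> 3321/1000"
    by (rule exp_upper_chain[of "75/1000" _ "107789/100000" "116185/100000" "134990/100000" "182224/100000"]) (simp_all add: power_divide)
  have "exp (207/1000*y) = exp (6/5) * exp t" by (simp add: t_def flip: exp_add)
  also have "\<dots> \<le> 3321/1000 * (1 + t + 56/100*t^2)"
    using et \<open>exp (6/5::real) \<le> 3321/1000\<close> by (intro mult_mono) auto
  finally have 1: "exp (207/1000*y) \<le> 3321/1000 * (1 + t + 56/100*t^2)" .
  \<comment> \<open>Left minus right of the next inequality is a convex quadratic in y, hence below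
    its chord over the range; this product expresses exactly that.\<close>
  have "(y - 4649/1000) * (7 - y) \<ge> 0" using y by simp
  then have "3321/1000 * (1 + t + 56/100*t^2) \<le> 1 + 1/10*y + 55/1000*y^2"
    using y unfolding t_def power2_eq_square by (simp add: field_simps)
  with 1 show ?thesis by simp
qed

text \<open>The tangent inequality of x^3 as a function of x^2 at c^2. In expectation it yields
  Lyapunov's inequality between the second and the third absolute moment.\<close>

lemma lyapunov_aux: "0 \<le> x \<Longrightarrow> 0 \<le> c \<Longrightarrow> 0 \<le> 2*x^3 - 3*c*x^2 + (c::real)^3"
proof -
  assume "0 \<le> x" "0 \<le> c"
  then have "0 \<le> (x-c)^2*(2*x+c)" by simp
  then show ?thesis by (simp add: power2_eq_square power3_eq_cube algebra_simps)
qed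

section \<open>Characteristic functions of symmetric summands\<close>

text \<open>Index set and scale are left open because the locale is instantiated with the given
  variables and, through its extension by moment assumptions, with their truncated and rescaled
  versions.\<close>

locale indep_symmetric = prob_space M for M :: "'a measure" +
  fixes I :: "'i set" and Y :: "'i \<Rightarrow> 'a \<Rightarrow> real"
  assumes finI: "finite I"
    and indep: "indep_vars (\<lambda>_. borel) Y I"
    and symm: "\<And>i. i \<in> I \<Longrightarrow> distr M borel (Y i) = distr M borel (\<lambda>\<omega>. - Y i \<omega>)"
begin

lemma rv [measurable]: "i \<in> I \<Longrightarrow> Y i \<in> borel_measurable M"
  using indep by (auto simp: indep_vars_def)

definition S :: "'a \<Rightarrow> real" where "S \<omega> = (\<Sum>i\<in>I. Y i \<omega>)"

lemma S_measurable [measurable]: "S \<in> borel_measurable M"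
  unfolding S_def by measurable

text \<open>By symmetry the characteristic function is real, so the cosine mean is all of
  it.\<close>

definition cf :: "'i \<Rightarrow> real \<Rightarrow> real" where "cf i t = expectation (\<lambda>\<omega>. cos (t * Y i \<omega>))"

lemma char_Y: assumes i: "i \<in> I" shows "char (distr M borel (Y i)) t = of_real (cf i t)"
proof -
  have [measurable]: "Y i \<in> borel_measurable M" using i by simp
  have "expectation (\<lambda>\<omega>. sin (t * Y i \<omega>)) = (\<integral>x. sin (t * x) \<partial>distr M borel (Y i))"
    by (subst integral_distr) auto
  also have "\<dots> = (\<integral>x. sin (t * x) \<partial>distr M borel (\<lambda>\<omega>. - Y i \<omega>))" by (simp only: symm[OF i])
  also have "\<dots> = - expectation (\<lambda>\<omega>. sin (t * Y i \<omega>))"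
    by (subst integral_distr) auto
  finally have 0: "expectation (\<lambda>\<omega>. sin (t * Y i \<omega>)) = 0" by simp
  have int: "integrable M (\<lambda>\<omega>. iexp (t * Y i \<omega>))"
    using integrable_iexp[of "\<lambda>\<omega>. of_real (t * Y i \<omega>)"] by simp
  have "char (distr M borel (Y i)) t = (CLINT \<omega>|M. iexp (t * Y i \<omega>))"
    unfolding char_def by (subst integral_distr) auto
  also have "\<dots> = of_real (cf i t)"
  proof (rule complex_eqI)
    show "Re (CLINT \<omega>|M. iexp (t * Y i \<omega>)) = Re (of_real (cf i t))"
      using integral_Re[OF int] by (simp add: cf_def Re_exp)
    show "Im (CLINT \<omega>|M. iexp (t * Y i \<omega>)) = Im (of_real (cf i t))"
      using integral_Im[OF int] 0 by (simp add: Im_exp)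
  qed
  finally show ?thesis .
qed

lemma char_S: "(CLINT \<omega>|M. iexp (t * S \<omega>)) = of_real (\<Prod>i\<in>I. cf i t)"
proof -
  have "(CLINT \<omega>|M. iexp (t * S \<omega>)) = char (distr M borel S) t"
    unfolding char_def by (subst integral_distr) auto
  also have "\<dots> = (\<Prod>i\<in>I. char (distr M borel (Y i)) t)"
    using char_distr_sum[OF indep] by (simp add: S_def[abs_def])
  also have "\<dots> = of_real (\<Prod>i\<in>I. cf i t)" by (simp add: char_Y)
  finally show ?thesis .
qed

lemma cos_S: "expectation (\<lambda>\<omega>. cos (t * S \<omega>)) = (\<Prod>i\<in>I. cf i t)"
  and sin_S: "expectation (\<lambda>\<omega>. sin (t * S \<omega>)) = 0"
proof -
  have int: "integrable M (\<lambda>\<omega>. iexp (t * S \<omega>))"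
    using integrable_iexp[of "\<lambda>\<omega>. of_real (t * S \<omega>)"] by simp
  show "expectation (\<lambda>\<omega>. cos (t * S \<omega>)) = (\<Prod>i\<in>I. cf i t)"
    using integral_Re[OF int] char_S[of t] by (simp add: Re_exp del: of_real_prod)
  show "expectation (\<lambda>\<omega>. sin (t * S \<omega>)) = 0"
    using integral_Im[OF int] char_S[of t] by (simp add: Im_exp del: of_real_prod)
qed

end

locale indep_symmetric3 = indep_symmetric M I Y
  for M :: "'a measure" and I :: "'i set" and Y :: "'i \<Rightarrow> 'a \<Rightarrow> real" +
  assumes int2: "\<And>i. i \<in> I \<Longrightarrow> integrable M (\<lambda>\<omega>. (Y i \<omega>)^2)"
    and int3: "\<And>i. i \<in> I \<Longrightarrow> integrable M (\<lambda>\<omega>. \<bar>Y i \<omega>\<bar>^3)"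
    and var1: "(\<Sum>i\<in>I. expectation (\<lambda>\<omega>. (Y i \<omega>)^2)) = 1"
begin

definition v :: "'i \<Rightarrow> real" where "v i = expectation (\<lambda>\<omega>. (Y i \<omega>)^2)"
definition b :: "'i \<Rightarrow> real" where "b i = expectation (\<lambda>\<omega>. \<bar>Y i \<omega>\<bar>^3)"
definition m :: real where "m = (\<Sum>i\<in>I. b i)"

lemma v_nonneg: "0 \<le> v i" and b_nonneg: "0 \<le> b i"
  by (simp_all add: v_def b_def)

lemma lyapunov: assumes i: "i \<in> I" shows "sqrt (v i) ^ 3 \<le> b i"
proof -
  have [measurable]: "Y i \<in> borel_measurable M" using i by simp
  define c where "c = sqrt (v i)"
  have c: "0 \<le> c" "c^2 = v i" using v_nonneg by (auto simp: c_def)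
  have "0 \<le> 2 * \<bar>Y i \<omega>\<bar>^3 - 3 * c * (Y i \<omega>)^2 + c^3" for \<omega>
    using lyapunov_aux[OF abs_ge_zero c(1), of "Y i \<omega>"] by simp
  then have "0 \<le> expectation (\<lambda>\<omega>. 2 * \<bar>Y i \<omega>\<bar>^3 - 3 * c * (Y i \<omega>)^2 + c^3)"
    by (intro Bochner_Integration.integral_nonneg)
  also have "\<dots> = 2 * b i - 3 * c * v i + c^3"
    using int2[OF i] int3[OF i] by (simp add: b_def v_def prob_space)
  also have "\<dots> = 2 * b i - 2 * c^3" by (simp flip: c(2) add: power2_eq_square power3_eq_cube)
  finally show ?thesis by (simp add: c_def)
qed

lemma cf_upper: assumes i: "i \<in> I" and t: "0 \<le> t" shows "cf i t \<le> 1 - v i * t^2 / 2 + b i * t^3 / 10"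
proof -
  have [measurable]: "Y i \<in> borel_measurable M" using i by simp
  note ints = int2[OF i] int3[OF i]
  have "cf i t \<le> expectation (\<lambda>\<omega>. 1 - t^2/2 * (Y i \<omega>)^2 + t^3/10 * \<bar>Y i \<omega>\<bar>^3)"
    unfolding cf_def
  proof (rule integral_mono)
    show "integrable M (\<lambda>\<omega>. cos (t * Y i \<omega>))"
      by (intro integrable_const_bound[of _ 1]) auto
    show "cos (t * Y i \<omega>) \<le> 1 - t^2/2 * (Y i \<omega>)^2 + t^3/10 * \<bar>Y i \<omega>\<bar>^3" for \<omega>
      using cos_cubic_upper[of "t * Y i \<omega>"] t by (simp add: power_mult_distrib abs_mult)
  qed (use ints in auto)
  also have "\<dots> = 1 - v i * t^2 / 2 + b i * t^3 / 10"
    using ints by (simp add: b_def v_def prob_space mult_ac)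
  finally show ?thesis .
qed

lemma cf_neg_upper: assumes i: "i \<in> I" and t: "0 \<le> t"
  shows "- cf i t \<le> 1 - v i * t^2 / 2 + 381/2000 * b i * t^3"
proof -
  have [measurable]: "Y i \<in> borel_measurable M" using i by simp
  note ints = int2[OF i] int3[OF i]
  have "expectation (\<lambda>\<omega>. - cos (t * Y i \<omega>)) \<le> expectation (\<lambda>\<omega>. 1 - t^2/2 * (Y i \<omega>)^2 + 381/2000 * t^3 * \<bar>Y i \<omega>\<bar>^3)"
  proof (rule integral_mono)
    show "integrable M (\<lambda>\<omega>. - cos (t * Y i \<omega>))"
      by (intro integrable_const_bound[of _ 1]) auto
    show "- cos (t * Y i \<omega>) \<le> 1 - t^2/2 * (Y i \<omega>)^2 + 381/2000 * t^3 * \<bar>Y i \<omega>\<bar>^3" for \<omega>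
      using neg_cos_cubic_upper[of "t * Y i \<omega>"] t by (simp add: power_mult_distrib abs_mult)
  qed (use ints in auto)
  also have "\<dots> = 1 - v i * t^2 / 2 + 381/2000 * b i * t^3"
    using ints by (simp add: b_def v_def prob_space mult_ac)
  finally show ?thesis by (simp add: cf_def)
qed

lemma cf_abs: assumes i: "i \<in> I" and t: "0 \<le> t"
  shows "\<bar>cf i t\<bar> \<le> exp (- v i * t^2 / 2 + 381/2000 * b i * t^3)"
proof -
  have "b i * t^3 / 10 \<le> 381/2000 * b i * t^3" using b_nonneg[of i] t by (simp add: mult_right_mono)
  then have "\<bar>cf i t\<bar> \<le> 1 + (- v i * t^2 / 2 + 381/2000 * b i * t^3)"
    using cf_upper[OF assms] cf_neg_upper[OF assms] by simp
  also have "\<dots> \<le> exp (- v i * t^2 / 2 + 381/2000 * b i * t^3)" by (rule exp_ge_add_one_self)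
  finally show ?thesis .
qed

lemma cf_lower: assumes i: "i \<in> I" and t: "0 \<le> t" "t * sqrt (v i) \<le> 2.1"
  shows "cos (t * sqrt (v i)) \<le> cf i t"
proof (cases "t * sqrt (v i) = 0")
  case True
  show ?thesis
  proof (cases "t = 0")
    case False
    then have "v i = 0" using True by simp
    have "1 - v i * t^2/2 \<le> cf i t"
    proof -
      have [measurable]: "Y i \<in> borel_measurable M" using i by simp
      have "expectation (\<lambda>\<omega>. 1 - t^2/2 * (Y i \<omega>)^2) \<le> cf i t"
        unfolding cf_def
      proof (rule integral_mono)
        show "integrable M (\<lambda>\<omega>. cos (t * Y i \<omega>))"
          by (intro integrable_const_bound[of _ 1]) auto
        show "1 - t^2/2 * (Y i \<omega>)^2 \<le> cos (t * Y i \<omega>)" for \<omega>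
          using cos_lower2[of "\<bar>t * Y i \<omega>\<bar>"] by (simp add: power_mult_distrib)
      qed (use int2[OF i] in auto)
      then show ?thesis using int2[OF i] by (simp add: v_def prob_space mult_ac)
    qed
    then show ?thesis using \<open>v i = 0\<close> by simp
  qed (simp add: cf_def prob_space)
next
  case False
  define s where "s = t * sqrt (v i)"
  have s: "0 < s" "s \<le> 2.1" using False t v_nonneg[of i] by (auto simp: s_def less_le)
  have [measurable]: "Y i \<in> borel_measurable M" using i by simp
  have "expectation (\<lambda>\<omega>. cos s - sin s / (2 * s) * (t^2 * (Y i \<omega>)^2 - s^2)) \<le> cf i t"
    unfolding cf_def
  proof (rule integral_mono)
    show "integrable M (\<lambda>\<omega>. cos (t * Y i \<omega>))"
      by (intro integrable_const_bound[of _ 1]) auto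
    show "cos s - sin s / (2 * s) * (t^2 * (Y i \<omega>)^2 - s^2) \<le> cos (t * Y i \<omega>)" for \<omega>
      using cos_tangent_square[OF s(1), of "t * Y i \<omega>"] s by (simp add: power_mult_distrib)
  qed (use int2[OF i] in auto)
  moreover have "expectation (\<lambda>\<omega>. cos s - sin s / (2 * s) * (t^2 * (Y i \<omega>)^2 - s^2)) = cos s - sin s / (2 * s) * (t^2 * v i - s^2)"
    using int2[OF i] by (simp add: v_def prob_space)
  moreover have "t^2 * v i - s^2 = 0" using v_nonneg[of i] by (simp add: s_def power_mult_distrib)
  ultimately show ?thesis by (simp add: s_def)
qed

lemma cf_prod_abs:
  assumes t: "0 \<le> t"
  shows "\<bar>(\<Prod>i\<in>I. cf i t)\<bar> \<le> exp (-(t^2)/2 + 381/2000 * (m * t^3))"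
proof -
  have "\<bar>(\<Prod>i\<in>I. cf i t)\<bar> = (\<Prod>i\<in>I. \<bar>cf i t\<bar>)" by (rule abs_prod)
  also have "\<dots> \<le> (\<Prod>i\<in>I. exp (- v i * t^2 / 2 + 381/2000 * b i * t^3))"
    using cf_abs t by (intro prod_mono) auto
  also have "\<dots> = exp (\<Sum>i\<in>I. - v i * t^2 / 2 + 381/2000 * b i * t^3)"
    using finI by (simp add: exp_sum)
  also have "(\<Sum>i\<in>I. - v i * t^2 / 2 + 381/2000 * b i * t^3) = - (\<Sum>i\<in>I. v i) * t^2/2 + 381/2000 * (m * t^3)"
    by (simp add: sum.distrib m_def sum_distrib_left sum_distrib_right sum_negf sum_subtractf sum_divide_distrib mult_ac)
  finally show ?thesis using var1 by (simp add: v_def)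
qed

text \<open>Multiplied by exp (v i t^2/2), each factor is near 1 and \<open>prod_near_one\<close>
  applies. The exponent \<open>E\<close> is abstract since two of them are used: \<open>E1\<close>
  serves the upper side, \<open>E2\<close> the lower side at s = t sqrt (v i), and \<open>E3\<close>
  carries the latter from s^3 to b i t^3 by Lyapunov's inequality.\<close>

lemma cf_prod_diff_aux:
  fixes E :: "real \<Rightarrow> real"
  assumes t: "0 \<le> t" and y: "m * t^3 \<le> y" "y \<le> 7"
    and E1: "\<And>z. 0 \<le> z \<Longrightarrow> z \<le> y \<Longrightarrow> z / 10 \<le> E z"
    and E2: "\<And>s. 0 \<le> s \<Longrightarrow> s^3 \<le> y \<Longrightarrow> 2 - cos s * exp (s^2/2) \<le> exp (E (s^3))"
    and E3: "\<And>z z'. 0 \<le> z \<Longrightarrow> z \<le> z' \<Longrightarrow> z' \<le> y \<Longrightarrow> E z \<le> E z'"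
  shows "\<bar>(\<Prod>i\<in>I. cf i t) - exp (-(t^2)/2)\<bar> \<le> exp (-(t^2)/2) * (exp (\<Sum>i\<in>I. E (b i * t^3)) - 1)"
proof -
  define a where "a i = cf i t * exp (v i * t^2/2)" for i
  have "\<bar>a i - 1\<bar> \<le> exp (E (b i * t^3)) - 1" if i: "i \<in> I" for i
  proof -
    have "b i \<le> m" unfolding m_def using finI i b_nonneg by (intro member_le_sum) auto
    then have bi: "b i * t^3 \<le> y" "0 \<le> b i * t^3"
      using y b_nonneg[of i] t mult_right_mono[of "b i" m "t^3"] by auto
    define s where "s = t * sqrt (v i)"
    have s: "0 \<le> s" "s^3 \<le> b i * t^3" "s^2 = v i * t^2"
      using t v_nonneg[of i] mult_right_mono[OF lyapunov[OF i], of "t^3"]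
      by (auto simp: s_def power_mult_distrib mult.commute)
    \<comment> \<open>Here s^3 <= 7 < 2.1^3, which brings s into the range of
      \<open>cf_lower\<close>.\<close>
    have s21: "s \<le> 2.1"
    proof (rule ccontr)
      assume "\<not> s \<le> 2.1"
      then have "2.1^3 \<le> s^3" by (intro power_mono) auto
      then show False using s bi y by (simp add: power_divide)
    qed
    have "a i \<le> exp (E (b i * t^3))"
    proof -
      have "cf i t \<le> 1 + (-(s^2)/2 + b i * t^3 / 10)" using cf_upper[OF i t] s by simp
      also have "\<dots> \<le> exp (-(s^2)/2 + b i * t^3 / 10)" by (rule exp_ge_add_one_self)
      finally have "a i \<le> exp (-(s^2)/2 + b i * t^3 / 10) * exp (s^2/2)"
        unfolding a_def s(3)[symmetric] by (intro mult_right_mono) auto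
      also have "\<dots> = exp (b i * t^3 / 10)" by (simp flip: exp_add)
      also have "\<dots> \<le> exp (E (b i * t^3))" using E1 bi by simp
      finally show ?thesis .
    qed
    moreover have "2 - a i \<le> exp (E (b i * t^3))"
    proof -
      have "cos s * exp (s^2/2) \<le> a i"
        unfolding a_def s(3)[symmetric] using cf_lower[OF i t] s21 by (intro mult_right_mono) (auto simp: s_def)
      then have "2 - a i \<le> exp (E (s^3))" using E2[OF s(1)] s bi by linarith
      also have "\<dots> \<le> exp (E (b i * t^3))" using E3 s bi by simp
      finally show ?thesis .
    qed
    ultimately show ?thesis by linarith
  qed
  from prod_near_one[OF finI this]
  have *: "\<bar>(\<Prod>i\<in>I. a i) - 1\<bar> \<le> exp (\<Sum>i\<in>I. E (b i * t^3)) - 1" .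
  have "(\<Prod>i\<in>I. exp (v i * t^2/2)) = exp (t^2/2)"
    using var1 finI by (simp flip: exp_sum sum_divide_distrib sum_distrib_right add: v_def)
  then have pa: "(\<Prod>i\<in>I. a i) = (\<Prod>i\<in>I. cf i t) * exp (t^2/2)" by (simp add: a_def prod.distrib)
  have "(\<Prod>i\<in>I. cf i t) - exp (-(t^2)/2) = exp (-(t^2)/2) * ((\<Prod>i\<in>I. a i) - 1)"
    unfolding pa by (simp add: algebra_simps flip: exp_add)
  then show ?thesis using mult_left_mono[OF *, of "exp (-(t^2)/2)"] by (simp add: abs_mult)
qed

text \<open>At z = 4.649 the proof changes from the quadratic to the linear exponent, near their
  crossing. Both are superadditive on nonnegative arguments, so the sum of the exponents is at most
  the exponent at the total z.\<close>

lemma cf_prod_diff: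
  assumes t: "0 \<le> t" and y: "m * t^3 \<le> 7"
  shows "\<bar>(\<Prod>i\<in>I. cf i t) - exp (-(t^2)/2)\<bar> \<le> exp (-(t^2)/2) * (1/10 * (m * t^3) + 55/1000 * (m * t^3)^2)"
proof -
  define z where "z = m * t^3"
  have bt: "0 \<le> b i * t^3" for i using b_nonneg[of i] t by simp
  have sum: "(\<Sum>i\<in>I. b i * t^3) = z" by (simp add: z_def m_def sum_distrib_right)
  have z0: "0 \<le> z" using sum bt by (metis sum_nonneg)
  show ?thesis
  proof (cases "z \<le> 4649/1000")
    case True
    define E where "E x = 1/10 * x + 23/1000 * x^2" for x :: real
    have "\<bar>(\<Prod>i\<in>I. cf i t) - exp (-(t^2)/2)\<bar> \<le> exp (-(t^2)/2) * (exp (\<Sum>i\<in>I. E (b i * t^3)) - 1)"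
    proof (rule cf_prod_diff_aux[OF t, of z])
      show "2 - cos s * exp (s^2/2) \<le> exp (E (s^3))" if s: "0 \<le> s" "s^3 \<le> z" for s
      proof -
        have "s \<le> 1669/1000"
        proof (rule ccontr)
          assume "\<not> s \<le> 1669/1000"
          then have "(1669/1000)^3 \<le> s^3" by (intro power_mono) auto
          then show False using s True by (simp add: power_divide)
        qed
        from lower_factor1'[OF s(1) this] show ?thesis by (simp add: E_def flip: power_mult)
      qed
      show "E w \<le> E w'" if "0 \<le> w" "w \<le> w'" for w w'
        using that power_mono[OF that(2,1), of 2] unfolding E_def by linarith
    qed (use y True in \<open>auto simp: z_def E_def\<close>)
    also have "(\<Sum>i\<in>I. E (b i * t^3)) \<le> E z"
    proof -
      have "(\<Sum>i\<in>I. (b i * t^3)^2) \<le> (\<Sum>i\<in>I. (b i * t^3) * z)"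
        unfolding power2_eq_square
      proof (intro sum_mono mult_left_mono)
        fix i assume "i \<in> I"
        then show "b i * t^3 \<le> z" unfolding sum[symmetric] using finI bt by (intro member_le_sum) auto
      qed (use bt in auto)
      also have "\<dots> = z^2" by (subst sum_distrib_right[symmetric]) (simp add: sum power2_eq_square)
      finally have "(\<Sum>i\<in>I. (b i * t^3)^2) \<le> z^2" .
      moreover have "(\<Sum>i\<in>I. E (b i * t^3)) = 1/10 * z + 23/1000 * (\<Sum>i\<in>I. (b i * t^3)^2)"
        by (simp only: E_def sum.distrib sum_distrib_left[symmetric] sum)
      ultimately show ?thesis by (simp add: E_def)
    qed
    then have "exp (-(t^2)/2) * (exp (\<Sum>i\<in>I. E (b i * t^3)) - 1) \<le> exp (-(t^2)/2) * (exp (E z) - 1)"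
      by (intro mult_left_mono) auto
    also have "\<dots> \<le> exp (-(t^2)/2) * (1/10 * z + 55/1000 * z^2)"
      using exp_growth1[OF z0 True] by (intro mult_left_mono) (auto simp: E_def)
    finally show ?thesis by (simp add: z_def)
  next
    case False
    define E where "E x = 207/1000 * x" for x :: real
    have "\<bar>(\<Prod>i\<in>I. cf i t) - exp (-(t^2)/2)\<bar> \<le> exp (-(t^2)/2) * (exp (\<Sum>i\<in>I. E (b i * t^3)) - 1)"
    proof (rule cf_prod_diff_aux[OF t, of z])
      show "2 - cos s * exp (s^2/2) \<le> exp (E (s^3))" if s: "0 \<le> s" "s^3 \<le> z" for s
      proof -
        have "s \<le> 1913/1000"
        proof (rule ccontr)
          assume "\<not> s \<le> 1913/1000"
          then have "(1913/1000)^3 \<le> s^3" by (intro power_mono) auto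
          then show False using s y by (simp add: power_divide z_def)
        qed
        from lower_factor2[OF s(1) this] show ?thesis by (simp add: E_def)
      qed
    qed (use y in \<open>auto simp: z_def E_def\<close>)
    also have "(\<Sum>i\<in>I. E (b i * t^3)) = E z"
      by (simp only: E_def sum_distrib_left[symmetric] sum)
    also have "exp (-(t^2)/2) * (exp (E z) - 1) \<le> exp (-(t^2)/2) * (1/10 * z + 55/1000 * z^2)"
      using exp_growth2[of z] False y by (intro mult_left_mono) (auto simp: E_def z_def)
    finally show ?thesis by (simp add: z_def)
  qed
qed

end

section \<open>Prawitz's trigonometric majorant\<close>

abbreviation U :: "real measure" where "U \<equiv> restrict_space lborel {0..1}"

lemma finite_U: "finite_measure U"
  by (rule finite_measureI) (simp add: emeasure_restrict_space space_restrict_space)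

lemma measure_U [simp]: "measure U {0..1} = 1"
  by (simp add: measure_def emeasure_restrict_space)

lemma space_U [simp]: "space U = {0..1}" by (simp add: space_restrict_space)

lemma integrable_U:
  fixes f :: "real \<Rightarrow> real"
  assumes [measurable]: "f \<in> borel_measurable borel" and "\<And>s. 0 \<le> s \<Longrightarrow> s \<le> 1 \<Longrightarrow> \<bar>f s\<bar> \<le> B"
  shows "integrable U f"
proof -
  interpret finite_measure U by (rule finite_U)
  show ?thesis
    by (rule integrable_const_bound[of _ B])
      (use assms in \<open>auto intro!: AE_I2 measurable_restrict_space1\<close>)
qed

lemma integral_U_FTC:
  fixes F f :: "real \<Rightarrow> real"
  assumes "\<And>s. 0 \<le> s \<Longrightarrow> s \<le> 1 \<Longrightarrow> (F has_real_derivative f s) (at s)"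
    and "\<And>s. 0 \<le> s \<Longrightarrow> s \<le> 1 \<Longrightarrow> isCont f s"
  shows "(\<integral>s. f s \<partial>U) = F 1 - F 0"
proof -
  have "(\<integral>s. f s \<partial>U) = (\<integral>s. f s * indicator {0..1} s \<partial>lborel)"
    by (subst integral_restrict_space) (auto simp: mult.commute)
  also have "\<dots> = F 1 - F 0" by (rule integral_FTC_Icc_real) (use assms in auto)
  finally show ?thesis .
qed

lemma AE_U_interior: "AE s in U. 0 < s \<and> s < 1"
proof -
  have "AE s in lborel. s \<noteq> 0 \<and> s \<noteq> (1::real)"
    using AE_lborel_singleton[of 0] AE_lborel_singleton[of "1::real"] by (auto elim: AE_mp)
  then show ?thesis by (subst AE_restrict_space_iff) (auto elim: AE_mp)
qed

text \<open>The cosine transform of a triangle, that is a Fejer kernel: nonnegative, and later the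
  majorant in \<open>prawitz\<close>.\<close>

definition tri :: "real \<Rightarrow> real" where "tri a = (\<integral>s. (1 - s) * cos (a * s) \<partial>U)"

lemma tri_eq: "a \<noteq> 0 \<Longrightarrow> tri a = (1 - cos a) / a^2"
proof -
  assume a: "a \<noteq> 0"
  have "tri a = (\<lambda>s. (1 - s) * sin (a * s) / a - cos (a * s) / a^2) 1 - (\<lambda>s. (1 - s) * sin (a * s) / a - cos (a * s) / a^2) 0"
    unfolding tri_def using a
    by (intro integral_U_FTC) (auto intro!: derivative_eq_intros simp: power2_eq_square field_simps)
  then show ?thesis by (simp add: diff_divide_distrib)
qed

lemma tri_0: "tri 0 = 1/2"
proof -
  have "tri 0 = (\<lambda>s. s - s^2/2) 1 - (\<lambda>s. s - s^2/2) (0::real)"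
    unfolding tri_def by (intro integral_U_FTC) (auto intro!: derivative_eq_intros)
  then show ?thesis by simp
qed

lemma tri_shift: "0 < w \<Longrightarrow> tri (2 * pi * real n + w) = (1 - cos w) / (2 * pi * real n + w)^2"
proof -
  assume "0 < w"
  then have "2 * pi * real n + w \<noteq> 0" using pi_gt_zero by (smt (verit) mult_nonneg_nonneg of_nat_0_le_iff)
  moreover have "cos (2 * pi * real n + w) = cos w"
    using cos_2npi[of n] sin_2npi[of n] by (simp add: cos_add mult_ac)
  ultimately show ?thesis by (simp add: tri_eq)
qed

text \<open>The Riemann-Lebesgue lemma for an orthogonal system: by Bessel's inequality the squared
  coefficients are summable, hence tend to 0. The squared norm 1/2 explains the factor 2 in the
  projection \<open>g\<close>.\<close>

lemma bessel_tendsto_0: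
  fixes e :: "nat \<Rightarrow> real \<Rightarrow> real" and h :: "real \<Rightarrow> real"
  assumes [measurable]: "\<And>n. e n \<in> borel_measurable borel" "h \<in> borel_measurable borel"
    and e: "\<And>n s. \<bar>e n s\<bar> \<le> 1" and h: "\<And>s. 0 \<le> s \<Longrightarrow> s \<le> 1 \<Longrightarrow> \<bar>h s\<bar> \<le> B"
    and orth: "\<And>n m. (\<integral>s. e n s * e m s \<partial>U) = (if n = m then 1/2 else 0)"
  shows "(\<lambda>n. (\<integral>s. h s * e n s \<partial>U)) \<longlonglongrightarrow> 0"
proof -
  define a where "a n = (\<integral>s. h s * e n s \<partial>U)" for n
  have B: "0 \<le> B" using h[of 0] by simp
  have i1: "integrable U (\<lambda>s. h s * e n s)" for n
    by (rule integrable_U[of _ "B * 1"]) (use h e B in \<open>auto simp: abs_mult simp del: mult_1_right intro!: mult_mono\<close>)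
  have i2: "integrable U (\<lambda>s. e n s * e k s)" for n k
    by (rule integrable_U[of _ 1]) (use e in \<open>auto simp: abs_mult intro!: mult_le_one\<close>)
  have i3: "integrable U (\<lambda>s. h s * h s)"
  proof (rule integrable_U[of _ "B * B"])
    fix s :: real assume "0 \<le> s" "s \<le> 1"
    then have "\<bar>h s\<bar> * \<bar>h s\<bar> \<le> B * B" using h B by (intro mult_mono) auto
    then show "\<bar>h s * h s\<bar> \<le> B * B" unfolding abs_mult .
  qed auto
  have bound: "(\<Sum>n<N. (a n)^2) \<le> (\<integral>s. h s * h s \<partial>U) / 2" for N
  proof -
    define g where "g s = (\<Sum>n<N. 2 * a n * e n s)" for s
    have hg_eq: "h s * g s = (\<Sum>n<N. 2 * a n * (h s * e n s))" for s
      by (simp add: g_def sum_distrib_left mult_ac)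
    have hg: "(\<integral>s. h s * g s \<partial>U) = (\<Sum>n<N. 2 * (a n)^2)"
      unfolding hg_eq using i1 by (simp add: power2_eq_square mult.assoc flip: a_def)
    have ihg: "integrable U (\<lambda>s. h s * g s)"
      unfolding hg_eq using i1 by simp
    have gg_eq: "g s * g s = (\<Sum>n<N. \<Sum>k<N. 4 * a n * a k * (e n s * e k s))" for s
      unfolding g_def sum_product by (simp add: mult_ac)
    have igg: "integrable U (\<lambda>s. g s * g s)"
      unfolding gg_eq using i2 by simp
    have "(\<integral>s. g s * g s \<partial>U) = (\<Sum>n<N. \<Sum>k<N. 4 * a n * a k * (if n = k then 1/2 else 0))"
      unfolding gg_eq using i2 by (simp add: orth)
    also have "\<dots> = (\<Sum>n<N. 2 * (a n)^2)"
      by (simp add: if_distrib sum.delta power2_eq_square mult_ac cong: if_cong)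
    finally have gg: "(\<integral>s. g s * g s \<partial>U) = (\<Sum>n<N. 2 * (a n)^2)" .
    have "0 \<le> (\<integral>s. (h s - g s)^2 \<partial>U)" by simp
    also have "\<dots> = (\<integral>s. h s * h s - 2 * (h s * g s) + g s * g s \<partial>U)"
      by (simp add: power2_eq_square algebra_simps)
    also have "\<dots> = (\<integral>s. h s * h s \<partial>U) - 2 * (\<Sum>n<N. 2 * (a n)^2) + (\<Sum>n<N. 2 * (a n)^2)"
      using i3 ihg igg by (simp add: hg gg)
    finally show ?thesis by (simp add: sum_distrib_left[symmetric])
  qed
  have "summable (\<lambda>n. (a n)^2)"
    by (rule summableI_nonneg_bounded[of _ "(\<integral>s. h s * h s \<partial>U) / 2"]) (use bound in auto)
  then have "(\<lambda>n. (a n)^2) \<longlonglongrightarrow> 0" by (rule summable_LIMSEQ_zero)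
  then have "(\<lambda>n. sqrt ((a n)^2)) \<longlonglongrightarrow> sqrt 0" by (rule tendsto_real_sqrt)
  then have "(\<lambda>n. \<bar>a n\<bar>) \<longlonglongrightarrow> 0" by simp
  then show ?thesis unfolding a_def by (rule tendsto_rabs_zero_cancel)
qed

lemma integral_cos_pi: "(\<integral>s. cos (pi * real_of_int k * s) \<partial>U) = (if k = 0 then 1 else 0)"
proof (cases "k = 0")
  case False
  have "(\<integral>s. cos (pi * real_of_int k * s) \<partial>U) = (\<lambda>s. sin (pi * real_of_int k * s) / (pi * real_of_int k)) 1 - (\<lambda>s. sin (pi * real_of_int k * s) / (pi * real_of_int k)) 0"
    using False by (intro integral_U_FTC) (auto intro!: derivative_eq_intros)
  also have "\<dots> = 0" using sin_integer_2pi sin_npi_int by (simp add: mult.commute)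
  finally show ?thesis using False by simp
qed simp

lemma orth_cos: "(\<integral>s. cos (real (2*n+1) * pi * s) * cos (real (2*m+1) * pi * s) \<partial>U) = (if n = m then 1/2 else 0)"
  and orth_sin: "(\<integral>s. sin (real (2*n+1) * pi * s) * sin (real (2*m+1) * pi * s) \<partial>U) = (if n = m then 1/2 else 0)"
proof -
  define p q where "p = 2 * (int n - int m)" and "q = 2 * (int n + int m + 1)"
  have q: "q \<noteq> 0" by (simp add: q_def)
  have p: "p = 0 \<longleftrightarrow> n = m" by (simp add: p_def)
  have i: "integrable U (\<lambda>s. cos (pi * real_of_int k * s))" for k
    by (rule integrable_U[of _ 1]) auto
  have *: "cos (real (2*n+1) * pi * s) * cos (real (2*m+1) * pi * s) = (cos (pi * real_of_int p * s) + cos (pi * real_of_int q * s)) / 2"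
    "sin (real (2*n+1) * pi * s) * sin (real (2*m+1) * pi * s) = (cos (pi * real_of_int p * s) - cos (pi * real_of_int q * s)) / 2" for s
    unfolding cos_times_cos sin_times_sin p_def q_def by (simp_all add: algebra_simps)
  show "(\<integral>s. cos (real (2*n+1) * pi * s) * cos (real (2*m+1) * pi * s) \<partial>U) = (if n = m then 1/2 else 0)"
    "(\<integral>s. sin (real (2*n+1) * pi * s) * sin (real (2*m+1) * pi * s) \<partial>U) = (if n = m then 1/2 else 0)"
    unfolding * using i q p by (simp_all add: integral_cos_pi)
qed

text \<open>Controls 1 / sin (pi s) at both ends of the unit interval at once, so that the quotients
  \<open>rem1\<close> and \<open>rem2\<close> stay bounded.\<close>

lemma sin_pi_ge: assumes "0 \<le> s" "s \<le> 1" shows "s * (1 - s) \<le> sin (pi * s)"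
proof -
  have *: "x * (1 - x) \<le> sin (pi * x)" if "0 \<le> x" "x \<le> 1/2" for x
  proof -
    have "(pi * x)^2 \<le> 2^2" using that pi_upper mult_mono[of pi 4 x "1/2"] by (intro power_mono) auto
    then have "3 * x * (1/3) \<le> pi * x * (1 - (pi * x)^2/6)" using that pi_lower by (intro mult_mono) auto
    also have "\<dots> \<le> sin (pi * x)" using sin_lower3[of "pi * x"] that by (simp add: power2_eq_square power3_eq_cube algebra_simps)
    finally have "x \<le> sin (pi * x)" by simp
    moreover have "x * (1 - x) \<le> x" using that by (simp add: algebra_simps)
    ultimately show ?thesis by linarith
  qed
  show ?thesis
  proof (cases "s \<le> 1/2")
    case False
    have "(1-s) * (1 - (1 - s)) \<le> sin (pi * (1 - s))" using False assms by (intro *) auto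
    then show ?thesis by (simp add: algebra_simps sin_diff)
  qed (use * assms in auto)
qed

text \<open>Up to a common factor 1/2, \<open>1 - s\<close> and \<open>kern s\<close> are the real
  and the imaginary part of Prawitz's kernel for 0 < s < 1. At the ends the cotangent takes the
  default value of a division by zero, which affects only a null set.\<close>

definition kern :: "real \<Rightarrow> real" where "kern s = (1 - s) * cot (pi * s) + 1 / pi"

lemma kern_measurable [measurable]: "kern \<in> borel_measurable borel"
  unfolding kern_def cot_def by measurable

text \<open>The conjugate Dirichlet kernel: divided by sin (pi s), it writes cot (pi s) as a sine
  sum plus a rapidly oscillating remainder. Next comes the Dirichlet kernel itself.\<close>

lemma dirichlet_sin: "2 * sin (pi * s) * (\<Sum>n=1..N. sin (2 * pi * real n * s)) = cos (pi * s) - cos (real (2*N+1) * pi * s)"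
proof (induction N)
  case (Suc N)
  have "2 * sin (pi * s) * sin (2 * pi * real (Suc N) * s) = cos (real (2*N+1) * pi * s) - cos (real (2 * Suc N+1) * pi * s)"
    using sin_times_sin[of "pi * s" "2 * pi * real (Suc N) * s"] cos_minus[of "real (2*N+1) * pi * s"]
    by (simp add: algebra_simps)
  with Suc show ?case by (simp add: algebra_simps)
qed (simp add: algebra_simps)

lemma dirichlet_cos: "sin (pi * s) * (1 + 2 * (\<Sum>n=1..N. cos (2 * pi * real n * s))) = sin (real (2*N+1) * pi * s)"
proof (induction N)
  case (Suc N)
  have "2 * sin (pi * s) * cos (2 * pi * real (Suc N) * s) = sin (real (2 * Suc N+1) * pi * s) - sin (real (2*N+1) * pi * s)"
    using sin_times_cos[of "pi * s" "2 * pi * real (Suc N) * s"] sin_minus[of "real (2*N+1) * pi * s"]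
    by (simp add: algebra_simps)
  with Suc show ?case by (simp add: algebra_simps)
qed (simp add: algebra_simps)

lemma sin_pi_pos: "0 < s \<Longrightarrow> s < 1 \<Longrightarrow> 0 < sin (pi * s)"
  by (intro sin_gt_zero) auto

text \<open>Amplitudes of the oscillating remainders in the two Dirichlet sums. The zeros of 1 - s
  and of sin (s w) or cos (s w) - 1 cancel those of sin (pi s).\<close>

definition rem1 :: "real \<Rightarrow> real \<Rightarrow> real" where "rem1 w s = (1 - s) * sin (s * w) / sin (pi * s)"
definition rem2 :: "real \<Rightarrow> real \<Rightarrow> real" where "rem2 w s = (1 - s) * (cos (s * w) - 1) / sin (pi * s)"

lemma rem_measurable [measurable]: "rem1 w \<in> borel_measurable borel" "rem2 w \<in> borel_measurable borel"
  unfolding rem1_def[abs_def] rem2_def[abs_def] by measurable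

lemma rem_bound:
  assumes s: "0 \<le> s" "s \<le> 1" shows "\<bar>rem1 w s\<bar> \<le> \<bar>w\<bar>" "\<bar>rem2 w s\<bar> \<le> \<bar>w\<bar>"
proof -
  have *: "\<bar>(1 - s) * x / sin (pi * s)\<bar> \<le> \<bar>w\<bar>" if x: "\<bar>x\<bar> \<le> \<bar>s * w\<bar>" for x
  proof (cases "s = 0 \<or> s = 1")
    case False
    then have p: "0 < s" "s < 1" using s by auto
    have "(1 - s) * \<bar>x\<bar> \<le> (1 - s) * (s * \<bar>w\<bar>)" using x p by (intro mult_left_mono) (auto simp: abs_mult)
    also have "\<dots> = (s * (1 - s)) * \<bar>w\<bar>" by simp
    also have "\<dots> \<le> sin (pi * s) * \<bar>w\<bar>" using sin_pi_ge s by (intro mult_right_mono) auto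
    finally have "(1 - s) * \<bar>x\<bar> / sin (pi * s) \<le> \<bar>w\<bar>"
      using sin_pi_pos[OF p] by (simp add: pos_divide_le_eq mult.commute)
    moreover have "\<bar>1 - s\<bar> = 1 - s" using p by simp
    ultimately show ?thesis using sin_pi_pos[OF p] by (simp only: abs_divide abs_mult abs_of_pos)
  qed auto
  show "\<bar>rem1 w s\<bar> \<le> \<bar>w\<bar>" unfolding rem1_def by (rule *) (rule abs_sin_x_le_abs_x)
  have "1 - cos y \<le> \<bar>y\<bar>" for y :: real
  proof (cases "\<bar>y\<bar> \<le> 2")
    case True
    have "y^2/2 \<le> \<bar>y\<bar>" using mult_left_mono[OF True, of "\<bar>y\<bar>"] by (simp add: power2_eq_square flip: abs_mult)
    then show ?thesis using cos_lower2[of "\<bar>y\<bar>"] by simp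
  qed (use cos_ge_minus_one[of y] in linarith)
  from this[of "s * w"] show "\<bar>rem2 w s\<bar> \<le> \<bar>w\<bar>" unfolding rem2_def by (intro *) simp
qed

lemma rem_tendsto:
  "(\<lambda>N. (\<integral>s. rem1 w s * cos (real (2*N+1) * pi * s) \<partial>U)) \<longlonglongrightarrow> 0"
  "(\<lambda>N. (\<integral>s. rem2 w s * sin (real (2*N+1) * pi * s) \<partial>U)) \<longlonglongrightarrow> 0"
  by (rule bessel_tendsto_0[OF _ _ _ _ orth_cos]; use rem_bound in auto)
     (rule bessel_tendsto_0[OF _ _ _ _ orth_sin]; use rem_bound in auto)

definition kint :: "real \<Rightarrow> real" where "kint w = (\<integral>s. kern s * sin (s * w) \<partial>U)"

lemma kern_sin_decomp:
  assumes "0 < s" "s < 1"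
  shows "kern s * sin (s * w) = (\<Sum>n=1..N. (1 - s) * cos ((2 * pi * real n - w) * s) - (1 - s) * cos ((2 * pi * real n + w) * s))
     + rem1 w s * cos (real (2*N+1) * pi * s) + sin (s * w) / pi"
proof -
  note p = sin_pi_pos[OF assms]
  have "cot (pi * s) = 2 * (\<Sum>n=1..N. sin (2 * pi * real n * s)) + cos (real (2*N+1) * pi * s) / sin (pi * s)"
    using dirichlet_sin[of s N] p by (simp add: cot_def field_simps)
  then have "kern s * sin (s * w) = (1 - s) * (2 * (\<Sum>n=1..N. sin (2 * pi * real n * s))) * sin (s * w)
     + rem1 w s * cos (real (2*N+1) * pi * s) + sin (s * w) / pi"
    by (simp add: kern_def rem1_def algebra_simps)
  moreover have "(1 - s) * (2 * (\<Sum>n=1..N. sin (2 * pi * real n * s))) * sin (s * w)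
    = (\<Sum>n=1..N. (1 - s) * (2 * (sin (2 * pi * real n * s) * sin (s * w))))"
    by (simp add: sum_distrib_left sum_distrib_right mult_ac)
  moreover have "2 * (sin (2 * pi * real n * s) * sin (s * w)) = cos ((2 * pi * real n - w) * s) - cos ((2 * pi * real n + w) * s)" for n
    by (subst sin_times_sin) (simp add: algebra_simps diff_divide_distrib)
  ultimately show ?thesis by (simp add: right_diff_distrib)
qed

lemma cos_decomp:
  assumes "0 < s" "s < 1"
  shows "rem2 w s * sin (real (2*N+1) * pi * s) = (1 - s) * cos (w * s) - (1 - s) * cos (0 * s)
    + (\<Sum>n=1..N. (1 - s) * cos ((2 * pi * real n - w) * s) + (1 - s) * cos ((2 * pi * real n + w) * s) - 2 * ((1 - s) * cos ((2 * pi * real n) * s)))"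
proof -
  note p = sin_pi_pos[OF assms]
  have "rem2 w s * sin (real (2*N+1) * pi * s) = (1 - s) * (cos (s * w) - 1) * (1 + 2 * (\<Sum>n=1..N. cos (2 * pi * real n * s)))"
    unfolding dirichlet_cos[symmetric] rem2_def using p by simp
  also have "\<dots> = (1 - s) * (cos (s * w) - 1) + (\<Sum>n=1..N. (1 - s) * (2 * (cos (2 * pi * real n * s) * cos (s * w)) - 2 * cos (2 * pi * real n * s)))"
    by (simp add: algebra_simps sum_distrib_left sum_distrib_right sum_subtractf sum.distrib)
  also have "\<dots> = (1 - s) * (cos (s * w) - 1) + (\<Sum>n=1..N. (1 - s) * (cos ((2 * pi * real n - w) * s) + cos ((2 * pi * real n + w) * s) - 2 * cos (2 * pi * real n * s)))"
  proof -
    have "2 * (cos (2 * pi * real n * s) * cos (s * w)) = cos ((2 * pi * real n - w) * s) + cos ((2 * pi * real n + w) * s)" for n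
      by (subst cos_times_cos) (simp add: algebra_simps add_divide_distrib)
    then show ?thesis by presburger
  qed
  finally show ?thesis by (simp add: algebra_simps)
qed

lemma integrable_tri: "integrable U (\<lambda>s. (1 - s) * cos (a * s))"
  by (rule integrable_U[of _ 1]) (auto simp: abs_mult intro!: mult_le_one)

lemma integrable_kern_sin: "integrable U (\<lambda>s. kern s * sin (s * w))"
proof -
  have "integrable U (\<lambda>s. rem1 w s * cos (pi * s) + sin (s * w) / pi)"
  proof (rule integrable_U[of _ "\<bar>w\<bar> + 1"])
    fix s :: real assume s: "0 \<le> s" "s \<le> 1"
    have "\<bar>rem1 w s * cos (pi * s)\<bar> \<le> \<bar>w\<bar> * 1"
      unfolding abs_mult using rem_bound[OF s] by (intro mult_mono) auto
    moreover have "\<bar>sin (s * w) / pi\<bar> \<le> 1/1" unfolding abs_divide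
      using pi_ge_two by (intro frac_le) auto
    ultimately show "\<bar>rem1 w s * cos (pi * s) + sin (s * w) / pi\<bar> \<le> \<bar>w\<bar> + 1" by linarith
  qed auto
  moreover have "rem1 w s * cos (pi * s) + sin (s * w) / pi = kern s * sin (s * w)" for s
    by (simp add: rem1_def kern_def cot_def algebra_simps)
  ultimately show ?thesis by simp
qed

lemma integrable_rem1_cos: "integrable U (\<lambda>s. rem1 w s * cos (real (2*N+1) * pi * s))"
proof (rule integrable_U[of _ "\<bar>w\<bar> * 1"])
  fix s :: real assume "0 \<le> s" "s \<le> 1"
  then show "\<bar>rem1 w s * cos (real (2*N+1) * pi * s)\<bar> \<le> \<bar>w\<bar> * 1"
    unfolding abs_mult using rem_bound by (intro mult_mono) auto
qed auto

text \<open>Product-to-sum formulas turn the sine sum for the cotangent into triangle transforms at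
  2 pi n - w and 2 pi n + w. The last term stems from the summand 1/pi of \<open>kern\<close>; the
  remainder vanishes as N grows.\<close>

lemma kint_eq:
  assumes w: "0 < w"
  shows "kint w = (\<Sum>n=1..N. tri (2 * pi * real n - w) - tri (2 * pi * real n + w))
     + (\<integral>s. rem1 w s * cos (real (2*N+1) * pi * s) \<partial>U) + (1 - cos w) / (pi * w)"
proof -
  have i: "integrable U (\<lambda>s. sin (s * w) / pi)"
    by (rule integrable_U[of _ "1/pi"]) (auto simp: divide_right_mono)
  have "(\<integral>s. sin (s * w) / pi \<partial>U) = (\<lambda>s. - cos (s * w) / (pi * w)) 1 - (\<lambda>s. - cos (s * w) / (pi * w)) 0"
    using w by (intro integral_U_FTC) (auto intro!: derivative_eq_intros)
  then have 1: "(\<integral>s. sin (s * w) / pi \<partial>U) = (1 - cos w) / (pi * w)" by (simp add: diff_divide_distrib)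
  have "kint w = (\<integral>s. (\<Sum>n=1..N. (1 - s) * cos ((2 * pi * real n - w) * s) - (1 - s) * cos ((2 * pi * real n + w) * s))
     + rem1 w s * cos (real (2*N+1) * pi * s) + sin (s * w) / pi \<partial>U)"
    unfolding kint_def
  proof (rule integral_cong_AE)
    show "AE s in U. kern s * sin (s * w) = (\<Sum>n=1..N. (1 - s) * cos ((2 * pi * real n - w) * s) - (1 - s) * cos ((2 * pi * real n + w) * s))
     + rem1 w s * cos (real (2*N+1) * pi * s) + sin (s * w) / pi"
      using AE_U_interior by eventually_elim (rule kern_sin_decomp, auto)
  qed (auto intro!: measurable_restrict_space1)
  also have "\<dots> = (\<Sum>n=1..N. tri (2 * pi * real n - w) - tri (2 * pi * real n + w))
     + (\<integral>s. rem1 w s * cos (real (2*N+1) * pi * s) \<partial>U) + (1 - cos w) / (pi * w)"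
    using i integrable_tri integrable_rem1_cos 1 by (simp add: tri_def)
  finally show ?thesis .
qed

text \<open>A finite form of Poisson summation: the left side tends to 0, so the translates of
  \<open>tri\<close> by all multiples of 2 pi sum to 1/2.\<close>

lemma tri_sum_eq:
  "(\<integral>s. rem2 w s * sin (real (2*N+1) * pi * s) \<partial>U) = tri w - 1/2 + (\<Sum>n=1..N. tri (2 * pi * real n - w) + tri (2 * pi * real n + w))"
proof -
  have z: "tri (2 * pi * real n) = 0" if "n \<ge> 1" for n
    using that cos_2npi[of n] by (subst tri_eq) (auto simp: mult_ac)
  have "(\<integral>s. rem2 w s * sin (real (2*N+1) * pi * s) \<partial>U) = (\<integral>s. (1 - s) * cos (w * s) - (1 - s) * cos (0 * s)
    + (\<Sum>n=1..N. (1 - s) * cos ((2 * pi * real n - w) * s) + (1 - s) * cos ((2 * pi * real n + w) * s) - 2 * ((1 - s) * cos ((2 * pi * real n) * s))) \<partial>U)"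
  proof (rule integral_cong_AE)
    show "AE s in U. rem2 w s * sin (real (2*N+1) * pi * s) = (1 - s) * cos (w * s) - (1 - s) * cos (0 * s)
    + (\<Sum>n=1..N. (1 - s) * cos ((2 * pi * real n - w) * s) + (1 - s) * cos ((2 * pi * real n + w) * s) - 2 * ((1 - s) * cos ((2 * pi * real n) * s)))"
      using AE_U_interior by eventually_elim (rule cos_decomp, auto)
  qed (auto intro!: measurable_restrict_space1)
  also have "\<dots> = tri w - tri 0 + (\<Sum>n=1..N. tri (2 * pi * real n - w) + tri (2 * pi * real n + w) - 2 * tri (2 * pi * real n))"
    using integrable_tri integrable_tri[of 0] unfolding tri_def
    by (subst Bochner_Integration.integral_add; (intro Bochner_Integration.integrable_add Bochner_Integration.integrable_sum Bochner_Integration.integrable_diff integrable_mult_right)?; simp)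
  finally show ?thesis using z by (simp add: tri_0)
qed

text \<open>Comparison with the integral, done by telescoping: the difference of two consecutive
  reciprocals 1 / (d n + w) lies between d times the two corresponding inverse squares.\<close>

lemma inverse_square_telescope:
  fixes w d :: real
  assumes "0 < w" "0 < d"
  shows "d * (\<Sum>n=1..N. 1 / (d * real n + w)^2) \<le> 1/w"
    and "1/w - 1 / (w + d * real (Suc N)) \<le> d * (1/w^2 + (\<Sum>n=1..N. 1 / (d * real n + w)^2))"
proof -
  have *: "d / (d * real (Suc n) + w)^2 \<le> 1 / (d * real n + w) - 1 / (d * real (Suc n) + w)"
    "1 / (d * real n + w) - 1 / (d * real (Suc n) + w) \<le> d / (d * real n + w)^2" for n
  proof -
    define x where "x = d * real n + w"
    have x: "0 < x" using assms by (simp add: x_def add_nonneg_pos)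
    have e: "d * real (Suc n) + w = x + d" by (simp add: x_def algebra_simps)
    have d: "1/x - 1/(x+d) = d / (x * (x+d))" using x assms by (simp add: field_simps)
    have "d / (x+d)^2 \<le> d / (x * (x+d))" "d / (x * (x+d)) \<le> d / x^2"
      using x assms by (auto intro!: divide_left_mono mult_right_mono mult_left_mono mult_pos_pos simp: power2_eq_square)
    then show "d / (d * real (Suc n) + w)^2 \<le> 1 / (d * real n + w) - 1 / (d * real (Suc n) + w)"
      "1 / (d * real n + w) - 1 / (d * real (Suc n) + w) \<le> d / (d * real n + w)^2"
      unfolding e x_def[symmetric] d by auto
  qed
  have "d * (\<Sum>n=1..N. 1 / (d * real n + w)^2) \<le> 1/w - 1 / (d * real N + w)"
  proof (induction N)
    case (Suc N) then show ?case using *(1)[of N] by (simp add: algebra_simps)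
  qed simp
  moreover have "0 \<le> 1 / (d * real N + w)" using assms by simp
  ultimately show "d * (\<Sum>n=1..N. 1 / (d * real n + w)^2) \<le> 1/w" by linarith
  show "1/w - 1 / (w + d * real (Suc N)) \<le> d * (1/w^2 + (\<Sum>n=1..N. 1 / (d * real n + w)^2))"
  proof (induction N)
    case 0 then show ?case using *(2)[of 0] by (simp add: algebra_simps)
  next
    case (Suc N) then show ?case using *(2)[of "Suc N"] by (simp add: algebra_simps)
  qed
qed

text \<open>Combining the two expansions cancels the transforms at 2 pi n - w. What remains is 1 -
  cos w times 1/w^2 + 2 sum - 1/(pi w), with the sum over 1 / (2 pi n + w)^2. The telescoping bounds
  place this factor between -1/w^2 and 1/w^2 in the limit, and (1 - cos w)/w^2 is
  \<open>tri w\<close>.\<close>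

lemma prawitz_pos:
  assumes w: "0 < w"
  shows "\<bar>1/2 - kint w\<bar> \<le> tri w"
proof -
  define c where "c = 1 - cos w"
  have c: "0 \<le> c" by (simp add: c_def)
  have tw: "tri w = c / w^2" using w by (simp add: tri_eq c_def)
  define R where "R N = (\<integral>s. rem1 w s * cos (real (2*N+1) * pi * s) \<partial>U) + (\<integral>s. rem2 w s * sin (real (2*N+1) * pi * s) \<partial>U)" for N
  have R: "R \<longlonglongrightarrow> 0" unfolding R_def using tendsto_add[OF rem_tendsto] by simp
  have main: "1/2 - kint w = c * (1/w^2 + 2 * (\<Sum>n=1..N. 1 / (2 * pi * real n + w)^2) - 1 / (pi * w)) - R N" for N
  proof -
    have "(\<Sum>n=1..N. tri (2 * pi * real n + w)) = c * (\<Sum>n=1..N. 1 / (2 * pi * real n + w)^2)"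
      using w by (simp add: tri_shift c_def sum_distrib_left)
    then show ?thesis
      using kint_eq[OF w, of N] tri_sum_eq[of w N] tw
      by (simp add: R_def c_def[symmetric] sum_subtractf sum.distrib algebra_simps)
  qed
  note T = inverse_square_telescope[OF w, of "2 * pi", simplified]
  have up: "1/2 - kint w + R N \<le> tri w" for N
  proof -
    have "2 * (\<Sum>n=1..N. 1 / (2 * pi * real n + w)^2) \<le> 1 / (pi * w)"
      using T(1)[of N] w by (simp add: field_simps)
    then have "c * (1/w^2 + 2 * (\<Sum>n=1..N. 1 / (2 * pi * real n + w)^2) - 1 / (pi * w)) \<le> c * (1/w^2)"
      using c by (intro mult_left_mono) auto
    then show ?thesis using main[of N] tw by simp
  qed
  have low: "- tri w - c * (1 / (pi * (w + 2 * pi * real (Suc N)))) \<le> 1/2 - kint w + R N" for N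
  proof -
    have "(1/w - 1 / (w + 2 * pi * real (Suc N))) / pi \<le> 2 * (1/w^2 + (\<Sum>n=1..N. 1 / (2 * pi * real n + w)^2))"
      using T(2)[of N] by (simp add: field_simps)
    then have "- (1/w^2) - 1 / (pi * (w + 2 * pi * real (Suc N))) \<le> 1/w^2 + 2 * (\<Sum>n=1..N. 1 / (2 * pi * real n + w)^2) - 1 / (pi * w)"
      by (simp add: diff_divide_distrib mult.commute)
    then have "c * (- (1/w^2) - 1 / (pi * (w + 2 * pi * real (Suc N)))) \<le> c * (1/w^2 + 2 * (\<Sum>n=1..N. 1 / (2 * pi * real n + w)^2) - 1 / (pi * w))"
      using c by (intro mult_left_mono) auto
    then show ?thesis using main[of N] tw by (simp add: right_diff_distrib)
  qed
  have "(\<lambda>N. 1/2 - kint w + R N) \<longlonglongrightarrow> 1/2 - kint w + 0" by (intro tendsto_intros R)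
  then have 1: "1/2 - kint w \<le> tri w" using up by (intro LIMSEQ_le_const2) auto
  have "filterlim (\<lambda>N. pi * (w + 2 * pi * real (Suc N))) at_top sequentially"
    using pi_gt_zero by real_asymp
  then have "(\<lambda>N. 1 / (pi * (w + 2 * pi * real (Suc N)))) \<longlonglongrightarrow> 0"
    by (intro tendsto_divide_0[OF tendsto_const] filterlim_at_top_imp_at_infinity)
  then have "(\<lambda>N. - tri w - c * (1 / (pi * (w + 2 * pi * real (Suc N))))) \<longlonglongrightarrow> - tri w - c * 0"
    by (intro tendsto_intros)
  then have "- tri w - c * 0 \<le> 1/2 - kint w + 0"
    by (rule LIMSEQ_le[OF _ \<open>(\<lambda>N. 1/2 - kint w + R N) \<longlonglongrightarrow> 1/2 - kint w + 0\<close>]) (use low in auto)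
  with 1 show ?thesis by simp
qed

lemma kint_minus: "kint (- w) = - kint w"
  by (simp add: kint_def)

lemma tri_minus: "tri (- w) = tri w"
  by (simp add: tri_def)

text \<open>Negative w follow by the parity of \<open>kint\<close> and \<open>tri\<close>. At w = 0
  both sides equal 1/2, so the event with strict inequality is covered without a limit
  argument.\<close>

lemma prawitz: "\<bar>(if w < 0 then 1 else 0) - 1/2 + kint w\<bar> \<le> tri w"
proof (cases w "0::real" rule: linorder_cases)
  case less
  then show ?thesis using prawitz_pos[of "- w"] by (simp add: kint_minus tri_minus)
next
  case equal
  then show ?thesis by (simp add: kint_def tri_0)
next
  case greater
  then show ?thesis using prawitz_pos[of w] by (simp add: abs_minus_commute)
qed

section \<open>The smoothing inequality\<close>

lemma kern_sin_bound:
  assumes s: "0 \<le> s" "s \<le> 1"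
  shows "\<bar>kern s * sin (s * w)\<bar> \<le> \<bar>w\<bar> + 1"
proof -
  have "\<bar>rem1 w s * cos (pi * s)\<bar> \<le> \<bar>w\<bar> * 1"
    unfolding abs_mult using rem_bound[OF s] by (intro mult_mono) auto
  moreover have "\<bar>sin (s * w) / pi\<bar> \<le> 1/1" unfolding abs_divide
    using pi_ge_two by (intro frac_le) auto
  moreover have "rem1 w s * cos (pi * s) + sin (s * w) / pi = kern s * sin (s * w)"
    by (simp add: rem1_def kern_def cot_def algebra_simps)
  ultimately show ?thesis by linarith
qed

lemma tri_kernel_bound: "0 \<le> (s::real) \<Longrightarrow> s \<le> 1 \<Longrightarrow> \<bar>(1 - s) * cos (w * s)\<bar> \<le> 1"
  by (simp add: abs_mult mult_le_one)

lemma sigma_finite_U: "sigma_finite_measure U"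
  using finite_U by (rule finite_measure.axioms)

context prob_space
begin

lemma pair_U: "pair_sigma_finite U M"
  using sigma_finite_U sigma_finite_measure_axioms by (simp add: pair_sigma_finite_def)

text \<open>The dominating function may depend on the sample point, because the kernel is bounded
  only by |w| + 1 with w random; this is where a first moment enters.\<close>

lemma Fubini_U:
  fixes g :: "real \<Rightarrow> 'a \<Rightarrow> real"
  assumes [measurable]: "case_prod g \<in> borel_measurable (borel \<Otimes>\<^sub>M M)"
    and B: "integrable M B" and g: "\<And>s \<omega>. 0 \<le> s \<Longrightarrow> s \<le> 1 \<Longrightarrow> \<bar>g s \<omega>\<bar> \<le> B \<omega>"
  shows "expectation (\<lambda>\<omega>. \<integral>s. g s \<omega> \<partial>U) = (\<integral>s. expectation (g s) \<partial>U)"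
    and "integrable M (\<lambda>\<omega>. \<integral>s. g s \<omega> \<partial>U)"
proof -
  interpret P: pair_sigma_finite U M by (rule pair_U)
  have m: "case_prod g \<in> borel_measurable (U \<Otimes>\<^sub>M M)"
  proof -
    have "(\<lambda>p. (fst p, snd p)) \<in> measurable (U \<Otimes>\<^sub>M M) (borel \<Otimes>\<^sub>M M)"
      by (intro measurable_Pair measurable_compose[OF measurable_fst] measurable_snd measurable_restrict_space1) simp
    from measurable_compose[OF this assms(1)] show ?thesis by (simp add: case_prod_beta)
  qed
  have int: "integrable (U \<Otimes>\<^sub>M M) (case_prod g)"
  proof (rule P.Fubini_integrable[OF m])
    have gi: "integrable M (\<lambda>\<omega>. g s \<omega>)" if "0 \<le> s" "s \<le> 1" for s
      by (rule Bochner_Integration.integrable_bound[OF B]) (use g that in \<open>auto intro!: AE_I2 order_trans[OF g abs_ge_self]\<close>)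
    show "AE s in U. integrable M (\<lambda>\<omega>. case_prod g (s, \<omega>))"
      using gi by (auto intro!: AE_I2)
    have meas: "(\<lambda>s. \<integral>\<omega>. norm (case_prod g (s, \<omega>)) \<partial>M) \<in> borel_measurable U"
      using m by measurable
    show "integrable U (\<lambda>s. \<integral>\<omega>. norm (case_prod g (s, \<omega>)) \<partial>M)"
    proof -
      interpret F: finite_measure U by (rule finite_U)
      show ?thesis
      proof (rule F.integrable_const_bound[OF _ meas])
        show "AE s in U. norm (\<integral>\<omega>. norm (case_prod g (s, \<omega>)) \<partial>M) \<le> expectation B"
          using gi g B by (auto intro!: AE_I2 integral_mono simp: abs_of_nonneg)
      qed
    qed
  qed
  show "expectation (\<lambda>\<omega>. \<integral>s. g s \<omega> \<partial>U) = (\<integral>s. expectation (g s) \<partial>U)"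
    by (rule P.Fubini_integral[OF int])
  show "integrable M (\<lambda>\<omega>. \<integral>s. g s \<omega> \<partial>U)"
    using P.integrable_snd[OF int] by simp
qed

text \<open>This is \<open>prawitz\<close> at w = T (X - x), integrated over the sample space.
  Interchanging the integrals turns the trigonometric functions of X into the real characteristic
  function \<open>f\<close>, since the sine means vanish.\<close>

theorem smoothing:
  assumes [measurable]: "X \<in> borel_measurable M" and iX: "integrable M X"
    and sin0: "\<And>t. expectation (\<lambda>\<omega>. sin (t * X \<omega>)) = 0"
    and f: "\<And>t. expectation (\<lambda>\<omega>. cos (t * X \<omega>)) = f t"
    and T: "0 < T"
  shows "\<bar>prob {\<omega> \<in> space M. X \<omega> < x} - 1/2 - (\<integral>s. kern s * (sin (s * (T * x)) * f (s * T)) \<partial>U)\<bar>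
     \<le> (\<integral>s. (1 - s) * (cos (s * (T * x)) * f (s * T)) \<partial>U)"
proof -
  define w where "w \<omega> = T * (X \<omega> - x)" for \<omega>
  have [measurable]: "w \<in> borel_measurable M" unfolding w_def by measurable
  have ic: "integrable M (\<lambda>\<omega>. cos (t * X \<omega>))" "integrable M (\<lambda>\<omega>. sin (t * X \<omega>))" for t
    by (intro integrable_const_bound[of _ 1]; simp)+
  have iw: "integrable M (\<lambda>\<omega>. \<bar>w \<omega>\<bar> + 1)" unfolding w_def using iX by auto
  have e1: "expectation (\<lambda>\<omega>. sin (s * w \<omega>)) = - sin (s * (T * x)) * f (s * T)" for s
  proof -
    have "sin (s * w \<omega>) = sin (s * T * X \<omega>) * cos (s * (T * x)) - cos (s * T * X \<omega>) * sin (s * (T * x))" for \<omega>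
      using sin_diff[of "s * T * X \<omega>" "s * (T * x)"] by (simp add: w_def algebra_simps)
    then show ?thesis using ic sin0 f by simp
  qed
  have e2: "expectation (\<lambda>\<omega>. cos (w \<omega> * s)) = cos (s * (T * x)) * f (s * T)" for s
  proof -
    have "cos (w \<omega> * s) = cos (s * T * X \<omega>) * cos (s * (T * x)) + sin (s * T * X \<omega>) * sin (s * (T * x))" for \<omega>
      using cos_diff[of "s * T * X \<omega>" "s * (T * x)"] by (simp add: w_def algebra_simps)
    then have *: "(\<lambda>\<omega>. cos (w \<omega> * s)) = (\<lambda>\<omega>. cos (s * T * X \<omega>) * cos (s * (T * x)) + sin (s * T * X \<omega>) * sin (s * (T * x)))" ..
    show ?thesis unfolding * using ic[of "s * T"] sin0[of "s * T"] f[of "s * T"] by simp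
  qed
  have K: "expectation (\<lambda>\<omega>. kint (w \<omega>)) = - (\<integral>s. kern s * (sin (s * (T * x)) * f (s * T)) \<partial>U)"
    and iK: "integrable M (\<lambda>\<omega>. kint (w \<omega>))"
    using Fubini_U[of "\<lambda>s \<omega>. kern s * sin (s * w \<omega>)", OF _ iw kern_sin_bound]
    by (simp_all add: kint_def e1)
  have i1: "integrable M (\<lambda>\<omega>. 1 :: real)" by simp
  have C: "expectation (\<lambda>\<omega>. tri (w \<omega>)) = (\<integral>s. (1 - s) * (cos (s * (T * x)) * f (s * T)) \<partial>U)"
    and iC: "integrable M (\<lambda>\<omega>. tri (w \<omega>))"
    using Fubini_U[of "\<lambda>s \<omega>. (1 - s) * cos (w \<omega> * s)", OF _ i1 tri_kernel_bound]
    by (simp_all add: tri_def e2)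
  define A where "A = {\<omega> \<in> space M. X \<omega> < x}"
  have [measurable]: "A \<in> sets M" unfolding A_def by measurable
  have iI: "integrable M (\<lambda>\<omega>. indicator A \<omega> :: real)" by (intro integrable_const_bound[of _ 1]) auto
  then have iA: "integrable M (\<lambda>\<omega>. indicator A \<omega> - 1/2 + kint (w \<omega>))" using iK by simp
  have "expectation (\<lambda>\<omega>. indicator A \<omega> - 1/2 + kint (w \<omega>)) = prob A - 1/2 + expectation (\<lambda>\<omega>. kint (w \<omega>))"
    using iK iI by (simp add: prob_space)
  moreover have "\<bar>expectation (\<lambda>\<omega>. indicator A \<omega> - 1/2 + kint (w \<omega>))\<bar> \<le> expectation (\<lambda>\<omega>. \<bar>indicator A \<omega> - 1/2 + kint (w \<omega>)\<bar>)"
    by (rule integral_abs_bound)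
  moreover have "\<dots> \<le> expectation (\<lambda>\<omega>. tri (w \<omega>))"
  proof (intro integral_mono iC integrable_abs iA)
    fix \<omega> assume "\<omega> \<in> space M"
    then have "indicator A \<omega> = (if w \<omega> < 0 then 1 else (0::real))"
      using T by (auto simp: A_def w_def mult_less_0_iff)
    then show "\<bar>indicator A \<omega> - 1/2 + kint (w \<omega>)\<bar> \<le> tri (w \<omega>)" using prawitz[of "w \<omega>"] by simp
  qed
  ultimately show ?thesis unfolding K C A_def by simp
qed

end

section \<open>Inversion formula for the normal distribution function\<close>

lemma expectation_cos_normal: "(\<integral>t. cos (y * t) \<partial>std_normal_distribution) = exp (-(y^2)/2)"
proof -
  interpret real_distribution std_normal_distribution by (rule real_dist_normal_dist)
  have int: "integrable std_normal_distribution (\<lambda>t. iexp (y * t))"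
    using integrable_iexp[of "\<lambda>t. of_real (y * t)"] by simp
  have "(\<integral>t. cos (y * t) \<partial>std_normal_distribution) = Re (char std_normal_distribution y)"
    using integral_Re[OF int] by (simp add: char_def Re_exp)
  then show ?thesis by (simp add: char_std_normal_distribution Re_exp)
qed

lemma Phi_integral: "Phi x = (\<integral>t. indicator {..<x} t * std_normal_density t \<partial>lborel)"
proof -
  have "Phi x = (\<integral>t. indicator {..<x} t \<partial>std_normal_distribution)"
    by (simp add: Phi_def)
  also have "\<dots> = (\<integral>t. std_normal_density t * indicator {..<x} t \<partial>lborel)"
    by (subst integral_density) (auto simp: normal_density_nonneg)
  finally show ?thesis by (simp add: mult.commute)
qed

lemma integrable_indicator_normal: "A \<in> sets borel \<Longrightarrow> integrable lborel (\<lambda>t. indicator A t * std_normal_density t)"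
  using integrable_mult_indicator[of A lborel std_normal_density] by simp

lemma Phi_minus: "Phi (- x) = 1 - Phi x"
proof -
  have "Phi (- x) = (\<integral>t. indicator {..<- x} t * std_normal_density t \<partial>lborel)" by (rule Phi_integral)
  also have "\<dots> = (\<integral>t. indicator {..<- x} (0 + -1 * t) * std_normal_density (0 + -1 * t) \<partial>lborel)"
    by (subst lborel_integral_real_affine[of "-1" _ 0]) simp_all
  also have "\<dots> = (\<integral>t. std_normal_density t - indicator {..<x} t * std_normal_density t \<partial>lborel)"
  proof (rule integral_cong_AE)
    show "AE t in lborel. indicator {..<- x} (0 + -1 * t) * std_normal_density (0 + -1 * t) = std_normal_density t - indicator {..<x} t * std_normal_density t"
      using AE_lborel_singleton[of x]
      by eventually_elim (auto simp: indicator_def std_normal_density_def)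
  qed auto
  also have "\<dots> = 1 - Phi x"
    using integrable_indicator_normal[of "{..<x}"] by (simp add: Phi_integral)
  finally show ?thesis .
qed

text \<open>Write sin (x t) / t as the integral of x cos (s x t) over s in the unit interval and
  interchange: the normal cosine mean exp (-(s x)^2/2) is again a normal density up to a constant,
  and its integral gives Phi x - 1/2.\<close>

lemma normal_sin_integral_pos:
  assumes x: "0 \<le> x"
  shows "integrable std_normal_distribution (\<lambda>t. sin (x * t) / t)"
    and "(\<integral>t. sin (x * t) / t \<partial>std_normal_distribution) = sqrt (2 * pi) * (Phi x - 1/2)"
proof -
  interpret N: prob_space std_normal_distribution
    using real_dist_normal_dist by (rule real_distribution.axioms)
  define g where "g s t = x * cos (s * x * t)" for s t :: real
  have 1: "(\<integral>s. g s t \<partial>U) = sin (x * t) / t" if "t \<noteq> 0" for t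
  proof -
    have "(\<integral>s. g s t \<partial>U) = (\<lambda>s. sin (s * x * t) / t) 1 - (\<lambda>s. sin (s * x * t) / t) 0"
      unfolding g_def using that by (intro integral_U_FTC) (auto intro!: derivative_eq_intros)
    then show ?thesis by simp
  qed
  have ae: "AE t in std_normal_distribution. (\<integral>s. g s t \<partial>U) = sin (x * t) / t"
  proof -
    have "AE t in lborel. t \<noteq> (0::real)" by (rule AE_lborel_singleton)
    then have "AE t in std_normal_distribution. t \<noteq> 0" by (subst AE_density) auto
    then show ?thesis by eventually_elim (rule 1)
  qed
  have B: "integrable std_normal_distribution (\<lambda>t. \<bar>x\<bar>)" by simp
  have gb: "\<bar>g s t\<bar> \<le> \<bar>x\<bar>" for s t
    using mult_left_mono[OF abs_cos_le_one, of "\<bar>x\<bar>" "s * x * t"] by (simp add: g_def abs_mult)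
  have gm: "case_prod g \<in> borel_measurable (borel \<Otimes>\<^sub>M std_normal_distribution)"
    unfolding g_def case_prod_beta by measurable
  note F = N.Fubini_U[OF gm B gb]
  show int: "integrable std_normal_distribution (\<lambda>t. sin (x * t) / t)"
    by (rule integrable_cong_AE_imp[OF F(2) _ ae]) auto
  have "(\<integral>t. sin (x * t) / t \<partial>std_normal_distribution) = N.expectation (\<lambda>t. \<integral>s. g s t \<partial>U)"
    using ae int F(2) by (intro integral_cong_AE) (auto elim: AE_mp dest: borel_measurable_integrable)
  also have "\<dots> = (\<integral>s. x * exp (-((s * x)^2)/2) \<partial>U)"
  proof -
    have "g s = (\<lambda>t. x * cos (s * x * t))" for s by (auto simp: g_def)
    then have "N.expectation (g s) = x * exp (-((s * x)^2)/2)" for s by (simp add: expectation_cos_normal)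
    then show ?thesis by (simp only: F(1))
  qed
  also have "\<dots> = sqrt (2 * pi) * (Phi x - 1/2)"
  proof (cases "x = 0")
    case True
    have "Phi 0 = 1/2" using Phi_minus[of 0] by simp
    then show ?thesis using True by simp
  next
    case False
    then have x: "0 < x" using x by simp
    have P0: "Phi 0 = 1/2" using Phi_minus[of 0] by simp
    have "Phi x - Phi 0 = (\<integral>t. indicator {..<x} t * std_normal_density t - indicator {..<0} t * std_normal_density t \<partial>lborel)"
      using integrable_indicator_normal[of "{..<x}"] integrable_indicator_normal[of "{..<0}"] by (simp add: Phi_integral)
    also have "\<dots> = (\<integral>t. indicator {0..x} t * std_normal_density t \<partial>lborel)"
    proof (rule integral_cong_AE)
      show "AE t in lborel. indicator {..<x} t * std_normal_density t - indicator {..<0} t * std_normal_density t = indicator {0..x} t * std_normal_density t"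
        using AE_lborel_singleton[of x] by eventually_elim (use x in \<open>auto simp: indicator_def\<close>)
    qed auto
    also have "\<dots> = \<bar>x\<bar> *\<^sub>R (\<integral>t. indicator {0..x} (0 + x * t) * std_normal_density (0 + x * t) \<partial>lborel)"
      using x by (intro lborel_integral_real_affine) auto
    also have "(\<lambda>t. indicator {0..x} (0 + x * t) * std_normal_density (0 + x * t)) = (\<lambda>t. indicator {0..1} t *\<^sub>R std_normal_density (x * t))"
      using x by (auto simp: fun_eq_iff indicator_def mult_le_cancel_left1 zero_le_mult_iff)
    also have "\<bar>x\<bar> *\<^sub>R (\<integral>t. indicator {0..1} t *\<^sub>R std_normal_density (x * t) \<partial>lborel) = x * (\<integral>t. std_normal_density (x * t) \<partial>U)"
      using x by (subst integral_restrict_space) auto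
    also have "\<dots> = (\<integral>s. x * exp (-((s * x)^2)/2) \<partial>U) / sqrt (2 * pi)"
      by (simp add: std_normal_density_def mult.commute)
    finally show ?thesis by (simp add: P0 field_simps)
  qed
  finally show "(\<integral>t. sin (x * t) / t \<partial>std_normal_distribution) = sqrt (2 * pi) * (Phi x - 1/2)" .
qed

lemma normal_sin_integral:
  shows "integrable std_normal_distribution (\<lambda>t. sin (x * t) / t)"
    and "(\<integral>t. sin (x * t) / t \<partial>std_normal_distribution) = sqrt (2 * pi) * (Phi x - 1/2)"
proof -
  have "integrable std_normal_distribution (\<lambda>t. sin (x * t) / t) \<and> (\<integral>t. sin (x * t) / t \<partial>std_normal_distribution) = sqrt (2 * pi) * (Phi x - 1/2)"
  proof (cases "0 \<le> x")
    case False
    then have "0 \<le> - x" by simp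
    from normal_sin_integral_pos[OF this] show ?thesis
      by (simp add: Phi_minus algebra_simps)
  qed (use normal_sin_integral_pos in auto)
  then show "integrable std_normal_distribution (\<lambda>t. sin (x * t) / t)"
    "(\<integral>t. sin (x * t) / t \<partial>std_normal_distribution) = sqrt (2 * pi) * (Phi x - 1/2)" by auto
qed

text \<open>The inversion formula, with t = s T as integration variable so that it can be merged
  with the smoothing integrals over s.\<close>

lemma Phi_sine:
  assumes T: "0 < T"
  shows "has_bochner_integral lborel (\<lambda>s. indicator {0<..} s * (sin (s * (T * x)) / (pi * s) * exp (-((s * T)^2)/2))) (Phi x - 1/2)"
proof -
  define h where "h t = std_normal_density t * (sin (x * t) / t)" for t
  have [measurable]: "h \<in> borel_measurable borel" unfolding h_def by measurable
  have ih: "integrable lborel h"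
    using normal_sin_integral(1)[of x] unfolding h_def
    by (subst (asm) integrable_density) (auto simp: normal_density_nonneg)
  have Ih: "(\<integral>t. h t \<partial>lborel) = sqrt (2 * pi) * (Phi x - 1/2)"
    using normal_sin_integral(2)[of x] unfolding h_def
    by (subst (asm) integral_density) (auto simp: normal_density_nonneg)
  have ihp: "integrable lborel (\<lambda>t. indicator {0<..} t * h t)" and ihn: "integrable lborel (\<lambda>t. indicator {..<0} t * h t)"
    using integrable_mult_indicator[OF _ ih, of "{0<..}"] integrable_mult_indicator[OF _ ih, of "{..<0}"] by auto
  have he: "h (- t) = h t" for t by (simp add: h_def std_normal_density_def)
  have "(\<integral>t. indicator {..<0} t * h t \<partial>lborel) = (\<integral>t. indicator {..<0} (0 + -1 * t) * h (0 + -1 * t) \<partial>lborel)"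
    by (subst lborel_integral_real_affine[of "-1" _ 0]) simp_all
  also have "\<dots> = (\<integral>t. indicator {0<..} t * h t \<partial>lborel)"
    by (intro Bochner_Integration.integral_cong) (auto simp: he indicator_def)
  finally have neg: "(\<integral>t. indicator {..<0} t * h t \<partial>lborel) = (\<integral>t. indicator {0<..} t * h t \<partial>lborel)" .
  have "(\<integral>t. h t \<partial>lborel) = (\<integral>t. indicator {..<0} t * h t + indicator {0<..} t * h t \<partial>lborel)"
  proof (rule integral_cong_AE)
    show "AE t in lborel. h t = indicator {..<0} t * h t + indicator {0<..} t * h t"
      using AE_lborel_singleton[of 0] by eventually_elim (auto simp: indicator_def)
  qed auto
  also have "\<dots> = 2 * (\<integral>t. indicator {0<..} t * h t \<partial>lborel)" using ihp ihn neg by simp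
  finally have half: "(\<integral>t. indicator {0<..} t * h t \<partial>lborel) = sqrt (2 * pi) * (Phi x - 1/2) / 2" using Ih by simp
  have hb: "has_bochner_integral lborel (\<lambda>t. indicator {0<..} t * h t) (sqrt (2 * pi) * (Phi x - 1/2) / 2)"
    using ihp half by (simp add: has_bochner_integral_iff)
  have "has_bochner_integral lborel (\<lambda>s. indicator {0<..} (0 + T * s) * h (0 + T * s)) ((sqrt (2 * pi) * (Phi x - 1/2) / 2) /\<^sub>R \<bar>T\<bar>)"
    by (rule lborel_has_bochner_integral_real_affine_iff[THEN iffD1, OF _ hb]) (use T in auto)
  then have "has_bochner_integral lborel (\<lambda>s. (T * sqrt (2 * pi) / pi) * (indicator {0<..} (0 + T * s) * h (0 + T * s)))
     ((T * sqrt (2 * pi) / pi) * ((sqrt (2 * pi) * (Phi x - 1/2) / 2) /\<^sub>R \<bar>T\<bar>))"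
    by (rule has_bochner_integral_mult_right)
  moreover have "(T * sqrt (2 * pi) / pi) * ((sqrt (2 * pi) * (Phi x - 1/2) / 2) /\<^sub>R \<bar>T\<bar>) = Phi x - 1/2"
  proof -
    have "sqrt (2 * pi) * sqrt (2 * pi) = 2 * pi" by simp
    then show ?thesis using T by (simp add: field_simps)
  qed
  moreover have "(T * sqrt (2 * pi) / pi) * (indicator {0<..} (0 + T * s) * h (0 + T * s)) = indicator {0<..} s * (sin (s * (T * x)) / (pi * s) * exp (-((s * T)^2)/2))" for s
    using T by (auto simp: h_def std_normal_density_def indicator_def field_simps zero_less_mult_iff)
  ultimately show ?thesis by simp
qed

context prob_space
begin

text \<open>The point x enters the integrand only through the phase \<theta> = s T x, and the
  direction of the deviation only through the sign \<sigma>. A bound valid for all phases and signs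
  is therefore uniform in x. The kernel stops at s = 1, whereas the normal part runs over the whole
  half line.\<close>

lemma smoothing_bound:
  assumes X [measurable]: "X \<in> borel_measurable M" and iX: "integrable M X"
    and sin0: "\<And>t. expectation (\<lambda>\<omega>. sin (t * X \<omega>)) = 0"
    and f: "\<And>t. expectation (\<lambda>\<omega>. cos (t * X \<omega>)) = f t"
    and T: "0 < T"
    and bd: "\<And>s \<theta> \<sigma>. 0 < s \<Longrightarrow> s \<noteq> 1 \<Longrightarrow> \<bar>\<sigma>\<bar> = 1 \<Longrightarrow>
      (if s \<le> 1 then (\<sigma> * kern s * sin \<theta> + (1 - s) * cos \<theta>) * f (s * T) else 0) - \<sigma> * (sin \<theta> / (pi * s)) * exp (-((s * T)^2)/2) \<le> bd s"
    and ibd: "integrable lborel (\<lambda>s. indicator {0<..} s * bd s)"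
  shows "\<bar>prob {\<omega> \<in> space M. X \<omega> < x} - Phi x\<bar> \<le> (\<integral>s. indicator {0<..} s * bd s \<partial>lborel)"
proof -
  define F where "F = prob {\<omega> \<in> space M. X \<omega> < x}"
  have f_le: "\<bar>f t\<bar> \<le> 1" for t
  proof -
    have "\<bar>expectation (\<lambda>\<omega>. cos (t * X \<omega>))\<bar> \<le> expectation (\<lambda>\<omega>. 1)"
      by (rule order_trans[OF integral_abs_bound integral_mono])
         (auto intro!: integrable_const_bound[of _ 1])
    then show ?thesis by (simp add: f prob_space)
  qed
  have [measurable]: "f \<in> borel_measurable borel"
    unfolding f[symmetric, abs_def] by measurable
  let ?k = "\<lambda>s. kern s * (sin (s * (T * x)) * f (s * T))"
  let ?c = "\<lambda>s. (1 - s) * (cos (s * (T * x)) * f (s * T))"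
  let ?p = "\<lambda>s. indicator {0<..} s * (sin (s * (T * x)) / (pi * s) * exp (-((s * T)^2)/2))"
  have ik: "integrable U ?k"
  proof (rule integrable_U[of _ "(\<bar>T * x\<bar> + 1) * 1"])
    fix s :: real assume "0 \<le> s" "s \<le> 1"
    then have "\<bar>kern s * sin (s * (T * x))\<bar> * \<bar>f (s * T)\<bar> \<le> (\<bar>T * x\<bar> + 1) * 1"
      by (intro mult_mono kern_sin_bound f_le) auto
    then show "\<bar>?k s\<bar> \<le> (\<bar>T * x\<bar> + 1) * 1"
      by (simp only: abs_mult mult.assoc)
  qed measurable
  have ic: "integrable U ?c"
  proof (rule integrable_U[of _ "1 * 1"])
    fix s :: real assume s: "0 \<le> s" "s \<le> 1"
    have "\<bar>(1 - s) * cos (s * (T * x))\<bar> * \<bar>f (s * T)\<bar> \<le> 1 * 1"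
      using tri_kernel_bound[OF s, of "T * x"] by (intro mult_mono f_le) (auto simp: mult.commute)
    then show "\<bar>?c s\<bar> \<le> 1 * 1"
      by (simp only: abs_mult mult.assoc)
  qed measurable
  have ik': "integrable lborel (\<lambda>s. indicator {0..1} s * ?k s)" and ic': "integrable lborel (\<lambda>s. indicator {0..1} s * ?c s)"
    using ik ic by (subst (asm) integrable_restrict_space; simp add: mult.commute)+
  have eq: "(\<integral>s. h s \<partial>U) = (\<integral>s. indicator {0..1} s * h s \<partial>lborel)" for h :: "real \<Rightarrow> real"
    by (subst integral_restrict_space) auto
  note ph = Phi_sine[OF T, of x]
  define kk cc pp where "kk s = indicator {0..1} s * ?k s" and "cc s = indicator {0..1} s * ?c s" and "pp s = ?p s" for s
  have ints: "integrable lborel kk" "integrable lborel cc" "integrable lborel pp" "(\<integral>s. pp s \<partial>lborel) = Phi x - 1/2"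
    using ik' ic' ph by (simp_all add: kk_def[abs_def] cc_def[abs_def] pp_def[abs_def] has_bochner_integral_iff)
  have key: "\<sigma> * (F - Phi x) \<le> (\<integral>s. indicator {0<..} s * bd s \<partial>lborel)" if \<sigma>: "\<bar>\<sigma>\<bar> = 1" for \<sigma>
  proof -
    have "\<sigma> * (F - 1/2 - (\<integral>s. ?k s \<partial>U)) \<le> (\<integral>s. ?c s \<partial>U)"
      using smoothing[OF X iX sin0 f T, of x] \<sigma> unfolding F_def
      by (smt (verit) mult_minus_left mult_cancel_right1)
    then have "\<sigma> * (F - Phi x) \<le> \<sigma> * (\<integral>s. ?k s \<partial>U) + (\<integral>s. ?c s \<partial>U) - \<sigma> * (Phi x - 1/2)"
      by (simp add: algebra_simps)
    also have "\<dots> = (\<integral>s. \<sigma> * (indicator {0..1} s * ?k s) + indicator {0..1} s * ?c s - \<sigma> * ?p s \<partial>lborel)"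
      unfolding eq kk_def[symmetric] cc_def[symmetric] pp_def[symmetric] using ints by simp
    also have "\<dots> \<le> (\<integral>s. indicator {0<..} s * bd s \<partial>lborel)"
    proof (rule integral_mono_AE)
      show "integrable lborel (\<lambda>s. \<sigma> * (indicator {0..1} s * ?k s) + indicator {0..1} s * ?c s - \<sigma> * ?p s)"
        unfolding kk_def[symmetric] cc_def[symmetric] pp_def[symmetric] using ints by simp
      show "AE s in lborel. \<sigma> * (indicator {0..1} s * ?k s) + indicator {0..1} s * ?c s - \<sigma> * ?p s \<le> indicator {0<..} s * bd s"
        using AE_lborel_singleton[of 0] AE_lborel_singleton[of 1]
      proof eventually_elim
        case (elim s)
        show ?case
        proof (cases "0 < s")
          case True
          with bd[OF True elim(2) \<sigma>, of "s * (T * x)"] show ?thesis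
            by (auto simp: indicator_def algebra_simps split: if_splits)
        qed (use elim in auto)
      qed
    qed (rule ibd)
    finally show ?thesis .
  qed
  have "F - Phi x \<le> (\<integral>s. indicator {0<..} s * bd s \<partial>lborel)" using key[of 1] by simp
  moreover have "Phi x - F \<le> (\<integral>s. indicator {0<..} s * bd s \<partial>lborel)" using key[of "-1"] by simp
  ultimately show ?thesis unfolding F_def by linarith
qed

end

section \<open>Bounds for the smoothing kernel\<close>

lemma sin_cos_combination_le:
  fixes a b c \<theta> :: real
  assumes "a^2 + b^2 \<le> c^2" "0 \<le> c"
  shows "a * sin \<theta> + b * cos \<theta> \<le> c"
proof (rule power2_le_imp_le[OF _ assms(2)])
  have "(a * sin \<theta> + b * cos \<theta>)^2 + (a * cos \<theta> - b * sin \<theta>)^2 = (a^2 + b^2) * (sin \<theta>^2 + cos \<theta>^2)"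
    by (simp add: power2_eq_square algebra_simps del: sin_cos_squared_add sin_cos_squared_add2 sin_cos_squared_add3)
  then have "(a * sin \<theta> + b * cos \<theta>)^2 \<le> a^2 + b^2"
    using zero_le_power2[of "a * cos \<theta> - b * sin \<theta>"] unfolding sin_cos_squared_add mult_1_right by linarith
  with assms(1) show "(a * sin \<theta> + b * cos \<theta>)^2 \<le> c^2" by linarith
qed

lemma x_cot_upper:
  fixes x :: real assumes x: "0 < x" "x < pi"
  shows "x * cot x \<le> 1 - x^2/3"
proof -
  have s: "0 < sin x" using x by (rule sin_gt_zero)
  have d: "0 \<le> sin t - t * cos t" if "0 \<le> t" "t \<le> x" for t
    by (rule nonneg_from_deriv[of _ 0 _ "\<lambda>t. t * sin t"])
      (use that x in \<open>auto intro!: derivative_eq_intros mult_nonneg_nonneg sin_ge_zero\<close>)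
  have d2: "t * (t * cos t) \<le> t * sin t" if "0 \<le> t" "t \<le> x" for t
    using d[OF that] that by (intro mult_left_mono) auto
  have "0 \<le> sin x * (1 - x^2/3) - x * cos x"
    by (rule nonneg_from_deriv[of "\<lambda>t. sin t * (1 - t^2/3) - t * cos t" 0 x "\<lambda>t. t/3 * (sin t - t * cos t)"])
      (use x d2 in \<open>auto intro!: derivative_eq_intros mult_nonneg_nonneg simp: power2_eq_square algebra_simps\<close>)
  then show ?thesis using s by (simp add: cot_def field_simps)
qed

text \<open>Taylor bounds for sine and cosine reduce the claim to the polynomial inequality assumed
  for \<open>c\<close>. A constant valid up to pi/2 must be at least 4/pi^2 = 0.405..., whence the
  later choice 0.41; for small x the value 0.36 is possible.\<close>

lemma x_cot_lower:
  fixes x c :: real assumes x: "0 < x" "x \<le> pi/2"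
    and c: "0 \<le> (c - 1/3) + x^2 * (1/30 - c/6) + x^4 * (c/120 - 1/720)"
  shows "1 - c * x^2 \<le> x * cot x"
proof -
  have s: "0 < sin x" using x by (intro sin_gt_zero) auto
  show ?thesis
  proof (cases "c * x^2 \<le> 1")
    case True
    have "(1 - c * x^2) * sin x \<le> (1 - c * x^2) * (x - x^3/6 + x^5/120)"
      using True x by (intro mult_left_mono sin_upper5) auto
    also have "\<dots> = x * (1 - x^2/2 + x^4/24 - x^6/720) - x^3 * ((c - 1/3) + x^2 * (1/30 - c/6) + x^4 * (c/120 - 1/720))"
      by (simp add: eval_nat_numeral field_simps)
    also have "\<dots> \<le> x * (1 - x^2/2 + x^4/24 - x^6/720)" using c x by simp
    also have "\<dots> \<le> x * cos x" using x by (intro mult_left_mono cos_lower6) auto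
    finally show ?thesis using s by (simp add: cot_def field_simps)
  next
    case False
    have "0 \<le> cos x" using x by (intro cos_ge_zero) auto
    then have "0 \<le> x * cot x" using x s by (simp add: cot_def)
    then show ?thesis using False by linarith
  qed
qed

text \<open>Bounds pi s times the Euclidean norm of the pair \<open>kern s\<close>,
  \<open>1 - s\<close>. The supremum is about 1.025; the excess absorbs the simple bound used for x
  cot x.\<close>

definition kern_const :: real where "kern_const = 1034/1000"

text \<open>The identities in the next four lemmas rewrite the polynomial in the Bernstein basis of the interval, where all coefficients are nonnegative.\<close>

lemma kernel_poly0:
  fixes s :: real
  assumes "0 \<le> s" "s \<le> (3/10)"
  shows "0 \<le> (17289/250000) * s^0 + (-9881/3000) * s^2 + (79/6) * s^3 + (-20703681/1000000) * s^4 + (10830681/500000) * s^5 + (-10830681/1000000) * s^6"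
proof -
  have "(17289/250000) * s^0 + (-9881/3000) * s^2 + (79/6) * s^3 + (-20703681/1000000) * s^4 + (10830681/500000) * s^5 + (-10830681/1000000) * s^6 = (7684/81) * ((s - 0)^0 * ((3/10) - s)^6) + (15368/27) * ((s - 0)^1 * ((3/10) - s)^5) + (246970/243) * ((s - 0)^2 * ((3/10) - s)^4) + (184300/243) * ((s - 0)^3 * ((3/10) - s)^3) + (175066871/810000) * ((s - 0)^4 * ((3/10) - s)^2) + (215891291/12150000) * ((s - 0)^5 * ((3/10) - s)^1) + (1755909037/243000000) * ((s - 0)^6 * ((3/10) - s)^0)"
    by (simp add: eval_nat_numeral field_simps)
  also have "0 \<le> \<dots>" using assms by (intro add_nonneg_nonneg mult_nonneg_nonneg zero_le_power) auto
  finally show ?thesis .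
qed

lemma kernel_poly1:
  fixes s :: real
  assumes "(3/10) \<le> s" "s \<le> (1/2)"
  shows "0 \<le> (17289/250000) * s^0 + (-9881/3000) * s^2 + (79/6) * s^3 + (-20703681/1000000) * s^4 + (10830681/500000) * s^5 + (-10830681/1000000) * s^6"
proof -
  have "(17289/250000) * s^0 + (-9881/3000) * s^2 + (79/6) * s^3 + (-20703681/1000000) * s^4 + (10830681/500000) * s^5 + (-10830681/1000000) * s^6 = (5267727111/64000000) * ((s - (3/10))^0 * ((1/2) - s)^6) + (4404161947/6400000) * ((s - (3/10))^1 * ((1/2) - s)^5) + (26106193723/7680000) * ((s - (3/10))^2 * ((1/2) - s)^4) + (3305376391/384000) * ((s - (3/10))^3 * ((1/2) - s)^3) + (1126793449/102400) * ((s - (3/10))^4 * ((1/2) - s)^2) + (210288721/30720) * ((s - (3/10))^5 * ((1/2) - s)^1) + (20213909/12288) * ((s - (3/10))^6 * ((1/2) - s)^0)"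
    by (simp add: eval_nat_numeral field_simps)
  also have "0 \<le> \<dots>" using assms by (intro add_nonneg_nonneg mult_nonneg_nonneg zero_le_power) auto
  finally show ?thesis .
qed

lemma gauss_poly0:
  fixes s :: real
  assumes "0 \<le> s" "s \<le> (1/4)"
  shows "0 \<le> (1/5) * s^0 + (-6/5) * s^1 + (82/25) * s^2 + (-82/25) * s^3"
proof -
  have "(1/5) * s^0 + (-6/5) * s^1 + (82/25) * s^2 + (-82/25) * s^3 = (64/5) * ((s - 0)^0 * ((1/4) - s)^3) + (96/5) * ((s - 0)^1 * ((1/4) - s)^2) + (328/25) * ((s - 0)^2 * ((1/4) - s)^1) + (86/25) * ((s - 0)^3 * ((1/4) - s)^0)"
    by (simp add: eval_nat_numeral field_simps)
  also have "0 \<le> \<dots>" using assms by (intro add_nonneg_nonneg mult_nonneg_nonneg zero_le_power) auto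
  finally show ?thesis .
qed

lemma gauss_poly1:
  fixes s :: real
  assumes "(1/4) \<le> s" "s \<le> (1/2)"
  shows "0 \<le> (1/5) * s^0 + (-6/5) * s^1 + (82/25) * s^2 + (-82/25) * s^3"
proof -
  have "(1/5) * s^0 + (-6/5) * s^1 + (82/25) * s^2 + (-82/25) * s^3 = (86/25) * ((s - (1/4))^0 * ((1/2) - s)^3) + (188/25) * ((s - (1/4))^1 * ((1/2) - s)^2) + 8 * ((s - (1/4))^2 * ((1/2) - s)^1) + (16/25) * ((s - (1/4))^3 * ((1/2) - s)^0)"
    by (simp add: eval_nat_numeral field_simps)
  also have "0 \<le> \<dots>" using assms by (intro add_nonneg_nonneg mult_nonneg_nonneg zero_le_power) auto
  finally show ?thesis .
qed

lemma pi_sq: "9869/1000 \<le> pi^2" "pi^2 \<le> 9873/1000"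
proof -
  have "(31415/10000)^2 \<le> pi^2" using pi_lower by (intro power_mono) auto
  then show "9869/1000 \<le> pi^2" by (simp add: power_divide)
  have "pi^2 \<le> (3142/1000)^2" using pi_upper by (intro power_mono) auto
  then show "pi^2 \<le> 9873/1000" by (simp add: power_divide)
qed

text \<open>Two normal forms in terms of x cot x: one for s near 0, the other, by reflection of the
  cotangent, for s near 1.\<close>

lemma kern_eq:
  assumes "0 < s" "s < 1"
  shows "pi * s * kern s = (1 - s) * (pi * s * cot (pi * s)) + s"
    and "pi * kern s = 1 - pi * (1 - s) * cot (pi * (1 - s))"
proof -
  show "pi * s * kern s = (1 - s) * (pi * s * cot (pi * s)) + s" by (simp add: kern_def algebra_simps)
  have "cot (pi * (1 - s)) = - cot (pi * s)"
    by (simp add: cot_def right_diff_distrib sin_diff cos_diff)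
  then show "pi * kern s = 1 - pi * (1 - s) * cot (pi * (1 - s))" by (simp add: kern_def algebra_simps)
qed

text \<open>With g = 1 - s the kernel is of second order, kern s <= 0.41 pi g^2, so the norm of the
  pair is g (1 + O(g^2)); half of (0.41 pi)^2 is just below 0.83. This bound vanishes at s = 1,
  where the exponential damping is almost gone.\<close>

lemma kern_half_upper:
  assumes s: "1/2 \<le> s" "s < 1"
  shows "(kern s)^2 + (1 - s)^2 \<le> ((1 - s) * (1 + 83/100 * (1 - s)^2))^2"
proof -
  define g where "g = 1 - s"
  define x where "x = pi * g"
  have g: "0 < g" "g \<le> 1/2" using s by (auto simp: g_def)
  have x: "0 < x" "x < pi" "x \<le> pi/2" using g by (auto simp: x_def)
  have x2: "x^2 \<le> 25/10"
    using power_mono[of x "pi/2" 2] x pi_sq by (simp add: power_divide)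
  have e: "pi * kern s = 1 - x * cot x" using kern_eq(2)[of s] s by (simp add: x_def g_def)
  have up: "x * cot x \<le> 1" using x_cot_upper[OF x(1,2)] zero_le_power2[of x] by linarith
  have "1 - 41/100 * x^2 \<le> x * cot x"
  proof (rule x_cot_lower[OF x(1,3)])
    have "(x^2 - 5/2) * (x^2 - 10) \<ge> 0" using x2 by (intro mult_nonpos_nonpos) auto
    then have "25/2 * x^2 \<le> 25 + x^4" by (simp add: power2_eq_square power4_eq_xxxx algebra_simps)
    then show "0 \<le> 41/100 - 1/3 + x^2 * (1/30 - 41/100/6) + x^4 * (41/100/120 - 1/720)" using x2 zero_le_power2[of "x^2"] by simp
  qed
  with e up have "0 \<le> pi * kern s" "pi * kern s \<le> 41/100 * x^2" by auto
  moreover have "41/100 * x^2 = pi * (41/100 * pi * g^2)" by (simp add: x_def power2_eq_square)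
  ultimately have k: "0 \<le> kern s" "kern s \<le> 41/100 * pi * g^2"
    using pi_gt_zero by (simp_all only: zero_le_mult_iff mult_le_cancel_left_pos) linarith+
  have "(kern s)^2 \<le> (41/100 * pi * g^2)^2" using k by (intro power_mono) auto
  also have "\<dots> = (41/100)^2 * pi^2 * g^4" by (simp add: power_mult_distrib power2_eq_square power4_eq_xxxx)
  also have "\<dots> \<le> 166/100 * g^4" using pi_sq(2) g by (intro mult_right_mono) (auto simp: power_divide)
  finally have "(kern s)^2 + g^2 \<le> 166/100 * g^4 + g^2" by simp
  also have "\<dots> \<le> (g * (1 + 83/100 * g^2))^2" using g by (simp add: power2_eq_square power4_eq_xxxx algebra_simps)
  finally show ?thesis by (simp add: g_def)
qed

lemma kern_bound:
  assumes s: "0 < s" "s < 1"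
  shows "(kern s)^2 + (1 - s)^2 \<le> (kern_const / (pi * s))^2"
proof (cases "s \<le> 1/2")
  case True
  define x where "x = pi * s"
  have x: "0 < x" "x < pi" "x \<le> pi/2" using s True by (auto simp: x_def)
  have "0 \<le> cos x" "0 < sin x" using x by (auto intro: cos_ge_zero sin_gt_zero)
  then have "0 \<le> x * cot x" using x by (simp add: cot_def)
  moreover have "x * cot x \<le> 1 - x^2/3" using x by (intro x_cot_upper)
  moreover have e: "x * kern s = (1 - s) * (x * cot x) + s" using kern_eq(1)[OF s] by (simp add: x_def)
  ultimately have "0 \<le> x * kern s" "x * kern s \<le> (1 - s) * (1 - x^2/3) + s"
    unfolding e using s by (auto intro!: mult_left_mono add_nonneg_nonneg mult_nonneg_nonneg[of "1 - s"])
  then have "(x * kern s)^2 \<le> ((1 - s) * (1 - x^2/3) + s)^2" by (intro power_mono)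
  then have 1: "(x * kern s)^2 + (x * (1 - s))^2 \<le> ((1 - s) * (1 - x^2/3) + s)^2 + (x * (1 - s))^2" by simp
  define p where "p = pi^2"
  have p: "9869/1000 \<le> p" "p \<le> 9873/1000" using pi_sq by (auto simp: p_def)
  have "((1 - s) * (1 - x^2/3) + s)^2 + (x * (1 - s))^2
      = 1 + p * (s^2 * (1-s)^2) - 2/3 * p * (s^2 * (1 - s)) + p * p * (s^4 * (1-s)^2) / 9"
    by (simp add: x_def p_def power_mult_distrib power2_eq_square power4_eq_xxxx field_simps)
  also have "\<dots> \<le> 1 + 9873/1000 * (s^2 * (1-s)^2) - 2/3 * (9869/1000) * (s^2 * (1 - s)) + 9873/1000 * (9873/1000) * (s^4 * (1-s)^2) / 9"
    using p s by (intro add_mono diff_mono mult_right_mono divide_right_mono mult_mono) auto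
  also have "\<dots> \<le> kern_const^2"
  proof -
    have "0 \<le> (17289/250000) * s^0 + (-9881/3000) * s^2 + (79/6) * s^3 + (-20703681/1000000) * s^4 + (10830681/500000) * s^5 + (-10830681/1000000) * s^6"
      using kernel_poly0[of s] kernel_poly1[of s] s True by (cases "s \<le> 3/10") auto
    then show ?thesis by (simp add: kern_const_def eval_nat_numeral field_simps)
  qed
  finally have "(pi * s)^2 * ((kern s)^2 + (1 - s)^2) \<le> kern_const^2"
    using 1 by (simp add: power_mult_distrib distrib_left x_def)
  then show ?thesis using s by (simp add: power_divide field_simps)
next
  case False
  have "(1 - s) * (1 + 83/100 * (1 - s)^2) \<le> kern_const / (pi * s)"
  proof -
    have "s * (1 - s) \<le> 1/4" using zero_le_power2[of "s - 1/2"] by (simp add: power2_eq_square algebra_simps)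
    moreover have "(1 - s)^2 \<le> (1/2)^2" using s False by (intro power_mono) auto
    ultimately have "pi * ((s * (1 - s)) * (1 + 83/100 * (1 - s)^2)) \<le> 3142/1000 * (1/4 * (1 + 83/100 * (1/2)^2))"
      using pi_upper s by (intro mult_mono mult_nonneg_nonneg add_mono) auto
    also have "\<dots> \<le> kern_const" by (simp add: kern_const_def power_divide)
    finally show ?thesis using s by (simp add: field_simps)
  qed
  moreover have "0 \<le> (1 - s) * (1 + 83/100 * (1 - s)^2)" using s by simp
  ultimately have "((1 - s) * (1 + 83/100 * (1 - s)^2))^2 \<le> (kern_const / (pi * s))^2" by (intro power_mono)
  then show ?thesis using kern_half_upper[of s] False s by linarith
qed

text \<open>The coefficient $0.64$ makes this a majorant of the Gaussian part of the integrand over all phases \<open>\<theta>\<close>, i.e. of the Euclidean norm of the pair \<open>kern s - 1 / (pi * s)\<close>, \<open>1 - s\<close>.\<close>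

definition majorant :: "real \<Rightarrow> real" where "majorant s = 1 - s + 64/100 * s^2"

lemma majorant_nonneg: "0 \<le> majorant s"
proof -
  have "majorant s = 64/100 * (s - 25/32)^2 + (1 - 64/100 * (25/32)^2)" by (simp add: majorant_def power2_eq_square field_simps)
  then show ?thesis by (simp add: power2_eq_square)
qed

text \<open>Subtracting (1 - s)^2 from the squared majorant leaves 1.28 (1 - s) s^2 + (0.64 s^2)^2
  to dominate (v/x)^2, where v/x = 1/(pi s) - kern s. For s <= 1/2 the first summand suffices, by x
  cot x >= 1 - c x^2. For s >= 1/2 the reflected form gives v/x <= 1.2/pi, and both summands are
  used.\<close>

lemma gauss_kernel_bound:
  assumes s: "0 < s" "s < 1"
  shows "(kern s - 1 / (pi * s))^2 + (1 - s)^2 \<le> (majorant s)^2"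
proof -
  define x where "x = pi * s"
  define v where "v = (1 - s) * (1 - x * cot x)"
  have x: "0 < x" "x < pi" using s by (auto simp: x_def)
  have "pi * s * (kern s - 1 / (pi * s)) = - v"
    using s by (simp add: right_diff_distrib kern_eq(1)[OF s, unfolded mult.assoc] v_def x_def algebra_simps)
  then have e: "kern s - 1 / (pi * s) = - v / x" using s by (simp add: x_def field_simps)
  have v0: "0 \<le> v" using x_cot_upper[OF x] zero_le_power2[of x] s unfolding v_def by (intro mult_nonneg_nonneg) linarith+
  have ex: "x^2 = pi^2 * s^2" by (simp add: x_def power_mult_distrib)
  have goal: ?thesis if "(v / x)^2 \<le> 128/100 * (1 - s) * s^2 + (64/100 * s^2)^2"
  proof -
    have "(majorant s)^2 = (1 - s)^2 + 128/100 * (1 - s) * s^2 + (64/100 * s^2)^2" by (simp add: majorant_def power2_eq_square field_simps)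
    moreover have "(- v / x)^2 = (v / x)^2" by (simp add: power_divide)
    ultimately show ?thesis unfolding e using that by linarith
  qed
  have small: ?thesis if c: "1 - c * x^2 \<le> x * cot x" "c^2 * (9873/1000) * (1 - s) \<le> 128/100" for c
  proof (rule goal)
    have "v \<le> (1 - s) * (c * x^2)" unfolding v_def using c s by (intro mult_left_mono) auto
    then have "v / x \<le> (1 - s) * (c * x)" using x by (simp add: power2_eq_square field_simps)
    then have "(v / x)^2 \<le> ((1 - s) * (c * x))^2" using v0 x by (intro power_mono) auto
    also have "\<dots> = (1 - s) * s^2 * (c^2 * pi^2 * (1 - s))"
      by (simp add: ex power_mult_distrib) (simp add: power2_eq_square)
    also have "\<dots> \<le> (1 - s) * s^2 * (128/100)"
    proof (intro mult_left_mono)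
      have "c^2 * pi^2 * (1 - s) \<le> c^2 * (9873/1000) * (1 - s)"
        using pi_sq s by (intro mult_right_mono mult_left_mono) auto
      with c show "c^2 * pi^2 * (1 - s) \<le> 128/100" by linarith
    qed (use s in auto)
    finally show "(v / x)^2 \<le> 128/100 * (1 - s) * s^2 + (64/100 * s^2)^2"
      using zero_le_power2[of "64/100 * s^2"] by linarith
  qed
  \<comment> \<open>The constant c = 0.36 just satisfies 9.873 c^2 <= 1.28 but requires small x, and
    c = 0.41 requires 1 - s to be below about 1.28/1.66; the split at 0.277 suits both.\<close>
  consider "s \<le> 277/1000" | "277/1000 \<le> s" "s \<le> 1/2" | "1/2 \<le> s" by linarith
  then show ?thesis
  proof cases
    case 1
    have xp: "x \<le> pi/2" using 1 by (simp add: x_def)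
    have "x^2 \<le> 9873/1000 * (277/1000)^2"
      unfolding ex using 1 s pi_sq by (intro mult_mono power_mono) auto
    then have "x^2 \<le> 76/100" by (simp add: power_divide)
    then have "1 - 36/100 * x^2 \<le> x * cot x"
      by (intro x_cot_lower xp x) (auto intro!: add_nonneg_nonneg)
    then show ?thesis by (rule small) (use s in \<open>simp add: power_divide\<close>)
  next
    case 2
    have xp: "x \<le> pi/2" using 2 by (simp add: x_def)
    have x2: "x^2 \<le> 25/10"
      using power_mono[of x "pi/2" 2] x xp pi_sq by (simp add: power_divide)
    have "1 - 41/100 * x^2 \<le> x * cot x"
    proof (rule x_cot_lower[OF x(1) xp])
      have "(x^2 - 5/2) * (x^2 - 10) \<ge> 0" using x2 by (intro mult_nonpos_nonpos) auto
      then have "25/2 * x^2 \<le> 25 + x^4" by (simp add: power2_eq_square power4_eq_xxxx algebra_simps)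
      then show "0 \<le> 41/100 - 1/3 + x^2 * (1/30 - 41/100/6) + x^4 * (41/100/120 - 1/720)" using x2 zero_le_power2[of "x^2"] by simp
    qed
    then show ?thesis by (rule small) (use 2 in \<open>simp add: power_divide\<close>)
  next
    case 3
    define g where "g = 1 - s"
    have g: "0 < g" "g \<le> 1/2" using 3 s by (auto simp: g_def)
    define y where "y = pi * g"
    have y: "0 < y" "y < pi" using g by (auto simp: y_def)
    have k: "pi * kern s = 1 - y * cot y" using kern_eq(2)[OF s] by (simp add: y_def g_def)
    have "y * cot y \<le> 1 - y^2/3" by (rule x_cot_upper[OF y])
    then have "y^2/3 \<le> pi * kern s" using k by simp
    have "v / x = 1 / (pi * s) - kern s" using e by simp
    then have "pi * (v / x) = pi * (1 / (pi * s)) - pi * kern s" by (simp only: right_diff_distrib)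
    then have "pi * (v / x) = 1/s - pi * kern s" by simp
    then have "pi * (v / x) \<le> 1/s - y^2/3" using \<open>y^2/3 \<le> pi * kern s\<close> by simp
    also have "\<dots> \<le> 12/10"
    proof -
      have "0 \<le> (1/5) * g^0 + (-6/5) * g^1 + (82/25) * g^2 + (-82/25) * g^3" using gauss_poly0[of g] gauss_poly1[of g] g by (cases "g \<le> 1/4") auto
      then have "1 \<le> s * (12/10 + 328/100 * g^2)" by (simp add: g_def power2_eq_square power3_eq_cube field_simps)
      also have "\<dots> \<le> s * (12/10 + y^2/3)"
      proof (intro mult_left_mono add_left_mono)
        show "328/100 * g^2 \<le> y^2/3"
          using mult_right_mono[OF pi_sq(1), of "g^2"] zero_le_power2[of g] unfolding y_def power_mult_distrib by linarith
      qed (use s in auto)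
      finally show ?thesis using s by (simp add: field_simps)
    qed
    finally have "pi * (v / x) \<le> 12/10" .
    moreover have "0 \<le> pi * (v / x)" using v0 x by simp
    ultimately have "(pi * (v / x))^2 \<le> (12/10)^2" by (intro power_mono)
    then have "9869/1000 * (v / x)^2 \<le> 144/100"
      using mult_right_mono[OF pi_sq(1), of "(v/x)^2"] by (simp add: power_mult_distrib power_divide)
    then have vx: "(v / x)^2 \<le> 146/1000" by simp
    show ?thesis
    proof (rule goal)
      have "146/1000 \<le> 128/100 * (1 - s) * s^2 + (64/100 * s^2)^2"
      proof (cases "s \<le> 6/10")
        case True
        have "146/1000 \<le> (1/2::real)^2 * (128/100 * (4/10) + (64/100)^2 * (1/2)^2)" by (simp add: power_divide)
        also have "\<dots> \<le> s^2 * (128/100 * (1 - s) + (64/100)^2 * s^2)"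
          using 3 s True by (intro mult_mono add_mono power_mono mult_left_mono) auto
        finally show ?thesis by (simp add: power2_eq_square algebra_simps)
      next
        case False
        have "0 \<le> (1 - s) * (128/100 - (64/100)^2 * (1 + s))" using s by (intro mult_nonneg_nonneg) (auto simp: power_divide)
        then have "(64/100)^2 \<le> 128/100 * (1 - s) + (64/100)^2 * s^2" by (simp add: power2_eq_square field_simps)
        then have "s^2 * (64/100)^2 \<le> s^2 * (128/100 * (1 - s) + (64/100)^2 * s^2)" by (intro mult_left_mono) auto
        moreover have "(6/10)^2 \<le> s^2" using False by (intro power_mono) auto
        ultimately show ?thesis by (simp add: power2_eq_square field_simps)
      qed
      with vx show "(v / x)^2 \<le> 128/100 * (1 - s) * s^2 + (64/100 * s^2)^2" by linarith
    qed
  qed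
qed

text \<open>Beyond s = 1 only the normal sine term, of size 1/(pi s), remains. As the majorant
  dominates it from 1/2 on, the Gaussian part can be integrated over the whole half line in closed
  form.\<close>

lemma majorant_ge_large: "1/2 \<le> s \<Longrightarrow> 1 / (pi * s) \<le> majorant s"
proof -
  assume s: "1/2 \<le> s"
  have "0 \<le> (s - 1/2) * (64/100 * s^2 - 68/100 * s + 66/100)"
  proof (rule mult_nonneg_nonneg)
    have "64/100 * s^2 - 68/100 * s + 66/100 = 64/100 * (s - 68/128)^2 + (66/100 - 64/100 * (68/128)^2)" by (simp add: power2_eq_square field_simps)
    then show "0 \<le> 64/100 * s^2 - 68/100 * s + 66/100" by (simp add: power2_eq_square)
  qed (use s in simp)
  then have "33/100 \<le> s * majorant s" by (simp add: majorant_def power2_eq_square field_simps)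
  then have "31415/10000 * (33/100) \<le> pi * (s * majorant s)" using pi_lower by (intro mult_mono) auto
  then show ?thesis using s by (simp add: field_simps)
qed

lemma majorant_ge_small: "0 < s \<Longrightarrow> s \<le> 1/2 \<Longrightarrow> 1 / (pi * s) \<le> majorant s + (1 - 2 * s) / (pi * s)"
proof -
  assume s: "0 < s" "s \<le> 1/2"
  have "0 \<le> (1/2 - s) * (1 - 64/100 * (s + 1/2))" using s by (intro mult_nonneg_nonneg) auto
  then have "66/100 \<le> majorant s" by (simp add: majorant_def power2_eq_square field_simps)
  moreover have "2 / pi \<le> 66/100" using pi_lower by (simp add: field_simps)
  moreover have "1 / (pi * s) = 2 / pi + (1 - 2 * s) / (pi * s)" using s by (simp add: field_simps)
  ultimately show ?thesis by linarith
qed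

text \<open>In the tail the characteristic function and the Gaussian are bounded separately. From s
  = 1/2 on the sharper norm bound takes over. The companion \<open>gauss_tail\<close> bounds the
  excess of 1/(pi s) over the majorant.\<close>

definition kern_tail :: "real \<Rightarrow> real" where
  "kern_tail s = (if s < 1/2 then kern_const / (pi * s) else (1 - s) * (1 + 83/100 * (1 - s)^2))"

definition gauss_tail :: "real \<Rightarrow> real" where
  "gauss_tail s = (if s < 1/2 then (1 - 2 * s) / (pi * s) else 0)"

lemma inverse_le_majorant: "0 < s \<Longrightarrow> 1 / (pi * s) \<le> majorant s + gauss_tail s"
  using majorant_ge_large[of s] majorant_ge_small[of s] by (simp add: gauss_tail_def)

text \<open>Splits f = (f - g) + g. The difference meets the full kernel; for the Gaussian g the
  pole of \<open>kern\<close> at 0 is cancelled by the sine term of the normal distribution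
  function, which leaves the majorant.\<close>

lemma integrand_bound_main:
  assumes s: "0 < s" "s < 1" and \<sigma>: "\<bar>\<sigma>\<bar> = 1" and g: "0 \<le> g"
  shows "(\<sigma> * kern s * sin \<theta> + (1 - s) * cos \<theta>) * f - \<sigma> * (sin \<theta> / (pi * s)) * g \<le> kern_const / (pi * s) * \<bar>f - g\<bar> + majorant s * g"
proof -
  have \<sigma>2: "\<sigma>^2 = 1" using \<sigma> by (metis power2_abs one_power2)
  have kern_const: "0 \<le> kern_const / (pi * s)" using s by (simp add: kern_const_def)
  have "(\<sigma> * kern s * sin \<theta> + (1 - s) * cos \<theta>) * (f - g) \<le> kern_const / (pi * s) * \<bar>f - g\<bar>"
  proof -
    have "\<sigma> * kern s * sin \<theta> + (1 - s) * cos \<theta> \<le> kern_const / (pi * s)"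
      using kern_bound[OF s] kern_const \<sigma>2 by (intro sin_cos_combination_le) (auto simp: power_mult_distrib power2_commute[of s 1])
    moreover have "(- \<sigma> * kern s) * sin \<theta> + (- (1 - s)) * cos \<theta> \<le> kern_const / (pi * s)"
      using kern_bound[OF s] kern_const \<sigma>2 by (intro sin_cos_combination_le) (auto simp: power_mult_distrib power2_commute[of s 1])
    ultimately have "\<bar>\<sigma> * kern s * sin \<theta> + (1 - s) * cos \<theta>\<bar> \<le> kern_const / (pi * s)" by (simp add: abs_le_iff algebra_simps)
    then have "\<bar>(\<sigma> * kern s * sin \<theta> + (1 - s) * cos \<theta>) * (f - g)\<bar> \<le> kern_const / (pi * s) * \<bar>f - g\<bar>"
      unfolding abs_mult by (intro mult_right_mono) auto
    then show ?thesis by linarith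
  qed
  moreover have "(\<sigma> * (kern s - 1 / (pi * s)) * sin \<theta> + (1 - s) * cos \<theta>) * g \<le> majorant s * g"
    using gauss_kernel_bound[OF s] majorant_nonneg \<sigma>2 g
    by (intro mult_right_mono sin_cos_combination_le) (auto simp: power_mult_distrib)
  ultimately show ?thesis by (simp add: algebra_simps)
qed

lemma sine_part_bound:
  assumes s: "0 < s" and \<sigma>: "\<bar>\<sigma>\<bar> = 1" and g: "0 \<le> g"
  shows "- \<sigma> * (sin \<theta> / (pi * s)) * g \<le> (majorant s + gauss_tail s) * g"
proof -
  have "- \<sigma> * sin \<theta> \<le> \<bar>\<sigma> * sin \<theta>\<bar>" by linarith
  also have "\<dots> \<le> 1" using \<sigma> by (simp add: abs_mult)
  finally have "- \<sigma> * sin \<theta> \<le> 1" .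
  then have "- \<sigma> * (sin \<theta> / (pi * s)) \<le> 1 / (pi * s)"
    using s divide_right_mono[of "- \<sigma> * sin \<theta>" 1 "pi * s"] by simp
  also have "\<dots> \<le> majorant s + gauss_tail s" using s by (rule inverse_le_majorant)
  finally show ?thesis using g by (rule mult_right_mono)
qed

lemma integrand_bound_tail:
  assumes s: "0 < s" "s < 1" and \<sigma>: "\<bar>\<sigma>\<bar> = 1" and g: "0 \<le> g"
  shows "(\<sigma> * kern s * sin \<theta> + (1 - s) * cos \<theta>) * f - \<sigma> * (sin \<theta> / (pi * s)) * g \<le> kern_tail s * \<bar>f\<bar> + majorant s * g + gauss_tail s * g"
proof -
  have \<sigma>2: "\<sigma>^2 = 1" using \<sigma> by (metis power2_abs one_power2)
  have K0: "0 \<le> kern_tail s" using s by (auto simp: kern_tail_def kern_const_def)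
  have K: "(kern s)^2 + (1 - s)^2 \<le> (kern_tail s)^2"
    using kern_bound[OF s] kern_half_upper[of s] s by (auto simp: kern_tail_def)
  have "\<sigma> * kern s * sin \<theta> + (1 - s) * cos \<theta> \<le> kern_tail s"
    using K K0 \<sigma>2 by (intro sin_cos_combination_le) (auto simp: power_mult_distrib power2_commute[of s 1])
  moreover have "(- \<sigma> * kern s) * sin \<theta> + (- (1 - s)) * cos \<theta> \<le> kern_tail s"
    using K K0 \<sigma>2 by (intro sin_cos_combination_le) (auto simp: power_mult_distrib power2_commute[of s 1])
  ultimately have "\<bar>\<sigma> * kern s * sin \<theta> + (1 - s) * cos \<theta>\<bar> \<le> kern_tail s" by (simp add: abs_le_iff algebra_simps)
  then have "\<bar>(\<sigma> * kern s * sin \<theta> + (1 - s) * cos \<theta>) * f\<bar> \<le> kern_tail s * \<bar>f\<bar>"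
    unfolding abs_mult by (intro mult_right_mono) auto
  then show ?thesis using sine_part_bound[OF s(1) \<sigma> g, of \<theta>] by (simp add: distrib_right)
qed

section \<open>The smoothing integral\<close>

lemma gauss_scaled:
  fixes T :: real
  assumes T: "0 < T" and h: "has_bochner_integral lborel (\<lambda>x. indicator {0..} x *\<^sub>R (exp (- x\<^sup>2) * x^k)) I"
  shows "has_bochner_integral lborel (\<lambda>s. indicator {0<..} s * (s^k * exp (-((s * T)^2)/2))) (I * (sqrt 2 / T)^(k+1))"
proof -
  define c where "c = T / sqrt 2"
  have c: "0 < c" using T by (simp add: c_def)
  have "has_bochner_integral lborel (\<lambda>x. indicator {0..} (0 + c * x) *\<^sub>R (exp (- (0 + c * x)\<^sup>2) * (0 + c * x)^k)) (I /\<^sub>R \<bar>c\<bar>)"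
    using c by (intro lborel_has_bochner_integral_real_affine_iff[THEN iffD1, OF _ h]) auto
  then have "has_bochner_integral lborel (\<lambda>x. (1/c^k) * (indicator {0..} (0 + c * x) *\<^sub>R (exp (- (0 + c * x)\<^sup>2) * (0 + c * x)^k))) ((1/c^k) * (I /\<^sub>R \<bar>c\<bar>))"
    by (rule has_bochner_integral_mult_right)
  moreover have "(1/c^k) * (indicator {0..} (0 + c * x) *\<^sub>R (exp (- (0 + c * x)\<^sup>2) * (0 + c * x)^k)) = indicator {0..} x * (x^k * exp (-((x * T)^2)/2))" for x
    using c T by (auto simp: indicator_def zero_le_mult_iff power_mult_distrib c_def power_divide field_simps)
  moreover have "(1/c^k) * (I /\<^sub>R \<bar>c\<bar>) = I * (sqrt 2 / T)^(k+1)"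
    using c T by (simp add: c_def power_divide field_simps)
  ultimately have *: "has_bochner_integral lborel (\<lambda>x. indicator {0..} x * (x^k * exp (-((x * T)^2)/2))) (I * (sqrt 2 / T)^(k+1))" by simp
  show ?thesis
  proof (rule has_bochner_integral_cong_AE[THEN iffD1, OF _ _ _ *])
    show "AE x in lborel. indicator {0..} x * (x^k * exp (-((x * T)^2)/2)) = indicator {0<..} x * (x^k * exp (-((x * T)^2)/2))"
      using AE_lborel_singleton[of 0] by eventually_elim (auto simp: indicator_def)
  qed auto
qed

definition sqrt_half_pi :: real where "sqrt_half_pi = sqrt (pi / 2)"

lemma gauss_moments:
  fixes T :: real
  assumes T: "0 < T"
  shows "has_bochner_integral lborel (\<lambda>s. indicator {0<..} s * (s^0 * exp (-((s * T)^2)/2))) (sqrt_half_pi / T)"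
    and "has_bochner_integral lborel (\<lambda>s. indicator {0<..} s * (s^1 * exp (-((s * T)^2)/2))) (1 / T^2)"
    and "has_bochner_integral lborel (\<lambda>s. indicator {0<..} s * (s^2 * exp (-((s * T)^2)/2))) (sqrt_half_pi / T^3)"
proof -
  have c: "sqrt pi * sqrt 2 / 2 = sqrt_half_pi"
  proof -
    have "sqrt_half_pi = sqrt pi / sqrt 2" by (simp add: sqrt_half_pi_def real_sqrt_divide)
    also have "\<dots> = sqrt pi * sqrt 2 / 2" by (simp add: field_simps)
    finally show ?thesis ..
  qed
  show "has_bochner_integral lborel (\<lambda>s. indicator {0<..} s * (s^0 * exp (-((s * T)^2)/2))) (sqrt_half_pi / T)"
    using gauss_scaled[OF T gaussian_moment_even_pos[of 0, simplified mult_0_right]] c by simp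
  show "has_bochner_integral lborel (\<lambda>s. indicator {0<..} s * (s^1 * exp (-((s * T)^2)/2))) (1 / T^2)"
    using gauss_scaled[OF T gaussian_moment_odd_pos[of 0, simplified mult_0_right add_0]] by (simp add: power2_eq_square)
  have "sqrt pi / 2 * (fact 2 / (2 ^ 2 * fact 1)) * (sqrt 2 / T)^(2+1) = sqrt_half_pi / T^3"
    unfolding c[symmetric] by (simp add: power3_eq_cube field_simps)
  then show "has_bochner_integral lborel (\<lambda>s. indicator {0<..} s * (s^2 * exp (-((s * T)^2)/2))) (sqrt_half_pi / T^3)"
    using gauss_scaled[OF T gaussian_moment_even_pos[of 1, simplified mult_1_right]] by simp
qed

lemma gauss_majorant:
  fixes T :: real
  assumes T: "0 < T"
  shows "has_bochner_integral lborel (\<lambda>s. indicator {0<..} s * (majorant s * exp (-((s * T)^2)/2))) (sqrt_half_pi / T - 1 / T^2 + 64/100 * (sqrt_half_pi / T^3))"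
proof -
  have "has_bochner_integral lborel (\<lambda>s. indicator {0<..} s * (s^0 * exp (-((s * T)^2)/2)) - indicator {0<..} s * (s^1 * exp (-((s * T)^2)/2)) + 64/100 * (indicator {0<..} s * (s^2 * exp (-((s * T)^2)/2))))
    (sqrt_half_pi / T - 1 / T^2 + 64/100 * (sqrt_half_pi / T^3))"
    by (intro has_bochner_integral_add has_bochner_integral_diff has_bochner_integral_mult_right gauss_moments[OF T])
  then show ?thesis by (simp add: majorant_def algebra_simps)
qed

text \<open>The moment belonging to (m t^3)^2 after division by s. The antiderivative -(t^4 + 4 t^2
  + 8) exp (-t^2/2) in t = s T lets the integral stop at \<open>s1\<close>; the full moment 8 is
  affordable only for small m.\<close>

lemma gauss_mom5:
  fixes T s1 :: real
  assumes T: "0 < T" and s1: "0 \<le> s1"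
  shows "has_bochner_integral lborel (\<lambda>s. (s^5 * exp (-((s * T)^2)/2)) * indicator {0..s1} s)
    ((8 - ((s1 * T)^4 + 4 * (s1 * T)^2 + 8) * exp (-((s1 * T)^2)/2)) / T^6)"
proof -
  define G where "G s = - (((s * T)^4 + 4 * (s * T)^2 + 8) * exp (-((s * T)^2)/2))" for s
  have "has_bochner_integral lborel (\<lambda>s. (s^5 * exp (-((s * T)^2)/2)) * indicator {0..s1} s) (G s1 / T^6 - G 0 / T^6)"
  proof (rule has_bochner_integral_FTC_Icc_real[OF s1])
    fix s
    have "(G has_real_derivative - ((4 * (s * T)^3 * T + 8 * (s * T) * T) * exp (-((s * T)^2)/2) + ((s * T)^4 + 4 * (s * T)^2 + 8) * (exp (-((s * T)^2)/2) * (- (s * T) * T)))) (at s)"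
      unfolding G_def by (auto intro!: derivative_eq_intros)
    moreover have "- ((4 * (s * T)^3 * T + 8 * (s * T) * T) * e + ((s * T)^4 + 4 * (s * T)^2 + 8) * (e * (- (s * T) * T))) = (s^5 * e) * T^6" for e
      by (simp add: eval_nat_numeral algebra_simps)
    ultimately have "(G has_real_derivative (s^5 * exp (-((s * T)^2)/2)) * T^6) (at s)" by simp
    from DERIV_cdivide[OF this, of "T^6"] show "((\<lambda>s. G s / T^6) has_real_derivative s^5 * exp (-((s * T)^2)/2)) (at s)"
      using T by simp
    show "isCont (\<lambda>s. s^5 * exp (-((s * T)^2)/2)) s" by simp
  qed
  moreover have "G s1 / T^6 - G 0 / T^6 = (8 - ((s1 * T)^4 + 4 * (s1 * T)^2 + 8) * exp (-((s1 * T)^2)/2)) / T^6"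
    by (simp add: G_def diff_divide_distrib)
  ultimately show ?thesis by simp
qed

text \<open>With $T = 2.6/m$ and $t = sT$ the exponent $-t^2/2 + 0.1905\,m t^3$ becomes $-(T^2/2)\,s^2 (1 - 0.9906 s)$.\<close>

definition damped_square :: "real \<Rightarrow> real" where "damped_square s = s^2 * (1 - 9906/10000 * s)"

definition tail_integrand :: "real \<Rightarrow> real \<Rightarrow> real" where
  "tail_integrand X s = kern_tail s * exp (- (X * damped_square s)) + gauss_tail s * exp (- (X * s^2))"

lemma tail_integrand_measurable [measurable]: "tail_integrand X \<in> borel_measurable borel"
  unfolding tail_integrand_def[abs_def] kern_tail_def gauss_tail_def damped_square_def by measurable

lemma kern_tail_nonneg: "0 < s \<Longrightarrow> s \<le> 1 \<Longrightarrow> 0 \<le> kern_tail s" and gauss_tail_nonneg: "0 < s \<Longrightarrow> 0 \<le> gauss_tail s"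
  by (auto simp: kern_tail_def gauss_tail_def kern_const_def)

lemma tail_integrand_bound: assumes s: "s1 \<le> s" "s \<le> 1" "0 < s1" and X: "0 \<le> X" shows "0 \<le> tail_integrand X s" "tail_integrand X s \<le> 2 * kern_const / (pi * s1) + 2"
proof -
  have r: "0 \<le> damped_square s" using s by (simp add: damped_square_def)
  show "0 \<le> tail_integrand X s" unfolding tail_integrand_def using kern_tail_nonneg[of s] gauss_tail_nonneg[of s] s by (intro add_nonneg_nonneg mult_nonneg_nonneg) auto
  have "kern_tail s \<le> kern_const / (pi * s1) + 2"
  proof (cases "s < 1/2")
    case True
    have "kern_const / (pi * s) \<le> kern_const / (pi * s1)" using s by (intro divide_left_mono mult_left_mono) (auto simp: kern_const_def)
    then show ?thesis using True by (simp add: kern_tail_def)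
  next
    case False
    have "(1 - s)^2 \<le> 1" using s by (simp add: power_le_one)
    then have "(1 - s) * (1 + 83/100 * (1 - s)^2) \<le> 1 * 2" using s by (intro mult_mono) auto
    moreover have "0 \<le> kern_const / (pi * s1)" using s by (simp add: kern_const_def)
    ultimately show ?thesis using False unfolding kern_tail_def by simp
  qed
  moreover have "gauss_tail s \<le> kern_const / (pi * s1)"
  proof -
    have "(1 - 2 * s) / (pi * s) \<le> kern_const / (pi * s1)" using s by (intro frac_le mult_left_mono) (auto simp: kern_const_def)
    moreover have "0 \<le> kern_const / (pi * s1)" using s by (simp add: kern_const_def)
    ultimately show ?thesis by (simp add: gauss_tail_def)
  qed
  moreover have "tail_integrand X s \<le> kern_tail s * 1 + gauss_tail s * 1"
    unfolding tail_integrand_def using kern_tail_nonneg[of s] gauss_tail_nonneg[of s] s X r by (intro add_mono mult_left_mono) auto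
  ultimately show "tail_integrand X s \<le> 2 * kern_const / (pi * s1) + 2" by simp
qed

lemma tail_integrand_integrable:
  assumes "0 < p" "q \<le> 1" "0 \<le> X"
  shows "integrable lborel (\<lambda>s. indicator {p..q} s * tail_integrand X s)"
proof -
  have "integrable lborel (\<lambda>s. indicator {p..q} s *\<^sub>R (2 * kern_const / (pi * p) + 2))"
    by (intro integrable_scaleR_left) (simp add: integrable_indicator_iff emeasure_lborel_Icc_eq)
  then show ?thesis
  proof (rule Bochner_Integration.integrable_bound)
    have "\<bar>tail_integrand X s\<bar> \<le> \<bar>2 * kern_const / (pi * p) + 2\<bar>" if "p \<le> s" "s \<le> q" for s
      using tail_integrand_bound[of p s X] that assms by linarith
    then show "AE s in lborel. norm (indicator {p..q} s * tail_integrand X s) \<le> norm (indicator {p..q} s *\<^sub>R (2 * kern_const / (pi * p) + 2))"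
      by (intro AE_I2) (simp add: indicator_def)
  qed simp
qed

context indep_symmetric3
begin

lemma m_nonneg: "0 \<le> m" unfolding m_def using b_nonneg by (simp add: sum_nonneg)

lemma S_integrable: "integrable M S"
proof -
  have "integrable M (Y i)" if i: "i \<in> I" for i
  proof (rule Bochner_Integration.integrable_bound[of M "\<lambda>\<omega>. 1 + (Y i \<omega>)^2"])
    show "integrable M (\<lambda>\<omega>. 1 + (Y i \<omega>)^2)" using int2[OF i] by simp
    have "\<bar>y\<bar> \<le> 1 + y^2" for y :: real using zero_le_power2[of "\<bar>y\<bar> - 1/2"] by (simp add: power2_eq_square field_simps)
    then show "AE \<omega> in M. norm (Y i \<omega>) \<le> norm (1 + (Y i \<omega>)^2)" by simp
  qed (use i in auto)
  then show ?thesis unfolding S_def[abs_def] by simp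
qed

text \<open>The value u is the frequency t where the estimate changes from
  \<open>cf_prod_diff\<close> to \<open>cf_prod_abs\<close>, that is s = u / T. The three summands
  are the Gaussian majorant, the near range and the tail.\<close>

lemma master:
  assumes m: "0 < m" and u: "0 < u" "m * u^3 \<le> 7" "u * m \<le> 26/10"
  defines "T \<equiv> 26/10 / m"
  shows "\<bar>prob {\<omega> \<in> space M. S \<omega> < x} - Phi x\<bar> \<le>
     (sqrt_half_pi / T - 1 / T^2 + 64/100 * (sqrt_half_pi / T^3))
     + (kern_const / pi * (m / 10 * sqrt_half_pi) + kern_const / pi * (55/1000 * m^2 * (8 - (u^4 + 4 * u^2 + 8) * exp (-(u^2)/2))))
     + (\<integral>s. indicator {u / T..1} s * tail_integrand (T^2/2) s \<partial>lborel)"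
proof -
  have T: "0 < T" using m by (simp add: T_def)
  define s1 where "s1 = u / T"
  have s1: "0 < s1" "s1 \<le> 1" using u T m by (auto simp: s1_def T_def field_simps)
  have s1T: "s1 * T = u" using T by (simp add: s1_def)
  have mT: "m * T = 26/10" using m by (simp add: T_def)
  let ?g = "\<lambda>s. exp (-((s * T)^2)/2)"
  \<comment> \<open>The part linear in m t^3 is integrated over the whole half line, where its
    moment is simple; the quadratic part \<open>A2\<close> is cut off at \<open>s1\<close>.\<close>
  define A1 where "A1 s = kern_const / pi * (m * T^3 / 10) * (indicator {0<..} s * (s^2 * ?g s))" for s
  define A2 where "A2 s = kern_const / pi * (55/1000 * m^2 * T^6) * ((s^5 * ?g s) * indicator {0..s1} s)" for s
  define B where "B s = indicator {s1..1} s * tail_integrand (T^2/2) s" for s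
  define q where "q s = indicator {0<..} s * (majorant s * ?g s)" for s
  have iq: "has_bochner_integral lborel q (sqrt_half_pi / T - 1 / T^2 + 64/100 * (sqrt_half_pi / T^3))"
    unfolding q_def by (rule gauss_majorant[OF T])
  have iA1: "has_bochner_integral lborel A1 (kern_const / pi * (m * T^3 / 10) * (sqrt_half_pi / T^3))"
    unfolding A1_def by (intro has_bochner_integral_mult_right gauss_moments[OF T])
  have iA2: "has_bochner_integral lborel A2 (kern_const / pi * (55/1000 * m^2 * T^6) * ((8 - (u^4 + 4 * u^2 + 8) * exp (-(u^2)/2)) / T^6))"
    unfolding A2_def using gauss_mom5[OF T less_imp_le[OF s1(1)]] by (intro has_bochner_integral_mult_right) (simp only: s1T)
  have iB: "has_bochner_integral lborel B (\<integral>s. B s \<partial>lborel)"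
    unfolding B_def using tail_integrand_integrable[of s1 1 "T^2/2"] s1 by (simp add: has_bochner_integral_iff)
  have tot: "has_bochner_integral lborel (\<lambda>s. q s + (A1 s + A2 s) + B s)
    ((sqrt_half_pi / T - 1 / T^2 + 64/100 * (sqrt_half_pi / T^3)) + (kern_const / pi * (m * T^3 / 10) * (sqrt_half_pi / T^3) + kern_const / pi * (55/1000 * m^2 * T^6) * ((8 - (u^4 + 4 * u^2 + 8) * exp (-(u^2)/2)) / T^6)) + (\<integral>s. B s \<partial>lborel))"
    by (intro has_bochner_integral_add iq iA1 iA2 iB)
  have pos: "0 \<le> A1 s" "0 \<le> A2 s" "0 \<le> B s" if "0 < s" for s
    using that m T s1 tail_integrand_bound(1)[of s1 s "T^2/2"] by (auto simp: A1_def A2_def B_def kern_const_def indicator_def)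
  let ?f = "\<lambda>t. \<Prod>i\<in>I. cf i t"
  have ind: "indicator {0<..} s * (q s + (A1 s + A2 s) + B s) = q s + (A1 s + A2 s) + B s" for s
    using s1 by (auto simp: q_def A1_def A2_def B_def indicator_def)
  have "\<bar>prob {\<omega> \<in> space M. S \<omega> < x} - Phi x\<bar> \<le> (\<integral>s. indicator {0<..} s * (q s + (A1 s + A2 s) + B s) \<partial>lborel)"
  proof (rule smoothing_bound[OF S_measurable S_integrable sin_S cos_S T])
    show "integrable lborel (\<lambda>s. indicator {0<..} s * (q s + (A1 s + A2 s) + B s))"
      unfolding ind using tot by (simp add: has_bochner_integral_iff)
    fix s \<theta> \<sigma> :: real
    assume s: "0 < s" "s \<noteq> 1" and \<sigma>: "\<bar>\<sigma>\<bar> = 1"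
    have g: "0 \<le> ?g s" by simp
    have sT: "0 \<le> s * T" using s T by simp
    show "(if s \<le> 1 then (\<sigma> * kern s * sin \<theta> + (1 - s) * cos \<theta>) * ?f (s * T) else 0) - \<sigma> * (sin \<theta> / (pi * s)) * ?g s
      \<le> q s + (A1 s + A2 s) + B s"
    proof (cases "s < 1")
      case False
      then have "1 < s" using s by simp
      then have "- \<sigma> * (sin \<theta> / (pi * s)) * ?g s \<le> majorant s * ?g s"
        using sine_part_bound[OF s(1) \<sigma> g, of \<theta>] by (simp add: gauss_tail_def)
      then show ?thesis using False s pos[OF s(1)] by (simp add: q_def)
    next
      case lt: True
      show ?thesis
      proof (cases "s < s1")
        case True
        have "m * (s * T)^3 \<le> m * u^3"
          using True T m s by (intro mult_left_mono power_mono) (auto simp flip: s1T)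
        then have "m * (s * T)^3 \<le> 7" using u by linarith
        from cf_prod_diff[OF sT this]
        have "kern_const / (pi * s) * \<bar>?f (s * T) - ?g s\<bar> \<le> kern_const / (pi * s) * (?g s * (1/10 * (m * (s * T)^3) + 55/1000 * (m * (s * T)^3)^2))"
          using s by (intro mult_left_mono) (auto simp: kern_const_def)
        also have "\<dots> = A1 s + A2 s"
          using s True by (simp add: A1_def A2_def indicator_def eval_nat_numeral field_simps)
        finally show ?thesis
          using integrand_bound_main[OF s(1) lt \<sigma> g, of \<theta> "?f (s * T)"] lt s pos(3)[OF s(1)] by (simp add: q_def)
      next
        case False
        have "kern_tail s * \<bar>?f (s * T)\<bar> \<le> kern_tail s * exp (-((s * T)^2)/2 + 381/2000 * (m * (s * T)^3))"
          using cf_prod_abs[OF sT] kern_tail_nonneg[of s] s lt by (intro mult_left_mono) auto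
        also have "-((s * T)^2)/2 + 381/2000 * (m * (s * T)^3) = - (T^2/2 * damped_square s)"
        proof -
          have "m * (s * T)^3 = (m * T) * s^3 * T^2" by (simp add: power2_eq_square power3_eq_cube)
          then show ?thesis unfolding mT by (simp add: damped_square_def power2_eq_square power3_eq_cube field_simps)
        qed
        finally have "kern_tail s * \<bar>?f (s * T)\<bar> + gauss_tail s * ?g s \<le> B s"
          using False lt by (simp add: B_def tail_integrand_def indicator_def power_mult_distrib mult.commute)
        then show ?thesis
          using integrand_bound_tail[OF s(1) lt \<sigma> g, of \<theta> "?f (s * T)"] lt s pos(1,2)[OF s(1)] by (simp add: q_def)
      qed
    qed
  qed
  also have "\<dots> = (sqrt_half_pi / T - 1 / T^2 + 64/100 * (sqrt_half_pi / T^3)) + (kern_const / pi * (m * T^3 / 10) * (sqrt_half_pi / T^3) + kern_const / pi * (55/1000 * m^2 * T^6) * ((8 - (u^4 + 4 * u^2 + 8) * exp (-(u^2)/2)) / T^6)) + (\<integral>s. B s \<partial>lborel)"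
    unfolding ind using tot by (simp only: has_bochner_integral_iff)
  also have "kern_const / pi * (m * T^3 / 10) * (sqrt_half_pi / T^3) = kern_const / pi * (m / 10 * sqrt_half_pi)" using T by simp
  also have "kern_const / pi * (55/1000 * m^2 * T^6) * ((8 - (u^4 + 4 * u^2 + 8) * exp (-(u^2)/2)) / T^6) = kern_const / pi * (55/1000 * m^2 * (8 - (u^4 + 4 * u^2 + 8) * exp (-(u^2)/2)))"
    using T by simp
  finally show ?thesis by (simp add: B_def s1_def)
qed

end

section \<open>Tail integrals by convexity\<close>

text \<open>The right side is the exact integral of the product of two chords with end values k0, k1
  and e0, e1. Two nonnegative convex factors lie below their chords, so this bounds the integral of
  their product from few mesh points.\<close>

lemma chord_product_integral:
  fixes p q k0 k1 e0 e1 :: real and h :: "real \<Rightarrow> real"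
  assumes pq: "p < q"
    and int: "integrable lborel (\<lambda>s. indicator {p..q} s * h s)"
    and h: "\<And>s. p \<le> s \<Longrightarrow> s \<le> q \<Longrightarrow> h s \<le> ((k1 - k0) / (q - p) * (s - p) + k0) * ((e1 - e0) / (q - p) * (s - p) + e0)"
  shows "(\<integral>s. indicator {p..q} s * h s \<partial>lborel) \<le> (q - p) / 6 * (2 * k0 * e0 + 2 * k1 * e1 + k0 * e1 + k1 * e0)"
proof -
  define A B where "A = (k1 - k0) / (q - p)" and "B = (e1 - e0) / (q - p)"
  have AB: "k1 = k0 + A * (q - p)" "e1 = e0 + B * (q - p)" using pq by (simp_all add: A_def B_def)
  define F where "F s = A * B * (s - p)^3 / 3 + (A * e0 + B * k0) * (s - p)^2 / 2 + k0 * e0 * (s - p)" for s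
  have "has_bochner_integral lborel (\<lambda>s. ((A * (s - p) + k0) * (B * (s - p) + e0)) * indicator {p..q} s) (F q - F p)"
  proof (rule has_bochner_integral_FTC_Icc_real)
    show "(F has_real_derivative (A * (s - p) + k0) * (B * (s - p) + e0)) (at s)" for s
      unfolding F_def by (auto intro!: derivative_eq_intros) (simp add: field_simps power2_eq_square)
  qed (use pq in auto)
  then have *: "has_bochner_integral lborel (\<lambda>s. indicator {p..q} s * ((A * (s - p) + k0) * (B * (s - p) + e0))) (F q - F p)"
    by (simp add: mult.commute)
  have "(\<integral>s. indicator {p..q} s * h s \<partial>lborel) \<le> (\<integral>s. indicator {p..q} s * ((A * (s - p) + k0) * (B * (s - p) + e0)) \<partial>lborel)"
    using * h by (intro integral_mono int) (auto simp: has_bochner_integral_iff indicator_def A_def B_def)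
  also have "\<dots> = F q - F p" using * by (simp add: has_bochner_integral_iff)
  also have "\<dots> = (q - p) / 6 * (2 * k0 * e0 + 2 * k1 * e1 + k0 * e1 + k1 * e0)"
    unfolding F_def AB by (simp add: power2_eq_square power3_eq_cube field_simps)
  finally show ?thesis .
qed

lemma chord_le:
  fixes f :: "real \<Rightarrow> real"
  assumes "convex_on {p..q} f" "f p \<le> a" "f q \<le> b" "p \<le> s" "s \<le> q" "p < q"
  shows "f s \<le> (b - a) / (q - p) * (s - p) + a"
proof -
  define l where "l = (s - p) / (q - p)"
  have "l * (q - p) = s - p" using assms by (simp add: l_def)
  then have l: "s = (1 - l) * p + l * q" "0 \<le> l" "l \<le> 1"
    using assms(4-6) by (simp add: algebra_simps, simp_all add: l_def)
  have "f s \<le> (1 - l) * f p + l * f q" using convex_onD_Icc[OF assms(1), of l] l assms(6) by simp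
  also have "\<dots> \<le> (1 - l) * a + l * b" using l assms by (intro add_mono mult_left_mono) auto
  also have "\<dots> = (b - a) / (q - p) * (s - p) + a" by (simp add: l_def algebra_simps diff_divide_distrib)
  finally show ?thesis .
qed

lemma convex_on_second_deriv:
  fixes f f' f'' :: "real \<Rightarrow> real"
  assumes "\<And>x. p \<le> x \<Longrightarrow> x \<le> q \<Longrightarrow> (f has_real_derivative f' x) (at x)"
    and "\<And>x. p \<le> x \<Longrightarrow> x \<le> q \<Longrightarrow> (f' has_real_derivative f'' x) (at x)"
    and "\<And>x. p \<le> x \<Longrightarrow> x \<le> q \<Longrightarrow> 0 \<le> f'' x"
  shows "convex_on {p..q} f"
  by (rule f''_ge0_imp_convex[of _ f f' f'']) (use assms in auto)

text \<open>The second derivative carries the factor X r1^2 - r2 with the derivatives r1, r2 of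
  \<open>damped_square\<close>. From 0.34 on r2 is negative; before that r1 >= 0.28 and X >= 26 give
  X r1^2 > 2 >= r2.\<close>

lemma convex_cubic_exp:
  fixes X p q :: real
  assumes X: "0 \<le> X" and p: "1/5 \<le> p" and cond: "34/100 \<le> p \<or> 26 \<le> X"
  shows "convex_on {p..q} (\<lambda>s. exp (- (X * damped_square s)))"
proof (rule convex_on_second_deriv)
  define r1 r2 where "r1 s = 2 * s - 29718/10000 * s^2" and "r2 s = 2 - 59436/10000 * s" for s :: real
  have d1: "(damped_square has_real_derivative r1 s) (at s)" for s
    unfolding damped_square_def[abs_def] r1_def by (auto intro!: derivative_eq_intros simp: power2_eq_square algebra_simps)
  have d2: "(r1 has_real_derivative r2 s) (at s)" for s
    unfolding r1_def[abs_def] r2_def by (auto intro!: derivative_eq_intros simp: power2_eq_square algebra_simps)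
  show "((\<lambda>s. exp (- (X * damped_square s))) has_real_derivative exp (- (X * damped_square s)) * (- (X * r1 s))) (at s)" for s
    by (auto intro!: derivative_eq_intros d1)
  show "((\<lambda>s. exp (- (X * damped_square s)) * (- (X * r1 s))) has_real_derivative exp (- (X * damped_square s)) * (X * (X * (r1 s)^2 - r2 s))) (at s)" for s
    by (auto intro!: derivative_eq_intros d1 d2 simp: algebra_simps power2_eq_square)
  fix s assume s: "p \<le> s" "s \<le> q"
  have "0 \<le> X * (r1 s)^2 - r2 s"
  proof (cases "34/100 \<le> s")
    case True
    then have "r2 s \<le> 0" by (simp add: r2_def)
    moreover have "0 \<le> X * (r1 s)^2" using X by simp
    ultimately show ?thesis by linarith
  next
    case False
    then have s': "1/5 \<le> s" "s \<le> 34/100" and X26: "26 \<le> X" using s p cond by auto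
    have "0 \<le> (s - 1/5) * (34/100 - s)" using s' by simp
    then have "28/100 \<le> r1 s" using s' by (simp add: r1_def power2_eq_square field_simps)
    then have "(28/100)^2 \<le> (r1 s)^2" by (intro power_mono) auto
    then have "26 * (28/100)^2 \<le> X * (r1 s)^2" using X26 by (intro mult_mono) auto
    then show ?thesis using s' by (simp add: r2_def power2_eq_square)
  qed
  then show "0 \<le> exp (- (X * damped_square s)) * (X * (X * (r1 s)^2 - r2 s))" using X by simp
qed

text \<open>The condition \<open>cond\<close> says that p lies beyond the inflection point 1 / sqrt
  (2 X) of the Gaussian; the linear weight only adds a positive term.\<close>

lemma convex_weighted_gauss:
  fixes X p q :: real
  assumes X: "0 \<le> X" and p: "0 \<le> p" "q \<le> 1/2" and cond: "1 \<le> 2 * X * p^2"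
  shows "convex_on {p..q} (\<lambda>s. (1 - 2 * s) * exp (- (X * s^2)))"
proof (rule convex_on_second_deriv)
  show "((\<lambda>s. (1 - 2 * s) * exp (- (X * s^2))) has_real_derivative exp (- (X * s^2)) * (- 2 - 2 * X * s * (1 - 2 * s))) (at s)" for s
    by (auto intro!: derivative_eq_intros simp: algebra_simps)
  show "((\<lambda>s. exp (- (X * s^2)) * (- 2 - 2 * X * s * (1 - 2 * s))) has_real_derivative exp (- (X * s^2)) * ((1 - 2 * s) * (2 * X * (2 * X * s^2 - 1)) + 8 * X * s)) (at s)" for s
    by (auto intro!: derivative_eq_intros simp: algebra_simps power2_eq_square)
  fix s assume s: "p \<le> s" "s \<le> q"
  have "2 * X * p^2 \<le> 2 * X * s^2" using s p X by (intro mult_left_mono power_mono) auto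
  then show "0 \<le> exp (- (X * s^2)) * ((1 - 2 * s) * (2 * X * (2 * X * s^2 - 1)) + 8 * X * s)"
    using X s p cond by (intro mult_nonneg_nonneg add_nonneg_nonneg) auto
qed

lemma convex_inverse: "0 < p \<Longrightarrow> convex_on {p..q} (\<lambda>s::real. c / s)" if "0 \<le> c" for c :: real
proof (rule convex_on_second_deriv)
  fix s assume "0 < p" "p \<le> s"
  then have s: "0 < s" by simp
  show "((\<lambda>s. c / s) has_real_derivative - c / s^2) (at s)"
    using s by (auto intro!: derivative_eq_intros simp: power2_eq_square)
  show "((\<lambda>s. - c / s^2) has_real_derivative 2 * c / s^3) (at s)"
    using s by (auto intro!: derivative_eq_intros simp: power2_eq_square power3_eq_cube field_simps)
  show "0 \<le> 2 * c / s^3" using s that by simp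
qed

lemma convex_on_eqI: "convex_on A f \<Longrightarrow> (\<And>x. x \<in> A \<Longrightarrow> f x = g x) \<Longrightarrow> convex_on A g" for f g :: "real \<Rightarrow> real"
  by (auto simp: convex_on_def convex_def)

definition cubic_tail :: "real \<Rightarrow> real" where "cubic_tail s = (1 - s) * (1 + 83/100 * (1 - s)^2)"

lemma convex_cubic_tail: "q \<le> 1 \<Longrightarrow> convex_on {p..q} cubic_tail"
proof (rule convex_on_second_deriv)
  fix s assume "q \<le> 1" "s \<le> q"
  show "(cubic_tail has_real_derivative - 1 - 249/100 * (1 - s)^2) (at s)"
    unfolding cubic_tail_def[abs_def] by (auto intro!: derivative_eq_intros) (simp add: power2_eq_square left_diff_distrib right_diff_distrib diff_divide_distrib mult.assoc add_divide_distrib)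
  show "((\<lambda>s. - 1 - 249/100 * (1 - s)^2) has_real_derivative 498/100 * (1 - s)) (at s)"
    by (auto intro!: derivative_eq_intros) (simp add: diff_divide_distrib)
  show "0 \<le> 498/100 * (1 - s)" using \<open>q \<le> 1\<close> \<open>s \<le> q\<close> by simp
qed

definition kern_const_pi :: real where "kern_const_pi = 32915/100000"

lemma kern_const_pi_le: "kern_const / pi \<le> kern_const_pi"
  unfolding kern_const_def kern_const_pi_def using pi_lower by (simp add: field_simps)

text \<open>Both exponentials of the tail integrand are given the common coefficient
  \<open>tail_coeff\<close>, at the small cost of replacing 1/pi by \<open>kern_const_pi\<close> in
  the Gaussian one. The integrand is then bounded by a product of two convex functions on each mesh
  piece.\<close>

definition tail_exp :: "real \<Rightarrow> real \<Rightarrow> real" where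
  "tail_exp X s = exp (- (X * damped_square s)) + max 0 (1 - 2 * s) * exp (- (X * s^2))"

text \<open>The side is a flag and not a test on s, because s = 1/2 is an end point of pieces on
  both sides and the two coefficients differ there.\<close>

definition tail_coeff :: "bool \<Rightarrow> real \<Rightarrow> real" where "tail_coeff low s = (if low then kern_const_pi / s else cubic_tail s)"

lemma tail_integrand_le:
  assumes s: "0 < s" "s \<le> 1" "if low then s \<le> 1/2 else 1/2 \<le> s"
  shows "tail_integrand X s \<le> tail_coeff low s * tail_exp X s"
proof (cases low)
  case True
  then have s2: "s \<le> 1/2" using s by simp
  have a: "kern_tail s \<le> kern_const_pi / s"
  proof (cases "s < 1/2")
    case True
    have "kern_const / pi / s \<le> kern_const_pi / s" using kern_const_pi_le s(1) by (intro divide_right_mono) auto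
    then show ?thesis using True by (simp add: kern_tail_def)
  next
    case False
    then have "s = 1/2" using s2 by simp
    show ?thesis unfolding \<open>s = 1/2\<close> by (simp add: kern_tail_def kern_const_pi_def power2_eq_square)
  qed
  have b: "gauss_tail s \<le> kern_const_pi / s * max 0 (1 - 2 * s)"
  proof (cases "s < 1/2")
    case True
    have "1 / pi \<le> kern_const / pi" by (intro divide_right_mono) (auto simp: kern_const_def)
    then have "1 / pi \<le> kern_const_pi" using kern_const_pi_le by linarith
    then have "(1 / pi) * ((1 - 2 * s) / s) \<le> kern_const_pi * ((1 - 2 * s) / s)" using True s(1) by (intro mult_right_mono) auto
    then show ?thesis using True by (simp add: gauss_tail_def)
  next
    case False
    then show ?thesis by (simp add: gauss_tail_def)
  qed
  have "tail_integrand X s \<le> kern_const_pi / s * exp (- (X * damped_square s)) + kern_const_pi / s * max 0 (1 - 2 * s) * exp (- (X * s^2))"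
    unfolding tail_integrand_def using a b by (intro add_mono mult_right_mono) auto
  then show ?thesis using True by (simp add: tail_coeff_def tail_exp_def algebra_simps)
next
  case False
  then have "1/2 \<le> s" using s by simp
  then show ?thesis using False by (simp add: tail_integrand_def kern_tail_def gauss_tail_def tail_coeff_def cubic_tail_def tail_exp_def)
qed

lemma tail_piece:
  fixes X p q e0 e1 :: real
  assumes X: "0 \<le> X" and pq: "1/5 \<le> p" "p < q" "q \<le> 1"
    and side: "if q \<le> 1/2 then 1 \<le> 2 * X * p^2 \<and> (34/100 \<le> p \<or> 26 \<le> X) else 1/2 \<le> p"
    and e: "tail_exp X p \<le> e0" "tail_exp X q \<le> e1"
  shows "(\<integral>s. indicator {p..q} s * tail_integrand X s \<partial>lborel) \<le>
    (q - p) / 6 * (2 * tail_coeff (q \<le> 1/2) p * e0 + 2 * tail_coeff (q \<le> 1/2) q * e1 + tail_coeff (q \<le> 1/2) p * e1 + tail_coeff (q \<le> 1/2) q * e0)"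
proof (rule chord_product_integral[OF pq(2)])
  show "integrable lborel (\<lambda>s. indicator {p..q} s * tail_integrand X s)"
    using X pq by (intro tail_integrand_integrable) auto
  have conv_k: "convex_on {p..q} (tail_coeff (q \<le> 1/2))"
  proof -
    have "convex_on {p..q} (\<lambda>s. kern_const_pi / s)" using pq by (intro convex_inverse) (auto simp: kern_const_pi_def)
    then show ?thesis using convex_cubic_tail[of q p] pq by (cases "q \<le> 1/2") (simp_all add: tail_coeff_def[abs_def])
  qed
  have conv_h: "convex_on {p..q} (tail_exp X)"
  proof (cases "q \<le> 1/2")
    case True
    have "convex_on {p..q} (\<lambda>s. exp (- (X * damped_square s)) + (1 - 2 * s) * exp (- (X * s^2)))"
      using side True X pq by (intro convex_on_add convex_cubic_exp convex_weighted_gauss) auto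
    then show ?thesis by (rule convex_on_eqI) (use True in \<open>auto simp: tail_exp_def\<close>)
  next
    case False
    have "convex_on {p..q} (\<lambda>s. exp (- (X * damped_square s)))"
      using side False X pq by (intro convex_cubic_exp) auto
    then show ?thesis by (rule convex_on_eqI) (use False side in \<open>auto simp: tail_exp_def\<close>)
  qed
  fix s assume s: "p \<le> s" "s \<le> q"
  have s0: "0 < s" using s pq by simp
  have h0: "0 \<le> tail_exp X s" by (simp add: tail_exp_def)
  have k0: "0 \<le> tail_coeff (q \<le> 1/2) s" using s pq by (auto simp: tail_coeff_def kern_const_pi_def cubic_tail_def)
  have "tail_integrand X s \<le> tail_coeff (q \<le> 1/2) s * tail_exp X s"
    by (rule tail_integrand_le) (use s side s0 pq in auto)
  also have "\<dots> \<le> ((tail_coeff (q \<le> 1/2) q - tail_coeff (q \<le> 1/2) p) / (q - p) * (s - p) + tail_coeff (q \<le> 1/2) p) * ((e1 - e0) / (q - p) * (s - p) + e0)"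
  proof (rule mult_mono)
    show k: "tail_coeff (q \<le> 1/2) s \<le> (tail_coeff (q \<le> 1/2) q - tail_coeff (q \<le> 1/2) p) / (q - p) * (s - p) + tail_coeff (q \<le> 1/2) p"
      by (rule chord_le[OF conv_k order.refl order.refl s pq(2)])
    then show "0 \<le> (tail_coeff (q \<le> 1/2) q - tail_coeff (q \<le> 1/2) p) / (q - p) * (s - p) + tail_coeff (q \<le> 1/2) p" using k0 by linarith
    show "tail_exp X s \<le> (e1 - e0) / (q - p) * (s - p) + e0"
      by (rule chord_le[OF conv_h e s pq(2)])
  qed (rule h0)
  finally show "tail_integrand X s \<le> \<dots>" .
qed

text \<open>Replacing $m$ by the right end $b$ of its range: $r \ge b^2/6.76$ makes $m \mapsto e^{-3.38 r/m^2}/m$ increasing up to $b$.\<close>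

lemma scaled_exp_mono:
  fixes m b r :: real
  assumes m: "0 < m" "m \<le> b" and r: "b^2 \<le> 676/100 * r"
  shows "exp (- (338/100 / m^2 * r)) / m \<le> exp (- (338/100 / b^2 * r)) / b"
proof -
  \<comment> \<open>In terms of z >= 1 the claim becomes z <= exp (y (z^2 - 1)). As y >= 1/2, the
    right side is at least 1 + (z^2 - 1)/2, which is at least z.\<close>
  define z where "z = b / m"
  have b: "0 < b" using m by simp
  have z: "1 \<le> z" "b = z * m" using m by (auto simp: z_def)
  define y where "y = 338/100 / b^2 * r"
  have y: "1/2 \<le> y" using r b by (simp add: y_def field_simps)
  have "338/100 / m^2 * r = y * z^2" using m b by (simp add: y_def z_def power_divide)
  then have "338/100 / m^2 * r - y = y * (z^2 - 1)" by (simp add: algebra_simps)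
  also have "\<dots> \<ge> 1/2 * (z^2 - 1)" using y z by (intro mult_right_mono) (auto simp: one_le_power)
  finally have "(z^2 - 1) / 2 \<le> 338/100 / m^2 * r - y" by simp
  then have "1 + (z^2 - 1) / 2 \<le> exp (338/100 / m^2 * r - y)"
    using exp_ge_add_one_self[of "338/100 / m^2 * r - y"] by linarith
  moreover have "z \<le> 1 + (z^2 - 1) / 2" using zero_le_power2[of "z - 1"] by (simp add: power2_eq_square field_simps)
  ultimately have "z \<le> exp (338/100 / m^2 * r - y)" by linarith
  then have "exp (- (338/100 / m^2 * r)) * z \<le> exp (- (338/100 / m^2 * r)) * exp (338/100 / m^2 * r - y)"
    by (intro mult_left_mono) auto
  also have "\<dots> = exp (- y)" by (simp flip: exp_add)
  finally have "exp (- (338/100 / m^2 * r)) * b \<le> exp (- y) * m" using m by (simp add: z_def field_simps)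
  then show ?thesis using m b unfolding y_def[symmetric] by (subst divide_le_eq) (auto simp: pos_le_divide_eq)
qed

text \<open>Two ways to remove m: bounding 1/m by 1/a always works; the sharper 1/b rests on
  \<open>scaled_exp_mono\<close>, whose condition may fail near s = 1, where
  \<open>damped_square\<close> is small.\<close>

lemma tail_integrand_scaled_le:
  fixes a m b s :: real
  assumes m: "0 < a" "a \<le> m" "m \<le> b" and s: "0 < s" "s \<le> 1"
  shows "tail_integrand (338/100 / m^2) s / m \<le> tail_integrand (338/100 / b^2) s / a"
    and "b^2 \<le> 676/100 * damped_square s \<Longrightarrow> tail_integrand (338/100 / m^2) s / m \<le> tail_integrand (338/100 / b^2) s / b"
proof -
  have m0: "0 < m" using m by simp
  have K: "0 \<le> kern_tail s" "0 \<le> gauss_tail s" using kern_tail_nonneg[OF s] gauss_tail_nonneg[OF s(1)] by auto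
  have rs: "0 \<le> damped_square s" "damped_square s \<le> s^2" using s by (auto simp: damped_square_def mult_left_le)
  have X: "338/100 / b^2 \<le> 338/100 / m^2" using m m0 by (intro divide_left_mono power_mono mult_pos_pos zero_less_power) auto
  have mono: "exp (- (338/100 / m^2 * r)) / m \<le> exp (- (338/100 / b^2 * r)) / a" if "0 \<le> r" for r
    using m m0 that mult_right_mono[OF X that] by (intro frac_le) auto
  have split: "tail_integrand Y s / c = kern_tail s * (exp (- (Y * damped_square s)) / c) + gauss_tail s * (exp (- (Y * s^2)) / c)" for Y c
    by (simp add: tail_integrand_def add_divide_distrib)
  show "tail_integrand (338/100 / m^2) s / m \<le> tail_integrand (338/100 / b^2) s / a"
    unfolding split using K rs mono[OF rs(1)] mono[OF zero_le_power2] by (intro add_mono mult_left_mono) auto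
  assume "b^2 \<le> 676/100 * damped_square s"
  then show "tail_integrand (338/100 / m^2) s / m \<le> tail_integrand (338/100 / b^2) s / b"
    unfolding split using K rs m m0 by (intro add_mono mult_left_mono scaled_exp_mono) auto
qed

text \<open>A mesh point \<open>s\<close> is paired with an upper bound for \<open>tail_exp (338/100 / b^2) s\<close>.\<close>

fun tail_sum :: "real \<Rightarrow> real \<Rightarrow> (real \<times> real) list \<Rightarrow> real" where
  "tail_sum a b ((p, e0) # (q, e1) # ns) =
     (if b^2 \<le> 676/100 * (p^2 * (1 - 9906/10000 * q)) then 1 / b else 1 / a)
       * ((q - p) / 6 * (2 * tail_coeff (q \<le> 1/2) p * e0 + 2 * tail_coeff (q \<le> 1/2) q * e1 + tail_coeff (q \<le> 1/2) p * e1 + tail_coeff (q \<le> 1/2) q * e0))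
     + tail_sum a b ((q, e1) # ns)"
| "tail_sum a b _ = 0"

text \<open>Collects the side conditions of \<open>tail_piece\<close> for X = 3.38/b^2: b^2 <= 6.76
  s^2 means 1 <= 2 X s^2, and b <= 0.36 implies X >= 26. No piece may straddle 1/2, and the mesh
  runs from p to 1.\<close>

fun tail_nodes :: "real \<Rightarrow> real \<Rightarrow> (real \<times> real) list \<Rightarrow> bool" where
  "tail_nodes b p [] = False"
| "tail_nodes b p [(s, e)] = (p = s \<and> s = 1)"
| "tail_nodes b p ((s, e0) # (q, e1) # ns) = (p = s \<and> 1/5 \<le> s \<and> s < q \<and> q \<le> 1
     \<and> (if q \<le> 1/2 then b^2 \<le> 676/100 * s^2 \<and> (34/100 \<le> s \<or> b \<le> 36/100) else 1/2 \<le> s)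
     \<and> tail_nodes b q ((q, e1) # ns))"

lemma tail_sum_bound:
  fixes a b m :: real
  assumes m: "0 < a" "a \<le> m" "m \<le> b"
    and "tail_nodes b p ns" "\<forall>(s, e)\<in>set ns. tail_exp (338/100 / b^2) s \<le> e"
  shows "(\<integral>s. indicator {p..1} s * tail_integrand (338/100 / m^2) s \<partial>lborel) / m \<le> tail_sum a b ns"
  using assms(4,5)
proof (induction ns arbitrary: p rule: induct_list012)
  case 1
  then show ?case by simp
next
  case (2 v)
  have "AE s in lborel. indicator {1..1::real} s * tail_integrand (338/100 / m^2) s = 0"
    using AE_lborel_singleton[of 1] by eventually_elim (auto simp: indicator_def)
  then have "(\<integral>s. indicator {1..1::real} s * tail_integrand (338/100 / m^2) s \<partial>lborel) = 0"
    by (rule integral_eq_zero_AE)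
  moreover have "p = 1" using 2 by (cases v) auto
  ultimately show ?case by (cases v) simp
next
  case (3 v w ns)
  obtain e0 where v: "v = (p, e0)" using "3.prems"(1) by (cases v, cases w) auto
  obtain q e1 where w: "w = (q, e1)" by (cases w)
  have nodes: "1/5 \<le> p" "p < q" "q \<le> 1" "tail_nodes b q (w # ns)"
    and side: "if q \<le> 1/2 then b^2 \<le> 676/100 * p^2 \<and> (34/100 \<le> p \<or> b \<le> 36/100) else 1/2 \<le> p"
    using "3.prems"(1) by (auto simp: v w)
  have e: "tail_exp (338/100 / b^2) p \<le> e0" "tail_exp (338/100 / b^2) q \<le> e1" using "3.prems"(2) by (auto simp: v w)
  have b: "0 < b" "0 < m" using m by auto
  \<comment> \<open>The two factors of \<open>damped_square\<close> are minimised separately, at p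
    and at q, so that the test at the end points is valid on the whole piece.\<close>
  let ?f = "if b^2 \<le> 676/100 * (p^2 * (1 - 9906/10000 * q)) then 1 / b else 1 / a"
  let ?Xm = "338/100 / m^2" and ?Xb = "338/100 / b^2"
  have Xb: "0 \<le> ?Xb" "0 \<le> ?Xm" by simp_all
  have f: "tail_integrand ?Xm s / m \<le> ?f * tail_integrand ?Xb s" if s: "p \<le> s" "s \<le> q" for s
  proof (cases "b^2 \<le> 676/100 * (p^2 * (1 - 9906/10000 * q))")
    case True
    have "p^2 * (1 - 9906/10000 * q) \<le> damped_square s"
      unfolding damped_square_def using s nodes by (intro mult_mono power_mono) auto
    then have "b^2 \<le> 676/100 * damped_square s" using True by linarith
    then show ?thesis using tail_integrand_scaled_le(2)[OF m, of s] s nodes True by simp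
  next
    case False
    then show ?thesis using tail_integrand_scaled_le(1)[OF m, of s] s nodes by simp
  qed
  have i: "integrable lborel (\<lambda>s. indicator {x..y} s * tail_integrand ?Xm s)" "integrable lborel (\<lambda>s. indicator {x..y} s * tail_integrand ?Xb s)"
    if "p \<le> x" "y \<le> 1" for x y using that nodes Xb by (auto intro!: tail_integrand_integrable)
  have "(\<integral>s. indicator {p..1} s * tail_integrand ?Xm s \<partial>lborel) / m = (\<integral>s. (indicator {p..1} s * tail_integrand ?Xm s) / m \<partial>lborel)" by simp
  also have "\<dots> \<le> (\<integral>s. ?f * (indicator {p..q} s * tail_integrand ?Xb s) + (indicator {q..1} s * tail_integrand ?Xm s) / m \<partial>lborel)"
  proof (rule integral_mono)
    fix s :: real
    have pos: "0 \<le> tail_integrand ?Xm s" "0 \<le> tail_integrand ?Xb s" if "p \<le> s" "s \<le> 1"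
      using tail_integrand_bound(1)[of p s] that nodes Xb by auto
    have fpos: "0 \<le> ?f" using b m by simp
    consider "s < p \<or> 1 < s" | "p \<le> s" "s \<le> q" | "q < s" "s \<le> 1" by linarith
    then show "indicator {p..1} s * tail_integrand ?Xm s / m \<le> ?f * (indicator {p..q} s * tail_integrand ?Xb s) + indicator {q..1} s * tail_integrand ?Xm s / m"
    proof cases
      case 1
      then show ?thesis using nodes by (auto simp: indicator_def)
    next
      case 2
      then have "0 \<le> indicator {q..1} s * tail_integrand ?Xm s / m" using pos b nodes by (simp add: indicator_def)
      then show ?thesis using f[OF 2] 2 nodes by (simp add: indicator_def)
    next
      case 3
      then show ?thesis using nodes by (simp add: indicator_def)
    qed
  qed (use i nodes in \<open>auto intro!: Bochner_Integration.integrable_add integrable_divide integrable_mult_right\<close>)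
  also have "\<dots> = ?f * (\<integral>s. indicator {p..q} s * tail_integrand ?Xb s \<partial>lborel) + (\<integral>s. indicator {q..1} s * tail_integrand ?Xm s \<partial>lborel) / m"
  proof -
    have "integrable lborel (\<lambda>s. ?f * (indicator {p..q} s * tail_integrand ?Xb s))" "integrable lborel (\<lambda>s. indicator {q..1} s * tail_integrand ?Xm s / m)"
      using i[of p q] i[of q 1] nodes by simp_all
    then show ?thesis by (subst Bochner_Integration.integral_add) simp_all
  qed
  also have "\<dots> \<le> tail_sum a b (v # w # ns)"
  proof -
    have "0 \<le> ?f" using b m by simp
    moreover have "if q \<le> 1/2 then 1 \<le> 2 * ?Xb * p^2 \<and> (34/100 \<le> p \<or> 26 \<le> ?Xb) else 1/2 \<le> p"
    proof (cases "q \<le> 1/2")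
      case True
      have "26 \<le> ?Xb" if "b \<le> 36/100"
      proof -
        have "b^2 \<le> (36/100)^2" using that b by (intro power_mono) auto
        then have "26 * b^2 \<le> 338/100" by (simp add: power2_eq_square)
        then show ?thesis using b by (simp add: field_simps)
      qed
      then show ?thesis using side True b by (auto simp: field_simps)
    qed (use side in simp)
    ultimately have "?f * (\<integral>s. indicator {p..q} s * tail_integrand ?Xb s \<partial>lborel) \<le> ?f * ((q - p) / 6 * (2 * tail_coeff (q \<le> 1/2) p * e0 + 2 * tail_coeff (q \<le> 1/2) q * e1 + tail_coeff (q \<le> 1/2) p * e1 + tail_coeff (q \<le> 1/2) q * e0))"
      using tail_piece[OF Xb(1) nodes(1-3) _ e] by (intro mult_left_mono) auto
    moreover have "(\<integral>s. indicator {q..1} s * tail_integrand ?Xm s \<partial>lborel) / m \<le> tail_sum a b (w # ns)"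
      using "3.IH"(2)[OF nodes(4)] "3.prems"(2) by simp
    ultimately show ?thesis unfolding v w tail_sum.simps by (rule add_mono)
  qed
  finally show ?case by (simp add: v)
qed

lemma exp_neg_le_taylor4:
  assumes "0 \<le> (x::real)"
  shows "exp (-x) \<le> 1 - x + x^2/2 - x^3/6 + x^4/24"
  using nonneg_from_deriv[of "\<lambda>t. 1 - t + t^2/2 - t^3/6 + t^4/24 - exp (-t)" 0 x "\<lambda>t. exp (-t) - (1 - t + t^2/2 - t^3/6)"]
    assms exp_neg_ge_taylor3
  by (fastforce intro!: derivative_eq_intros simp: algebra_simps)

lemma exp_neg_upper_chain:
  fixes x y t0 t1 t2 t3 t4 :: real
  assumes "0 \<le> y" "16 * y \<le> x" "1 - y + y^2/2 - y^3/6 + y^4/24 \<le> t0"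
    "t0^2 \<le> t1" "t1^2 \<le> t2" "t2^2 \<le> t3" "t3^2 \<le> t4"
  shows "exp (-x) \<le> t4"
proof -
  have "exp (-y) \<le> t0" using exp_neg_le_taylor4[OF assms(1)] assms(3) by linarith
  then have "exp (-2*y) \<le> t1" using power_chain_mono[OF _ _ assms(4)] exp_square[of "-2*y"] by simp
  then have "exp (-4*y) \<le> t2" using power_chain_mono[OF _ _ assms(5)] exp_square[of "-4*y"] by simp
  then have "exp (-8*y) \<le> t3" using power_chain_mono[OF _ _ assms(6)] exp_square[of "-8*y"] by simp
  then have "exp (-16*y) \<le> t4" using power_chain_mono[OF _ _ assms(7)] exp_square[of "-16*y"] by simp
  then show ?thesis using assms(2) by (smt (verit) exp_le_cancel_iff)
qed

lemma tail_exp_le_high: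
  fixes b s y t0 t1 t2 t3 e :: real
  assumes "1/2 \<le> s" and "0 \<le> y" "16 * y \<le> 338/100 / b^2 * (s^2 * (1 - 9906/10000 * s))" "1 - y + y^2/2 - y^3/6 + y^4/24 \<le> t0"
    "t0^2 \<le> t1" "t1^2 \<le> t2" "t2^2 \<le> t3" "t3^2 \<le> e"
  shows "tail_exp (338/100 / b^2) s \<le> e"
  using exp_neg_upper_chain[OF assms(2-)] assms(1) by (simp add: tail_exp_def damped_square_def)

lemma tail_exp_le_low:
  fixes b s y t0 t1 t2 t3 t z g0 g1 g2 g3 g e :: real
  assumes "s \<le> 1/2" and "0 \<le> y" "16 * y \<le> 338/100 / b^2 * (s^2 * (1 - 9906/10000 * s))" "1 - y + y^2/2 - y^3/6 + y^4/24 \<le> t0"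
    "t0^2 \<le> t1" "t1^2 \<le> t2" "t2^2 \<le> t3" "t3^2 \<le> t"
    and "0 \<le> z" "16 * z \<le> 338/100 / b^2 * s^2" "1 - z + z^2/2 - z^3/6 + z^4/24 \<le> g0"
    "g0^2 \<le> g1" "g1^2 \<le> g2" "g2^2 \<le> g3" "g3^2 \<le> g"
    and "t + (1 - 2 * s) * g \<le> e"
  shows "tail_exp (338/100 / b^2) s \<le> e"
proof -
  have "exp (- (338/100 / b^2 * damped_square s)) \<le> t"
    using exp_neg_upper_chain[OF assms(2-8)] by (simp add: damped_square_def)
  moreover have "(1 - 2 * s) * exp (- (338/100 / b^2 * s^2)) \<le> (1 - 2 * s) * g"
    using exp_neg_upper_chain[OF assms(9-15)] assms(1) by (intro mult_left_mono) auto
  moreover have "max 0 (1 - 2 * s) = 1 - 2 * s" using assms(1) by simp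
  ultimately show ?thesis unfolding tail_exp_def using assms(16) by simp
qed

lemma sqrt_half_pi_bounds: "0 < sqrt_half_pi" "sqrt_half_pi \<le> 12534/10000"
proof -
  show "0 < sqrt_half_pi" by (simp add: sqrt_half_pi_def)
  show "sqrt_half_pi \<le> 12534/10000" unfolding sqrt_half_pi_def using pi_upper by (intro real_le_lsqrt) (auto simp: power2_eq_square)
qed

text \<open>The closed-form part of \<open>master\<close> divided by m, with T = 2.6/m inserted,
  sqrt (pi/2) rounded up to 1.2534, and D bounding the truncated fifth moment. The quadratic
  coefficient in x is positive, so a range of m need only be checked at its ends.\<close>

definition main_poly :: "real \<Rightarrow> real \<Rightarrow> real" where
  "main_poly D x = 12534/26000 - x / (676/100) + 64/100 * (12534/10000) * x^2 / (17576/1000) + kern_const_pi * (12534/100000 + 55/1000 * x * D)"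

lemma main_poly_convex:
  assumes "a \<le> x" "x \<le> b" "main_poly D a \<le> c" "main_poly D b \<le> c"
  shows "main_poly D x \<le> c"
proof (cases "a < b")
  case True
  define A B where "A = 64/100 * (12534/10000) / (17576/1000::real)" and "B = kern_const_pi * (55/1000) * D - 1 / (676/100)"
  define C where "C = 12534/26000 + kern_const_pi * (12534/100000)"
  have eq: "main_poly D z = A * z^2 + B * z + C" for z
    by (simp add: main_poly_def A_def B_def C_def field_simps)
  have "(b - x) * main_poly D a + (x - a) * main_poly D b - (b - a) * main_poly D x = A * ((b - x) * (x - a) * (b - a))"
    unfolding eq by (simp add: power2_eq_square algebra_simps)
  also have "\<dots> \<ge> 0" using assms by (auto simp: A_def)
  finally have "(b - a) * main_poly D x \<le> (b - x) * main_poly D a + (x - a) * main_poly D b" by simp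
  also have "\<dots> \<le> (b - x) * c + (x - a) * c" using assms by (intro add_mono mult_left_mono) auto
  also have "\<dots> = (b - a) * c" by (simp add: algebra_simps)
  finally show ?thesis using True by simp
next
  case False
  then have "x = a" using assms by simp
  then show ?thesis using assms by simp
qed

context indep_symmetric3
begin

lemma master_poly:
  assumes m: "0 < m" and u: "0 < u" "m * u^3 \<le> 7" "u * m \<le> 26/10"
    and D: "8 - (u^4 + 4 * u^2 + 8) * exp (-(u^2)/2) \<le> D"
    and p: "0 < p" "p * (26/10) \<le> u * m"
    and t: "(\<integral>s. indicator {p..1} s * tail_integrand (338/100 / m^2) s \<partial>lborel) / m \<le> t"
    and c: "main_poly D m + t \<le> c"
  shows "\<bar>prob {\<omega> \<in> space M. S \<omega> < x} - Phi x\<bar> \<le> c * m"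
proof -
  let ?T = "26/10 / m"
  let ?E = "8 - (u^4 + 4 * u^2 + 8) * exp (-(u^2)/2)"
  have T2: "?T^2/2 = 338/100 / m^2" by (simp add: power_divide power2_eq_square)
  have pu: "p \<le> u / ?T" using p m by simp
  have "(\<integral>s. indicator {u / ?T..1} s * tail_integrand (?T^2/2) s \<partial>lborel) \<le> (\<integral>s. indicator {p..1} s * tail_integrand (338/100 / m^2) s \<partial>lborel)"
    unfolding T2
  proof (rule integral_mono)
    show "integrable lborel (\<lambda>s. indicator {u / ?T..1} s * tail_integrand (338/100 / m^2) s)"
      using m u by (intro tail_integrand_integrable) auto
    show "integrable lborel (\<lambda>s. indicator {p..1} s * tail_integrand (338/100 / m^2) s)"
      using p by (intro tail_integrand_integrable) auto
    show "indicator {u / ?T..1} s * tail_integrand (338/100 / m^2) s \<le> indicator {p..1} s * tail_integrand (338/100 / m^2) s" for s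
      using pu tail_integrand_bound(1)[of p s "338/100 / m^2"] p by (auto simp: indicator_def)
  qed
  also have "\<dots> \<le> t * m" using t m by (simp add: pos_divide_le_eq)
  finally have tail: "(\<integral>s. indicator {u / ?T..1} s * tail_integrand (?T^2/2) s \<partial>lborel) \<le> t * m" .
  have Wp: "0 \<le> kern_const / pi" by (simp add: kern_const_def)
  have WP0: "0 \<le> kern_const_pi" by (simp add: kern_const_pi_def)
  have a: "sqrt_half_pi / ?T \<le> m * (12534/26000)" using m sqrt_half_pi_bounds by (simp add: field_simps)
  have b: "1 / ?T^2 = m * (m / (676/100))" using m by (simp add: power2_eq_square field_simps)
  have "m^3 * (64/100 * sqrt_half_pi / (17576/1000)) \<le> m^3 * (64/100 * (12534/10000) / (17576/1000))"
    using m sqrt_half_pi_bounds by (intro mult_left_mono) auto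
  then have c': "64/100 * (sqrt_half_pi / ?T^3) \<le> m * (64/100 * (12534/10000) * m^2 / (17576/1000))"
    using m by (simp add: power2_eq_square power3_eq_cube field_simps)
  have "kern_const / pi * (m / 10 * sqrt_half_pi) \<le> kern_const_pi * (m / 10 * (12534/10000))"
    using kern_const_pi_le Wp sqrt_half_pi_bounds m by (intro mult_mono) auto
  then have d: "kern_const / pi * (m / 10 * sqrt_half_pi) \<le> m * (kern_const_pi * (12534/100000))" by (simp add: algebra_simps)
  have E0: "0 \<le> ?E"
  proof -
    have "u^2/2 \<ge> 0" by simp
    have "1 + u^2/2 + (u^2/2)^2/2 \<le> exp (u^2/2)" by (rule exp_lower_Taylor_quadratic) simp
    then have "(u^4 + 4 * u^2 + 8) \<le> 8 * exp (u^2/2)" by (simp add: power_divide)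
    then have "(u^4 + 4 * u^2 + 8) * exp (-(u^2)/2) \<le> 8 * exp (u^2/2) * exp (-(u^2)/2)" by (intro mult_right_mono) auto
    also have "\<dots> = 8" by (simp flip: exp_add)
    finally show ?thesis by simp
  qed
  have "kern_const / pi * (55/1000 * m^2 * ?E) \<le> kern_const_pi * (55/1000 * m^2 * D)"
    using kern_const_pi_le Wp D E0 WP0 by (intro mult_mono) auto
  then have e: "kern_const / pi * (55/1000 * m^2 * ?E) \<le> m * (kern_const_pi * (55/1000 * m * D))" by (simp add: power2_eq_square algebra_simps)
  have "m * main_poly D m = m * (12534/26000) - m * (m / (676/100)) + m * (64/100 * (12534/10000) * m^2 / (17576/1000)) + m * (kern_const_pi * (12534/100000)) + m * (kern_const_pi * (55/1000 * m * D))"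
    by (simp add: main_poly_def algebra_simps)
  moreover have "m * main_poly D m + m * t \<le> m * c" using mult_left_mono[OF c, of m] m by (simp add: algebra_simps)
  ultimately show ?thesis
    using master[OF m u, of x] tail a b c' d e by (simp only: mult.commute[of t m] mult.commute[of c m])
qed

text \<open>Reduces a range [a, b] of m to finitely many rational inequalities. The frequency u is
  fixed on the range, so its conditions are tested at the worse end: m u^3 <= 7 at b, and the start
  p <= u m / 2.6 of the tail at a.\<close>

lemma cell:
  fixes a b :: real
  assumes m: "a \<le> m" "m \<le> b" and ab: "0 < a" "0 < u" "b * u^3 \<le> 7" "u * b \<le> 26/10"
    and ex: "exp (u^2/2) \<le> E" "(8 - D) * E \<le> u^4 + 4 * u^2 + 8" "D \<le> 8"
    and nodes: "tail_nodes b p ns" "\<forall>(s, e)\<in>set ns. tail_exp (338/100 / b^2) s \<le> e"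
    and p: "0 < p" "p * (26/10) \<le> u * a"
    and c: "main_poly D a + tail_sum a b ns \<le> c" "main_poly D b + tail_sum a b ns \<le> c"
  shows "\<bar>prob {\<omega> \<in> space M. S \<omega> < x} - Phi x\<bar> \<le> c * m"
proof (rule master_poly)
  show "0 < m" using m ab by simp
  show "0 < u" by fact
  have "m * u^3 \<le> b * u^3" using m ab by (intro mult_right_mono) auto
  then show "m * u^3 \<le> 7" using ab by linarith
  have "u * m \<le> u * b" using m ab by (intro mult_left_mono) auto
  then show "u * m \<le> 26/10" using ab by linarith
  have "8 - D \<le> (u^4 + 4 * u^2 + 8) * exp (-(u^2)/2)"
  proof -
    have "(8 - D) * exp (u^2/2) \<le> (8 - D) * E" using ex by (intro mult_left_mono) auto
    then have "(8 - D) * exp (u^2/2) * exp (-(u^2)/2) \<le> (u^4 + 4 * u^2 + 8) * exp (-(u^2)/2)"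
      using ex by (intro mult_right_mono) auto
    then show ?thesis by (simp add: mult.assoc flip: exp_add)
  qed
  then show "8 - (u^4 + 4 * u^2 + 8) * exp (-(u^2)/2) \<le> D" by simp
  show "0 < p" by fact
  have "u * a \<le> u * m" using m ab by (intro mult_left_mono) auto
  then show "p * (26/10) \<le> u * m" using p by linarith
  show "(\<integral>s. indicator {p..1} s * tail_integrand (338/100 / m^2) s \<partial>lborel) / m \<le> tail_sum a b ns"
    by (rule tail_sum_bound[OF ab(1) m nodes])
  have "main_poly D m \<le> c - tail_sum a b ns" by (rule main_poly_convex[OF m]) (use c in auto)
  then show "main_poly D m + tail_sum a b ns \<le> c" by simp
qed

end

text \<open>With b = 1/5 every piece passes the monotonicity test, even the last one (0.04 <= 6.76 *
  0.81 * 0.0094). The factor 1/a therefore never occurs, and \<open>tail_sum_bound\<close> can be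
  applied with a = m, so that one numerical sum serves all m down to 0.\<close>

lemma high_tail_small:
  assumes m: "0 < m" "m \<le> 1/5"
  shows "(\<integral>s. indicator {1/2..1} s * tail_integrand (338/100 / m^2) s \<partial>lborel) / m \<le> 12/3125"
proof -
  have n0: "tail_exp (338/100 / (1/5)^2) (1/2) \<le> 1/40000"
    by (rule tail_exp_le_high[of _ "6663/10000" _ "51459/100000" "26481/100000" "561/8000" "6147/1250000"]) (simp_all add: power_divide)
  have n1: "tail_exp (338/100 / (1/5)^2) (3/5) \<le> 1/200000"
    by (rule tail_exp_le_high[of _ "482/625" _ "46447/100000" "10787/50000" "2909/62500" "677/312500"]) (simp_all add: power_divide)
  have n2: "tail_exp (338/100 / (1/5)^2) (7/10) \<le> 1/250000"
    by (rule tail_exp_le_high[of _ "7933/10000" _ "22733/50000" "646/3125" "21367/500000" "9131/5000000"]) (simp_all add: power_divide)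
  have n3: "tail_exp (338/100 / (1/5)^2) (4/5) \<le> 7/500000"
    by (rule tail_exp_le_high[of _ "3507/5000" _ "12429/25000" "24717/100000" "30547/500000" "1493/400000"]) (simp_all add: power_divide)
  have n4: "tail_exp (338/100 / (1/5)^2) (9/10) \<le> 601/1000000"
    by (rule tail_exp_le_high[of _ "4639/10000" _ "629/1000" "7913/20000" "7827/50000" "4901/200000"]) (simp_all add: power_divide)
  have n5: "tail_exp (338/100 / (1/5)^2) (1) \<le> 22613/50000"
    by (rule tail_exp_le_high[of _ "31/625" _ "95161/100000" "90557/100000" "41003/50000" "269/400"]) (simp_all add: power_divide)
  let ?ns = "[(1/2, 1/40000), (3/5, 1/200000), (7/10, 1/250000), (4/5, 7/500000), (9/10, 601/1000000), (1, 22613/50000)]"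
  have hs: "\<forall>(s, e)\<in>set ?ns. tail_exp (338/100 / (1/5)^2) s \<le> e"
    using n0 n1 n2 n3 n4 n5 by simp
  have "tail_nodes (1/5) (1/2) ?ns" by (simp add: power2_eq_square)
  from tail_sum_bound[OF m(1) order.refl m(2) this hs]
  have "(\<integral>s. indicator {1/2..1} s * tail_integrand (338/100 / m^2) s \<partial>lborel) / m \<le> tail_sum m (1/5) ?ns" .
  also have "\<dots> \<le> 12/3125" by (simp add: tail_coeff_def cubic_tail_def kern_const_pi_def power2_eq_square)
  finally show ?thesis .
qed

lemma gauss_first_moment_piece:
  fixes A p q :: real
  assumes A: "0 < A" and pq: "p \<le> q"
  shows "integrable lborel (\<lambda>s. indicator {p..q} s * (s * exp (- (A * s^2))))"
    and "(\<integral>s. indicator {p..q} s * (s * exp (- (A * s^2))) \<partial>lborel) \<le> exp (- (A * p^2)) / (2 * A)"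
proof -
  define G where "G s = - (exp (- (A * s^2)) / (2 * A))" for s
  have "has_bochner_integral lborel (\<lambda>s. (s * exp (- (A * s^2))) * indicator {p..q} s) (G q - G p)"
  proof (rule has_bochner_integral_FTC_Icc_real[OF pq])
    show "(G has_real_derivative s * exp (- (A * s^2))) (at s)" for s
      unfolding G_def using A by (auto intro!: derivative_eq_intros simp: field_simps)
  qed auto
  then have *: "has_bochner_integral lborel (\<lambda>s. indicator {p..q} s * (s * exp (- (A * s^2)))) (G q - G p)"
    by (simp add: mult.commute)
  then show "integrable lborel (\<lambda>s. indicator {p..q} s * (s * exp (- (A * s^2))))" by (simp add: has_bochner_integral_iff)
  show "(\<integral>s. indicator {p..q} s * (s * exp (- (A * s^2))) \<partial>lborel) \<le> exp (- (A * p^2)) / (2 * A)"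
    using * A by (simp add: has_bochner_integral_iff G_def)
qed

text \<open>For s <= 1/2 the factor 1 - 0.9906 s is at least 0.5047, and 1/s <= s/p^2 supplies the
  factor s that makes the Gaussian integrals elementary.\<close>

lemma low_tail_bound:
  fixes X p :: real
  assumes X: "0 < X" and p: "0 < p" "p \<le> 1/2"
  shows "(\<integral>s. indicator {p..1/2} s * tail_integrand X s \<partial>lborel) \<le>
    kern_const_pi / p^2 * (exp (- (5047/10000 * X * p^2)) / (2 * (5047/10000 * X)) + exp (- (X * p^2)) / (2 * X))"
proof -
  let ?c = "5047/10000 * X"
  let ?g = "\<lambda>A s. indicator {p..1/2} s * (s * exp (- (A * s^2))) :: real"
  have c: "0 < ?c" using X by simp
  have "(\<integral>s. indicator {p..1/2} s * tail_integrand X s \<partial>lborel) \<le> (\<integral>s. kern_const_pi / p^2 * (?g ?c s + ?g X s) \<partial>lborel)"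
  proof (rule integral_mono)
    show "integrable lborel (\<lambda>s. indicator {p..1/2} s * tail_integrand X s)" using X p by (intro tail_integrand_integrable) auto
    show "integrable lborel (\<lambda>s. kern_const_pi / p^2 * (?g ?c s + ?g X s))"
      by (intro integrable_mult_right Bochner_Integration.integrable_add gauss_first_moment_piece(1) c X p)
    fix s :: real
    show "indicator {p..1/2} s * tail_integrand X s \<le> kern_const_pi / p^2 * (?g ?c s + ?g X s)"
    proof (cases "p \<le> s \<and> s \<le> 1/2")
      case True
      then have s: "0 < s" "p \<le> s" "s \<le> 1/2" using p by auto
      have "5047/10000 * s^2 \<le> damped_square s" unfolding damped_square_def using s by (simp add: mult.commute)
      then have "?c * s^2 \<le> X * damped_square s" using X by (simp add: mult.assoc mult.left_commute)
      then have h1: "exp (- (X * damped_square s)) \<le> exp (- (?c * s^2))" by simp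
      have "max 0 (1 - 2 * s) * exp (- (X * s^2)) \<le> 1 * exp (- (X * s^2))" using s by (intro mult_right_mono) auto
      then have h: "tail_exp X s \<le> exp (- (?c * s^2)) + exp (- (X * s^2))" using h1 unfolding tail_exp_def by linarith
      have "p^2 \<le> s^2" using s p by (intro power_mono) auto
      then have "1 / s \<le> s / p^2" using s p by (simp add: field_simps power2_eq_square)
      then have k: "tail_coeff True s \<le> kern_const_pi / p^2 * s" unfolding tail_coeff_def using mult_left_mono[of "1 / s" "s / p^2" kern_const_pi] by (simp add: kern_const_pi_def)
      have "tail_integrand X s \<le> tail_coeff True s * tail_exp X s" using s by (intro tail_integrand_le) auto
      also have "\<dots> \<le> (kern_const_pi / p^2 * s) * (exp (- (?c * s^2)) + exp (- (X * s^2)))"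
        using k h s by (intro mult_mono) (auto simp: tail_exp_def kern_const_pi_def)
      finally show ?thesis using True by (simp add: algebra_simps)
    qed (auto simp: indicator_def)
  qed
  also have "\<dots> = kern_const_pi / p^2 * ((\<integral>s. ?g ?c s \<partial>lborel) + (\<integral>s. ?g X s \<partial>lborel))"
    using gauss_first_moment_piece(1)[OF c p(2)] gauss_first_moment_piece(1)[OF X p(2)] by simp
  also have "\<dots> \<le> kern_const_pi / p^2 * (exp (- (?c * p^2)) / (2 * ?c) + exp (- (X * p^2)) / (2 * X))"
    by (intro mult_left_mono add_mono gauss_first_moment_piece(2) c X p) (simp add: kern_const_pi_def)
  finally show ?thesis .
qed

text \<open>The derivative of u exp (-c u^2/2) has the sign of 1 - c u^2; the proof needs only 1 + d
  <= exp d.\<close>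

lemma gauss_linear_decreasing:
  fixes c u v :: real
  assumes "0 < v" "v \<le> u" "1 \<le> c * v^2"
  shows "u * exp (- (c * u^2 / 2)) \<le> v * exp (- (c * v^2 / 2))"
proof -
  define d where "d = c * (u^2 - v^2) / 2"
  have "1 * (u - v) \<le> c * v^2 * (u - v)" using assms by (intro mult_right_mono) auto
  also have "\<dots> = c * v * (u - v) * v" by (simp add: power2_eq_square)
  also have "\<dots> \<le> v * d"
  proof -
    have c: "0 < c" using assms by (metis mult_le_0_iff not_less order_trans zero_le_power2 zero_less_one less_le_trans mult_nonpos_nonneg)
    have "c * v * (u - v) * (2 * v) \<le> c * v * (u - v) * (u + v)" using assms c by (intro mult_left_mono) auto
    then show ?thesis by (simp add: d_def power2_eq_square algebra_simps)
  qed
  finally have "u \<le> v * (1 + d)" by (simp add: algebra_simps)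
  also have "\<dots> \<le> v * exp d" using assms by (intro mult_left_mono) auto
  finally have "u * exp (- (c * u^2 / 2)) \<le> v * exp d * exp (- (c * u^2 / 2))" by (intro mult_right_mono) auto
  also have "\<dots> = v * exp (- (c * v^2 / 2))" by (simp add: d_def diff_divide_distrib right_diff_distrib flip: exp_add mult.assoc)
  finally show ?thesis .
qed

context indep_symmetric3
begin

text \<open>No fixed mesh can start at p, which tends to 0 with m. With m u^3 = 7 exactly, the low
  tail divided by m becomes a combination of u exp (-c u^2/2) for c = 0.5047 and c = 1, both
  decreasing in u, so m = 1/5 is the worst case. The budget is 0.53 + 0.022 + 0.01 < 0.57.\<close>

lemma cell_small:
  assumes m: "0 < m" "m \<le> 1/5"
  shows "\<bar>prob {\<omega> \<in> space M. S \<omega> < x} - Phi x\<bar> \<le> 57/100 * m"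
proof -
  define u where "u = root 3 (7 / m)"
  have u3: "m * u^3 = 7" using m by (simp add: u_def)
  \<comment> \<open>The cube root of 35, which is the value of u at m = 1/5, rounded down.\<close>
  have u: "3271/1000 \<le> u"
  proof -
    have "(3271/1000)^3 \<le> 7 / m" using m by (simp add: field_simps power3_eq_cube)
    then have "root 3 ((3271/1000)^3) \<le> u" unfolding u_def by (intro real_root_le_mono) auto
    then show ?thesis by (simp only: real_root_power_cancel)
  qed
  have u2: "(3271/1000)^2 \<le> u^2" using u by (intro power_mono) auto
  have um: "u * m = 7 / u^2" using u3 u by (simp add: field_simps power2_eq_square power3_eq_cube)
  have um1: "u * m \<le> 1" unfolding um using u u2 by (simp add: power2_eq_square)
  define p where "p = u * m / (26/10)"
  have p: "0 < p" "p \<le> 1/2" using m u um1 by (auto simp: p_def)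
  let ?X = "338/100 / m^2"
  have Xp: "?X * p^2 = u^2/2" using m by (simp add: p_def power_divide power_mult_distrib)
  have X: "0 < ?X" using m by simp
  let ?t = "\<lambda>q r. \<integral>s. indicator {q..r} s * tail_integrand ?X s \<partial>lborel"
  have i: "integrable lborel (\<lambda>s. indicator {q..r} s * tail_integrand ?X s)" if "p \<le> q" "r \<le> 1" for q r
    using that p X by (intro tail_integrand_integrable) auto
  have "?t p 1 \<le> (\<integral>s. indicator {p..1/2} s * tail_integrand ?X s + indicator {1/2..1} s * tail_integrand ?X s \<partial>lborel)"
  proof (rule integral_mono)
    show "indicator {p..1} s * tail_integrand ?X s \<le> indicator {p..1/2} s * tail_integrand ?X s + indicator {1/2..1} s * tail_integrand ?X s" for s
      using tail_integrand_bound(1)[of p s ?X] p X by (auto simp: indicator_def)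
  qed (use i p in auto)
  also have "\<dots> = ?t p (1/2) + ?t (1/2) 1" using i p by simp
  finally have split: "?t p 1 / m \<le> ?t p (1/2) / m + ?t (1/2) 1 / m" using m by (simp add: add_divide_distrib[symmetric] divide_right_mono)
  have e: "u * exp (- (c * u^2 / 2)) \<le> 3271/1000 * exp (- (c * (3271/1000)^2 / 2))" if "1/2 \<le> c" for c :: real
  proof (rule gauss_linear_decreasing)
    have "(1/2) * (3271/1000)^2 \<le> c * (3271/1000)^2" using that by (intro mult_right_mono) auto
    then show "1 \<le> c * (3271/1000)^2" by (simp add: power_divide)
  qed (use u in auto)
  have e1: "exp (- (5047/10000 * (3271/1000)^2 / 2)) \<le> (68/1000::real)"
    by (rule exp_neg_upper_chain[of "16875/100000" _ "84473/100000" "71357/100000" "50919/100000" "25928/100000"]) (simp_all add: power_divide)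
  have e2: "exp (- (1 * (3271/1000)^2 / 2)) \<le> (5/1000::real)"
    by (rule exp_neg_upper_chain[of "3343/10000" _ "7159/10000" "51252/100000" "26268/100000" "6901/100000"]) (simp_all add: power_divide)
  have "?t p (1/2) / m \<le> kern_const_pi / p^2 * (exp (- (5047/10000 * ?X * p^2)) / (2 * (5047/10000 * ?X)) + exp (- (?X * p^2)) / (2 * ?X)) / m"
    using low_tail_bound[OF X p] m by (intro divide_right_mono) auto
  also have "\<dots> = kern_const_pi / (2 * (?X * p^2)) * (exp (- (5047/10000 * (?X * p^2))) / (5047/10000) + exp (- (?X * p^2))) / m"
    using p X by (simp add: field_simps)
  also have "\<dots> = kern_const_pi / (u^2 * m) * (exp (- (5047/10000 * u^2 / 2)) / (5047/10000) + exp (- (1 * u^2 / 2)))"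
    unfolding Xp by simp
  also have "u^2 * m = 7 / u" using u3 u by (simp add: field_simps power2_eq_square power3_eq_cube)
  also have "kern_const_pi / (7 / u) * (exp (- (5047/10000 * u^2 / 2)) / (5047/10000) + exp (- (1 * u^2 / 2)))
    = kern_const_pi / 7 * (u * exp (- (5047/10000 * u^2 / 2)) / (5047/10000) + u * exp (- (1 * u^2 / 2)))" using u by (simp add: field_simps)
  also have "\<dots> \<le> kern_const_pi / 7 * (3271/1000 * (68/1000) / (5047/10000) + 3271/1000 * (5/1000))"
    using e[of "5047/10000"] e[of 1] e1 e2 by (intro mult_left_mono add_mono divide_right_mono) (auto simp: kern_const_pi_def)
  also have "\<dots> \<le> 22/1000" by (simp add: kern_const_pi_def)
  finally have low: "?t p (1/2) / m \<le> 22/1000" .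
  have tail: "?t p 1 / m \<le> 22/1000 + 1/100" using split low high_tail_small[OF m] by linarith
  \<comment> \<open>D = 8 is the untruncated moment, which bounds the truncated one for every
    u.\<close>
  have poly: "main_poly 8 m \<le> 53/100"
    by (rule main_poly_convex[of 0 _ "1/5"]) (use m in \<open>auto simp: main_poly_def kern_const_pi_def power2_eq_square\<close>)
  show ?thesis
  proof (rule master_poly[OF m(1) _ _ _ _ p(1) _ tail])
    show "8 - (u^4 + 4 * u^2 + 8) * exp (- (u^2)/2) \<le> 8" by simp
  qed (use u u3 um1 poly in \<open>auto simp: p_def\<close>)
qed

end

section \<open>The numerical ranges\<close>

context indep_symmetric3
begin

text \<open>In this and the following ranges [a, b], u is the cube root of 7/b rounded down and
  occurs in \<open>E\<close>; the first mesh point is u a / 2.6 rounded down; D is read off from the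
  bound in \<open>E\<close>. The bounds for \<open>tail_sum\<close> and \<open>main_poly\<close> add
  up to exactly 0.57.\<close>

lemma cell1:
  assumes m: "1/5 \<le> m" "m \<le> 6/25"
  shows "\<bar>prob {\<omega> \<in> space M. S \<omega> < x} - Phi x\<bar> \<le> 57/100 * m"
proof -
  \<comment> \<open>Below s = 1/2 the Gaussian summand of \<open>tail_exp\<close> contributes too,
    hence two chains of squarings; from 1/2 on one chain is enough.\<close>
  have n0: "tail_exp (338/100 / (6/25)^2) (59/250) \<le> 101911/1000000"
    by (rule tail_exp_le_low[of _ "313/2000" _ "42757/50000" "73127/100000" "13369/25000" "28597/100000" "81779/1000000" "1021/5000" "81531/100000" "33237/50000" "11047/25000" "9763/50000" "38127/1000000"]) (simp_all add: power_divide)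
  have n1: "tail_exp (338/100 / (6/25)^2) (2/5) \<le> 3479/1000000"
    by (rule tail_exp_le_low[of _ "1771/5000" _ "35089/50000" "197/400" "758/3125" "14709/250000" "34617/10000000" "1467/2500" "3479/6250" "6197/20000" "12001/125000" "5761/625000" "16993/200000000"]) (simp_all add: power_divide)
  have n2: "tail_exp (338/100 / (6/25)^2) (1/2) \<le> 613/1000000"
    by (rule tail_exp_le_high[of _ "4627/10000" _ "2519/4000" "39659/100000" "15729/100000" "24741/1000000"]) (simp_all add: power_divide)
  have n3: "tail_exp (338/100 / (6/25)^2) (3/5) \<le> 3/15625"
    by (rule tail_exp_le_high[of _ "1071/2000" _ "14643/25000" "34307/100000" "1177/10000" "6927/500000"]) (simp_all add: power_divide)
  have n4: "tail_exp (338/100 / (6/25)^2) (7/10) \<le> 151/1000000"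
    by (rule tail_exp_le_high[of _ "5509/10000" _ "28841/50000" "33273/100000" "11071/100000" "12257/1000000"]) (simp_all add: power_divide)
  have n5: "tail_exp (338/100 / (6/25)^2) (4/5) \<le> 13/31250"
    by (rule tail_exp_le_high[of _ "487/1000" _ "15367/25000" "4723/12500" "14277/100000" "637/31250"]) (simp_all add: power_divide)
  have n6: "tail_exp (338/100 / (6/25)^2) (17/20) \<le> 619/500000"
    by (rule tail_exp_le_high[of _ "2093/5000" _ "65807/100000" "21653/50000" "3751/20000" "4397/125000"]) (simp_all add: power_divide)
  have n7: "tail_exp (338/100 / (6/25)^2) (9/10) \<le> 361/62500"
    by (rule tail_exp_le_high[of _ "1611/5000" _ "72459/100000" "6563/12500" "27567/100000" "37997/500000"]) (simp_all add: power_divide)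
  have n8: "tail_exp (338/100 / (6/25)^2) (19/20) \<le> 5521/125000"
    by (rule tail_exp_le_high[of _ "39/200" _ "20571/25000" "67707/100000" "45843/100000" "2627/12500"]) (simp_all add: power_divide)
  have n9: "tail_exp (338/100 / (6/25)^2) (1) \<le> 57681/100000"
    by (rule tail_exp_le_high[of _ "43/1250" _ "96619/100000" "93353/100000" "21787/25000" "18987/25000"]) (simp_all add: power_divide)
  have E: "exp ((1539/500)^2/2) \<le> (11501/100::real)"
    by (rule exp_upper_chain[of "2961/10000" _ "3363/2500" "1131/625" "32747/10000" "2681/250"]) (simp_all add: power_divide)
  let ?ns = "[(59/250, 101911/1000000), (2/5, 3479/1000000), (1/2, 613/1000000), (3/5, 3/15625), (7/10, 151/1000000), (4/5, 13/31250), (17/20, 619/500000), (9/10, 361/62500), (19/20, 5521/125000), (1, 57681/100000)]"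
  have "tail_sum (1/5) (6/25) ?ns \<le> 229/5000"
    by (simp add: tail_coeff_def cubic_tail_def kern_const_pi_def power2_eq_square)
  moreover have nodes: "tail_nodes (6/25) (59/250) ?ns" by (simp add: power2_eq_square)
  moreover have "main_poly (13641/2000) (1/5) \<le> 2621/5000" "main_poly (13641/2000) (6/25) \<le> 2621/5000"
    by (simp_all add: main_poly_def kern_const_pi_def power2_eq_square)
  moreover have hs: "\<forall>(s, e)\<in>set ?ns. tail_exp (338/100 / (6/25)^2) s \<le> e"
    using n0 n1 n2 n3 n4 n5 n6 n7 n8 n9 by simp
  ultimately show ?thesis
    by (intro cell[where D = "13641/2000", OF m _ _ _ _ E _ _ nodes hs]) (simp_all add: power_divide del: tail_sum.simps)
qed

lemma cell2:
  assumes m: "6/25 \<le> m" "m \<le> 29/100"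
  shows "\<bar>prob {\<omega> \<in> space M. S \<omega> < x} - Phi x\<bar> \<le> 57/100 * m"
proof -
  have n0: "tail_exp (338/100 / (29/100)^2) (133/500) \<le> 37661/250000"
    by (rule tail_exp_le_low[of _ "327/2500" _ "4387/5000" "9623/12500" "29633/50000" "281/800" "6169/50000" "1777/10000" "2093/2500" "70091/100000" "6141/12500" "3017/12500" "11651/200000"]) (simp_all add: power_divide)
  have n1: "tail_exp (338/100 / (29/100)^2) (2/5) \<le> 20951/1000000"
    by (rule tail_exp_le_low[of _ "1213/5000" _ "3923/5000" "1539/2500" "37897/100000" "7181/50000" "20627/1000000" "4019/10000" "66913/100000" "22387/50000" "1253/6250" "40193/1000000" "3231/2000000"]) (simp_all add: power_divide)
  have n2: "tail_exp (338/100 / (29/100)^2) (1/2) \<le> 1257/200000"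
    by (rule tail_exp_le_high[of _ "3169/10000" _ "72843/100000" "26531/50000" "7039/25000" "79277/1000000"]) (simp_all add: power_divide)
  have n3: "tail_exp (338/100 / (29/100)^2) (3/5) \<le> 2831/1000000"
    by (rule tail_exp_le_high[of _ "917/2500" _ "69301/100000" "48027/100000" "11533/50000" "10641/200000"]) (simp_all add: power_divide)
  have n4: "tail_exp (338/100 / (29/100)^2) (7/10) \<le> 1197/500000"
    by (rule tail_exp_le_high[of _ "3773/10000" _ "34289/50000" "4703/10000" "22119/100000" "24463/500000"]) (simp_all add: power_divide)
  have n5: "tail_exp (338/100 / (29/100)^2) (4/5) \<le> 4813/1000000"
    by (rule tail_exp_le_high[of _ "417/1250" _ "35819/50000" "51321/100000" "26339/100000" "111/1600"]) (simp_all add: power_divide)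
  have n6: "tail_exp (338/100 / (29/100)^2) (17/20) \<le> 10189/1000000"
    by (rule tail_exp_le_high[of _ "2867/10000" _ "18769/25000" "11273/20000" "31771/100000" "5047/50000"]) (simp_all add: power_divide)
  have n7: "tail_exp (338/100 / (29/100)^2) (9/10) \<le> 2933/100000"
    by (rule tail_exp_le_high[of _ "1103/5000" _ "16041/20000" "64329/100000" "41383/100000" "8563/50000"]) (simp_all add: power_divide)
  have n8: "tail_exp (338/100 / (29/100)^2) (19/20) \<le> 2363/20000"
    by (rule tail_exp_le_high[of _ "267/2000" _ "87503/100000" "9571/12500" "58627/100000" "8593/25000"]) (simp_all add: power_divide)
  have n9: "tail_exp (338/100 / (29/100)^2) (1) \<le> 68561/100000"
    by (rule tail_exp_le_high[of _ "59/2500" _ "24417/25000" "95391/100000" "18199/20000" "82801/100000"]) (simp_all add: power_divide)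
  have E: "exp ((289/100)^2/2) \<le> (13103/200::real)"
    by (rule exp_upper_chain[of "2611/10000" _ "12987/10000" "16867/10000" "569/200" "80941/10000"]) (simp_all add: power_divide)
  let ?ns = "[(133/500, 37661/250000), (2/5, 20951/1000000), (1/2, 1257/200000), (3/5, 2831/1000000), (7/10, 1197/500000), (4/5, 4813/1000000), (17/20, 10189/1000000), (9/10, 2933/100000), (19/20, 2363/20000), (1, 68561/100000)]"
  have "tail_sum (6/25) (29/100) ?ns \<le> 639/12500"
    by (simp add: tail_coeff_def cubic_tail_def kern_const_pi_def power2_eq_square)
  moreover have nodes: "tail_nodes (29/100) (133/500) ?ns" by (simp add: power2_eq_square)
  moreover have "main_poly (7879/1250) (6/25) \<le> 3243/6250" "main_poly (7879/1250) (29/100) \<le> 3243/6250"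
    by (simp_all add: main_poly_def kern_const_pi_def power2_eq_square)
  moreover have hs: "\<forall>(s, e)\<in>set ?ns. tail_exp (338/100 / (29/100)^2) s \<le> e"
    using n0 n1 n2 n3 n4 n5 n6 n7 n8 n9 by simp
  ultimately show ?thesis
    by (intro cell[where D = "7879/1250", OF m _ _ _ _ E _ _ nodes hs]) (simp_all add: power_divide del: tail_sum.simps)
qed

text \<open>The last range whose mesh starts below 0.34, which b = 0.34 <= 0.36 permits; in later
  ranges \<open>convex_cubic_exp\<close> applies for every X >= 0.\<close>

lemma cell3:
  assumes m: "29/100 \<le> m" "m \<le> 17/50"
  shows "\<bar>prob {\<omega> \<in> space M. S \<omega> < x} - Phi x\<bar> \<le> 57/100 * m"
proof -
  have n0: "tail_exp (338/100 / (17/50)^2) (61/200) \<le> 5491/31250"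
    by (rule tail_exp_le_low[of _ "593/5000" _ "88817/100000" "15777/20000" "62229/100000" "1549/4000" "14997/100000" "1699/10000" "10547/12500" "35597/50000" "25343/50000" "25691/100000" "66003/1000000"]) (simp_all add: power_divide)
  have n1: "tail_exp (338/100 / (17/50)^2) (2/5) \<le> 30627/500000"
    by (rule tail_exp_le_low[of _ "353/2000" _ "83821/100000" "3513/5000" "9873/20000" "2437/10000" "5939/100000" "2923/10000" "74657/100000" "55737/100000" "31067/100000" "24129/250000" "46577/5000000"]) (simp_all add: power_divide)
  have n2: "tail_exp (338/100 / (17/50)^2) (1/2) \<le> 12517/500000"
    by (rule tail_exp_le_high[of _ "461/2000" _ "15883/20000" "15767/25000" "1243/3125" "7911/50000"]) (simp_all add: power_divide)
  have n3: "tail_exp (338/100 / (17/50)^2) (3/5) \<le> 14007/1000000"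
    by (rule tail_exp_le_high[of _ "667/2500" _ "9573/12500" "14663/25000" "34401/100000" "2367/20000"]) (simp_all add: power_divide)
  have n4: "tail_exp (338/100 / (17/50)^2) (7/10) \<le> 387/31250"
    by (rule tail_exp_le_high[of _ "549/2000" _ "75997/100000" "14439/25000" "16679/50000" "1391/12500"]) (simp_all add: power_divide)
  have n5: "tail_exp (338/100 / (17/50)^2) (4/5) \<le> 5149/250000"
    by (rule tail_exp_le_high[of _ "2427/10000" _ "19613/25000" "15387/25000" "18941/50000" "14351/100000"]) (simp_all add: power_divide)
  have n6: "tail_exp (338/100 / (17/50)^2) (17/20) \<le> 35593/1000000"
    by (rule tail_exp_le_high[of _ "417/2000" _ "81181/100000" "4119/6250" "21717/50000" "9433/50000"]) (simp_all add: power_divide)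
  have n7: "tail_exp (338/100 / (17/50)^2) (9/10) \<le> 9587/125000"
    by (rule tail_exp_le_high[of _ "321/2000" _ "21293/25000" "72543/100000" "421/800" "13847/50000"]) (simp_all add: power_divide)
  have n8: "tail_exp (338/100 / (17/50)^2) (19/20) \<le> 21153/100000"
    by (rule tail_exp_le_high[of _ "971/10000" _ "90747/100000" "82351/100000" "67817/100000" "5749/12500"]) (simp_all add: power_divide)
  have n9: "tail_exp (338/100 / (17/50)^2) (1) \<le> 9509/12500"
    by (rule tail_exp_le_high[of _ "171/10000" _ "19661/20000" "96639/100000" "93391/100000" "87219/100000"]) (simp_all add: power_divide)
  have E: "exp ((137/50)^2/2) \<le> (42911/1000::real)"
    by (rule exp_upper_chain[of "2347/10000" _ "1581/1250" "7999/5000" "12797/5000" "32753/5000"]) (simp_all add: power_divide)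
  let ?ns = "[(61/200, 5491/31250), (2/5, 30627/500000), (1/2, 12517/500000), (3/5, 14007/1000000), (7/10, 387/31250), (4/5, 5149/250000), (17/20, 35593/1000000), (9/10, 9587/125000), (19/20, 21153/100000), (1, 9509/12500)]"
  have "tail_sum (29/100) (17/50) ?ns \<le> 5253/100000"
    by (simp add: tail_coeff_def cubic_tail_def kern_const_pi_def power2_eq_square)
  moreover have nodes: "tail_nodes (17/50) (61/200) ?ns" by (simp add: power2_eq_square)
  moreover have "main_poly (58003/10000) (29/100) \<le> 51747/100000" "main_poly (58003/10000) (17/50) \<le> 51747/100000"
    by (simp_all add: main_poly_def kern_const_pi_def power2_eq_square)
  moreover have hs: "\<forall>(s, e)\<in>set ?ns. tail_exp (338/100 / (17/50)^2) s \<le> e"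
    using n0 n1 n2 n3 n4 n5 n6 n7 n8 n9 by simp
  ultimately show ?thesis
    by (intro cell[where D = "58003/10000", OF m _ _ _ _ E _ _ nodes hs]) (simp_all add: power_divide del: tail_sum.simps)
qed

lemma cell4:
  assumes m: "17/50 \<le> m" "m \<le> 77/200"
  shows "\<bar>prob {\<omega> \<in> space M. S \<omega> < x} - Phi x\<bar> \<le> 57/100 * m"
proof -
  have n0: "tail_exp (338/100 / (77/200)^2) (343/1000) \<le> 191661/1000000"
    by (rule tail_exp_le_low[of _ "1107/10000" _ "89521/100000" "80141/100000" "32113/50000" "33/80" "2127/12500" "419/2500" "8457/10000" "71521/100000" "51153/100000" "26167/100000" "8559/125000"]) (simp_all add: power_divide)
  have n1: "tail_exp (338/100 / (77/200)^2) (2/5) \<le> 115861/1000000"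
    by (rule tail_exp_le_low[of _ "86/625" _ "17429/20000" "75943/100000" "28837/50000" "33263/100000" "2213/20000" "57/250" "79613/100000" "63383/100000" "1607/4000" "16141/100000" "13027/500000"]) (simp_all add: power_divide)
  have n2: "tail_exp (338/100 / (77/200)^2) (1/2) \<le> 56321/1000000"
    by (rule tail_exp_le_high[of _ "899/5000" _ "10443/12500" "17449/25000" "9743/20000" "5933/25000"]) (simp_all add: power_divide)
  have n3: "tail_exp (338/100 / (77/200)^2) (3/5) \<le> 4477/125000"
    by (rule tail_exp_le_high[of _ "2081/10000" _ "81213/100000" "16489/25000" "21751/50000" "757/4000"]) (simp_all add: power_divide)
  have n4: "tail_exp (338/100 / (77/200)^2) (7/10) \<le> 32599/1000000"
    by (rule tail_exp_le_high[of _ "107/500" _ "2523/3125" "2037/3125" "4249/10000" "3611/20000"]) (simp_all add: power_divide)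
  have n5: "tail_exp (338/100 / (77/200)^2) (4/5) \<le> 48467/1000000"
    by (rule tail_exp_le_high[of _ "473/2500" _ "82763/100000" "34249/50000" "1173/2500" "4403/20000"]) (simp_all add: power_divide)
  have n6: "tail_exp (338/100 / (77/200)^2) (17/20) \<le> 2967/40000"
    by (rule tail_exp_le_high[of _ "813/5000" _ "42497/50000" "903/1250" "52187/100000" "5447/20000"]) (simp_all add: power_divide)
  have n7: "tail_exp (338/100 / (77/200)^2) (9/10) \<le> 6747/50000"
    by (rule tail_exp_le_high[of _ "313/2500" _ "88233/100000" "77851/100000" "1894/3125" "18367/50000"]) (simp_all add: power_divide)
  have n8: "tail_exp (338/100 / (77/200)^2) (19/20) \<le> 2979/10000"
    by (rule tail_exp_le_high[of _ "757/10000" _ "9271/10000" "2686/3125" "36939/50000" "2729/5000"]) (simp_all add: power_divide)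
  have n9: "tail_exp (338/100 / (77/200)^2) (1) \<le> 2021/2500"
    by (rule tail_exp_le_high[of _ "133/10000" _ "98679/100000" "3043/3125" "94821/100000" "89911/100000"]) (simp_all add: power_divide)
  have E: "exp ((2629/1000)^2/2) \<le> (6357/200::real)"
    by (rule exp_upper_chain[of "27/125" _ "12413/10000" "15409/10000" "1484/625" "28189/5000"]) (simp_all add: power_divide)
  let ?ns = "[(343/1000, 191661/1000000), (2/5, 115861/1000000), (1/2, 56321/1000000), (3/5, 4477/125000), (7/10, 32599/1000000), (4/5, 48467/1000000), (17/20, 2967/40000), (9/10, 6747/50000), (19/20, 2979/10000), (1, 2021/2500)]"
  have "tail_sum (17/50) (77/200) ?ns \<le> 177/3125"
    by (simp add: tail_coeff_def cubic_tail_def kern_const_pi_def power2_eq_square)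
  moreover have nodes: "tail_nodes (77/200) (343/1000) ?ns" by (simp add: power2_eq_square)
  moreover have "main_poly (13439/2500) (17/50) \<le> 6417/12500" "main_poly (13439/2500) (77/200) \<le> 6417/12500"
    by (simp_all add: main_poly_def kern_const_pi_def power2_eq_square)
  moreover have hs: "\<forall>(s, e)\<in>set ?ns. tail_exp (338/100 / (77/200)^2) s \<le> e"
    using n0 n1 n2 n3 n4 n5 n6 n7 n8 n9 by simp
  ultimately show ?thesis
    by (intro cell[where D = "13439/2500", OF m _ _ _ _ E _ _ nodes hs]) (simp_all add: power_divide del: tail_sum.simps)
qed

lemma cell5:
  assumes m: "77/200 \<le> m" "m \<le> 21/50"
  shows "\<bar>prob {\<omega> \<in> space M. S \<omega> < x} - Phi x\<bar> \<le> 57/100 * m"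
proof -
  have n0: "tail_exp (338/100 / (21/50)^2) (189/500) \<le> 196347/1000000"
    by (rule tail_exp_le_low[of _ "107/1000" _ "89853/100000" "2523/3125" "2037/3125" "4249/10000" "3611/20000" "1711/10000" "42137/50000" "35511/50000" "25221/50000" "6361/25000" "3237/50000"]) (simp_all add: power_divide)
  have n1: "tail_exp (338/100 / (21/50)^2) (2/5) \<le> 83339/500000"
    by (rule tail_exp_le_low[of _ "289/2500" _ "22271/25000" "496/625" "62981/100000" "39667/100000" "3147/20000" "479/2500" "20641/25000" "68169/100000" "46471/100000" "5399/25000" "46639/1000000"]) (simp_all add: power_divide)
  have n2: "tail_exp (338/100 / (21/50)^2) (1/2) \<le> 44581/500000"
    by (rule tail_exp_le_high[of _ "1511/10000" _ "85977/100000" "73921/100000" "13661/25000" "1493/5000"]) (simp_all add: power_divide)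
  have n3: "tail_exp (338/100 / (21/50)^2) (3/5) \<le> 30507/500000"
    by (rule tail_exp_le_high[of _ "437/2500" _ "83963/100000" "35249/50000" "497/1000" "24701/100000"]) (simp_all add: power_divide)
  have n4: "tail_exp (338/100 / (21/50)^2) (7/10) \<le> 14059/250000"
    by (rule tail_exp_le_high[of _ "1799/10000" _ "5221/6250" "69783/100000" "48697/100000" "11857/50000"]) (simp_all add: power_divide)
  have n5: "tail_exp (338/100 / (21/50)^2) (4/5) \<le> 78563/1000000"
    by (rule tail_exp_le_high[of _ "159/1000" _ "853/1000" "72761/100000" "26471/50000" "28029/100000"]) (simp_all add: power_divide)
  have n6: "tail_exp (338/100 / (21/50)^2) (17/20) \<le> 11243/100000"
    by (rule tail_exp_le_high[of _ "683/5000" _ "2726/3125" "15219/20000" "11581/20000" "3353/10000"]) (simp_all add: power_divide)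
  have n7: "tail_exp (338/100 / (21/50)^2) (9/10) \<le> 18583/100000"
    by (rule tail_exp_le_high[of _ "263/2500" _ "18003/20000" "20257/25000" "8207/12500" "10777/25000"]) (simp_all add: power_divide)
  have n8: "tail_exp (338/100 / (21/50)^2) (19/20) \<le> 36157/100000"
    by (rule tail_exp_le_high[of _ "159/2500" _ "93839/100000" "44029/50000" "77543/100000" "6013/10000"]) (simp_all add: power_divide)
  have n9: "tail_exp (338/100 / (21/50)^2) (1) \<le> 8361/10000"
    by (rule tail_exp_le_high[of _ "7/625" _ "98887/100000" "97787/100000" "95623/100000" "45719/50000"]) (simp_all add: power_divide)
  have E: "exp ((1277/500)^2/2) \<le> (6543/250::real)"
    by (rule exp_upper_chain[of "2039/10000" _ "12263/10000" "15039/10000" "11309/5000" "25579/5000"]) (simp_all add: power_divide)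
  let ?ns = "[(189/500, 196347/1000000), (2/5, 83339/500000), (1/2, 44581/500000), (3/5, 30507/500000), (7/10, 14059/250000), (4/5, 78563/1000000), (17/20, 11243/100000), (9/10, 18583/100000), (19/20, 36157/100000), (1, 8361/10000)]"
  have "tail_sum (77/200) (21/50) ?ns \<le> 729/12500"
    by (simp add: tail_coeff_def cubic_tail_def kern_const_pi_def power2_eq_square)
  moreover have nodes: "tail_nodes (21/50) (189/500) ?ns" by (simp add: power2_eq_square)
  moreover have "main_poly (50717/10000) (77/200) \<le> 1599/3125" "main_poly (50717/10000) (21/50) \<le> 1599/3125"
    by (simp_all add: main_poly_def kern_const_pi_def power2_eq_square)
  moreover have hs: "\<forall>(s, e)\<in>set ?ns. tail_exp (338/100 / (21/50)^2) s \<le> e"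
    using n0 n1 n2 n3 n4 n5 n6 n7 n8 n9 by simp
  ultimately show ?thesis
    by (intro cell[where D = "50717/10000", OF m _ _ _ _ E _ _ nodes hs]) (simp_all add: power_divide del: tail_sum.simps)
qed

lemma cell6:
  assumes m: "21/50 \<le> m" "m \<le> 9/20"
  shows "\<bar>prob {\<omega> \<in> space M. S \<omega> < x} - Phi x\<bar> \<le> 57/100 * m"
proof -
  have n0: "tail_exp (338/100 / (9/20)^2) (403/1000) \<le> 209437/1000000"
    by (rule tail_exp_le_low[of _ "1017/10000" _ "90331/100000" "81597/100000" "66581/100000" "44331/100000" "19653/100000" "847/5000" "42209/50000" "2227/3125" "25393/50000" "25793/100000" "2079/31250"]) (simp_all add: power_divide)
  have n1: "tail_exp (338/100 / (9/20)^2) (1/2) \<le> 12181/100000"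
    by (rule tail_exp_le_high[of _ "329/2500" _ "8767/10000" "76861/100000" "59077/100000" "34901/100000"]) (simp_all add: power_divide)
  have n2: "tail_exp (338/100 / (9/20)^2) (3/5) \<le> 87469/1000000"
    by (rule tail_exp_le_high[of _ "1523/10000" _ "42937/50000" "4609/6250" "27191/50000" "1183/4000"]) (simp_all add: power_divide)
  have n3: "tail_exp (338/100 / (9/20)^2) (7/10) \<le> 40761/500000"
    by (rule tail_exp_le_high[of _ "1567/10000" _ "85497/100000" "36549/50000" "26717/50000" "3569/12500"]) (simp_all add: power_divide)
  have n4: "tail_exp (338/100 / (9/20)^2) (4/5) \<le> 2727/25000"
    by (rule tail_exp_le_high[of _ "277/2000" _ "87067/100000" "75807/100000" "14367/25000" "16513/50000"]) (simp_all add: power_divide)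
  have n5: "tail_exp (338/100 / (9/20)^2) (17/20) \<le> 14899/100000"
    by (rule tail_exp_le_high[of _ "119/1000" _ "88781/100000" "78821/100000" "3883/6250" "38599/100000"]) (simp_all add: power_divide)
  have n6: "tail_exp (338/100 / (9/20)^2) (9/10) \<le> 23099/100000"
    by (rule tail_exp_le_high[of _ "229/2500" _ "5703/6250" "41631/50000" "34663/50000" "48061/100000"]) (simp_all add: power_divide)
  have n7: "tail_exp (338/100 / (9/20)^2) (19/20) \<le> 41219/100000"
    by (rule tail_exp_le_high[of _ "277/5000" _ "94611/100000" "89513/100000" "40063/50000" "32101/50000"]) (simp_all add: power_divide)
  have n8: "tail_exp (338/100 / (9/20)^2) (1) \<le> 10687/12500"
    by (rule tail_exp_le_high[of _ "49/5000" _ "3961/4000" "4903/5000" "48079/50000" "5779/6250"]) (simp_all add: power_divide)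
  have E: "exp ((312/125)^2/2) \<le> (22591/1000::real)"
    by (rule exp_upper_chain[of "1947/10000" _ "12151/10000" "2953/2000" "21801/10000" "47529/10000"]) (simp_all add: power_divide)
  let ?ns = "[(403/1000, 209437/1000000), (1/2, 12181/100000), (3/5, 87469/1000000), (7/10, 40761/500000), (4/5, 2727/25000), (17/20, 14899/100000), (9/10, 23099/100000), (19/20, 41219/100000), (1, 10687/12500)]"
  have "tail_sum (21/50) (9/20) ?ns \<le> 383/6250"
    by (simp add: tail_coeff_def cubic_tail_def kern_const_pi_def power2_eq_square)
  moreover have nodes: "tail_nodes (9/20) (403/1000) ?ns" by (simp add: power2_eq_square)
  moreover have "main_poly (6031/1250) (21/50) \<le> 6359/12500" "main_poly (6031/1250) (9/20) \<le> 6359/12500"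
    by (simp_all add: main_poly_def kern_const_pi_def power2_eq_square)
  moreover have hs: "\<forall>(s, e)\<in>set ?ns. tail_exp (338/100 / (9/20)^2) s \<le> e"
    using n0 n1 n2 n3 n4 n5 n6 n7 n8 by simp
  ultimately show ?thesis
    by (intro cell[where D = "6031/1250", OF m _ _ _ _ E _ _ nodes hs]) (simp_all add: power_divide del: tail_sum.simps)
qed

lemma cell7:
  assumes m: "9/20 \<le> m" "m \<le> 12/25"
  shows "\<bar>prob {\<omega> \<in> space M. S \<omega> < x} - Phi x\<bar> \<le> 57/100 * m"
proof -
  have n0: "tail_exp (338/100 / (12/25)^2) (211/500) \<le> 28779/125000"
    by (rule tail_exp_le_low[of _ "19/200" _ "45469/50000" "41349/50000" "6839/10000" "11693/25000" "21877/100000" "102/625" "84943/100000" "36077/50000" "26031/50000" "5421/20000" "73469/1000000"]) (simp_all add: power_divide)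
  have n1: "tail_exp (338/100 / (12/25)^2) (1/2) \<le> 3147/20000"
    by (rule tail_exp_le_high[of _ "289/2500" _ "22271/25000" "496/625" "62981/100000" "39667/100000"]) (simp_all add: power_divide)
  have n2: "tail_exp (338/100 / (12/25)^2) (3/5) \<le> 11759/100000"
    by (rule tail_exp_le_high[of _ "669/5000" _ "87477/100000" "76523/100000" "29279/50000" "34291/100000"]) (simp_all add: power_divide)
  have n3: "tail_exp (338/100 / (12/25)^2) (7/10) \<le> 11049/100000"
    by (rule tail_exp_le_high[of _ "1377/10000" _ "87137/100000" "75929/100000" "57653/100000" "33239/100000"]) (simp_all add: power_divide)
  have n4: "tail_exp (338/100 / (12/25)^2) (4/5) \<le> 1427/10000"
    by (rule tail_exp_le_high[of _ "1217/10000" _ "44271/50000" "78397/100000" "61461/100000" "1511/4000"]) (simp_all add: power_divide)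
  have n5: "tail_exp (338/100 / (12/25)^2) (17/20) \<le> 9381/50000"
    by (rule tail_exp_le_high[of _ "523/5000" _ "90069/100000" "649/800" "65813/100000" "21657/50000"]) (simp_all add: power_divide)
  have n6: "tail_exp (338/100 / (12/25)^2) (9/10) \<le> 6897/25000"
    by (rule tail_exp_le_high[of _ "161/2000" _ "46133/50000" "85131/100000" "72473/100000" "13131/25000"]) (simp_all add: power_divide)
  have n7: "tail_exp (338/100 / (12/25)^2) (19/20) \<le> 11471/25000"
    by (rule tail_exp_le_high[of _ "487/10000" _ "95247/100000" "567/625" "41151/50000" "67737/100000"]) (simp_all add: power_divide)
  have n8: "tail_exp (338/100 / (12/25)^2) (1) \<le> 2179/2500"
    by (rule tail_exp_le_high[of _ "43/5000" _ "12393/12500" "12287/12500" "48311/50000" "93359/100000"]) (simp_all add: power_divide)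
  have E: "exp ((2443/1000)^2/2) \<le> (2481/125::real)"
    by (rule exp_upper_chain[of "933/5000" _ "12053/10000" "908/625" "21107/10000" "44551/10000"]) (simp_all add: power_divide)
  let ?ns = "[(211/500, 28779/125000), (1/2, 3147/20000), (3/5, 11759/100000), (7/10, 11049/100000), (4/5, 1427/10000), (17/20, 9381/50000), (9/10, 6897/25000), (19/20, 11471/25000), (1, 2179/2500)]"
  have "tail_sum (9/20) (12/25) ?ns \<le> 6471/100000"
    by (simp add: tail_coeff_def cubic_tail_def kern_const_pi_def power2_eq_square)
  moreover have nodes: "tail_nodes (12/25) (211/500) ?ns" by (simp add: power2_eq_square)
  moreover have "main_poly (11499/2500) (9/20) \<le> 50529/100000" "main_poly (11499/2500) (12/25) \<le> 50529/100000"
    by (simp_all add: main_poly_def kern_const_pi_def power2_eq_square)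
  moreover have hs: "\<forall>(s, e)\<in>set ?ns. tail_exp (338/100 / (12/25)^2) s \<le> e"
    using n0 n1 n2 n3 n4 n5 n6 n7 n8 by simp
  ultimately show ?thesis
    by (intro cell[where D = "11499/2500", OF m _ _ _ _ E _ _ nodes hs]) (simp_all add: power_divide del: tail_sum.simps)
qed

lemma cell8:
  assumes m: "12/25 \<le> m" "m \<le> 103/200"
  shows "\<bar>prob {\<omega> \<in> space M. S \<omega> < x} - Phi x\<bar> \<le> 57/100 * m"
proof -
  have n0: "tail_exp (338/100 / (103/200)^2) (11/25) \<le> 129591/500000"
    by (rule tail_exp_le_low[of _ "869/10000" _ "91677/100000" "84047/100000" "70639/100000" "49899/100000" "249/1000" "771/5000" "85711/100000" "9183/12500" "5397/10000" "3641/12500" "16969/200000"]) (simp_all add: power_divide)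
  have n1: "tail_exp (338/100 / (103/200)^2) (1/2) \<le> 10033/50000"
    by (rule tail_exp_le_high[of _ "251/2500" _ "5653/6250" "81809/100000" "4183/6250" "22397/50000"]) (simp_all add: power_divide)
  have n2: "tail_exp (338/100 / (103/200)^2) (3/5) \<le> 7779/50000"
    by (rule tail_exp_le_high[of _ "1163/10000" _ "89021/100000" "4953/6250" "62803/100000" "39443/100000"]) (simp_all add: power_divide)
  have n3: "tail_exp (338/100 / (103/200)^2) (7/10) \<le> 7379/50000"
    by (rule tail_exp_le_high[of _ "299/2500" _ "11091/12500" "78727/100000" "3099/5000" "2401/6250"]) (simp_all add: power_divide)
  have n4: "tail_exp (338/100 / (103/200)^2) (4/5) \<le> 4609/25000"
    by (rule tail_exp_le_high[of _ "1057/10000" _ "8997/10000" "80947/100000" "2621/4000" "5367/12500"]) (simp_all add: power_divide)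
  have n5: "tail_exp (338/100 / (103/200)^2) (17/20) \<le> 5839/25000"
    by (rule tail_exp_le_high[of _ "909/10000" _ "91311/100000" "83377/100000" "34759/50000" "6041/12500"]) (simp_all add: power_divide)
  have n6: "tail_exp (338/100 / (103/200)^2) (9/10) \<le> 32683/100000"
    by (rule tail_exp_le_high[of _ "699/10000" _ "93249/100000" "43477/50000" "7561/10000" "57169/100000"]) (simp_all add: power_divide)
  have n7: "tail_exp (338/100 / (103/200)^2) (19/20) \<le> 10167/20000"
    by (rule tail_exp_le_high[of _ "423/10000" _ "95859/100000" "9189/10000" "42219/50000" "35649/50000"]) (simp_all add: power_divide)
  have n8: "tail_exp (338/100 / (103/200)^2) (1) \<le> 22211/25000"
    by (rule tail_exp_le_high[of _ "37/5000" _ "99263/100000" "24633/25000" "48543/50000" "94257/100000"]) (simp_all add: power_divide)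
  have E: "exp ((1193/500)^2/2) \<le> (691/40::real)"
    by (rule exp_upper_chain[of "89/500" _ "11949/10000" "7139/5000" "20387/10000" "41563/10000"]) (simp_all add: power_divide)
  let ?ns = "[(11/25, 129591/500000), (1/2, 10033/50000), (3/5, 7779/50000), (7/10, 7379/50000), (4/5, 4609/25000), (17/20, 5839/25000), (9/10, 32683/100000), (19/20, 10167/20000), (1, 22211/25000)]"
  have "tail_sum (12/25) (103/200) ?ns \<le> 1721/25000"
    by (simp add: tail_coeff_def cubic_tail_def kern_const_pi_def power2_eq_square)
  moreover have nodes: "tail_nodes (103/200) (11/25) ?ns" by (simp add: power2_eq_square)
  moreover have "main_poly (21713/5000) (12/25) \<le> 12529/25000" "main_poly (21713/5000) (103/200) \<le> 12529/25000"
    by (simp_all add: main_poly_def kern_const_pi_def power2_eq_square)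
  moreover have hs: "\<forall>(s, e)\<in>set ?ns. tail_exp (338/100 / (103/200)^2) s \<le> e"
    using n0 n1 n2 n3 n4 n5 n6 n7 n8 by simp
  ultimately show ?thesis
    by (intro cell[where D = "21713/5000", OF m _ _ _ _ E _ _ nodes hs]) (simp_all add: power_divide del: tail_sum.simps)
qed

lemma cell9:
  assumes m: "103/200 \<le> m" "m \<le> 111/200"
  shows "\<bar>prob {\<omega> \<in> space M. S \<omega> < x} - Phi x\<bar> \<le> 57/100 * m"
proof -
  have n0: "tail_exp (338/100 / (111/200)^2) (23/50) \<le> 72723/250000"
    by (rule tail_exp_le_low[of _ "789/10000" _ "46207/50000" "21351/25000" "72939/100000" "53201/100000" "1769/6250" "1451/10000" "43247/50000" "74813/100000" "5597/10000" "31327/100000" "98139/1000000"]) (simp_all add: power_divide)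
  have n1: "tail_exp (338/100 / (111/200)^2) (1/2) \<le> 25063/100000"
    by (rule tail_exp_le_high[of _ "173/2000" _ "45857/50000" "16823/20000" "35377/50000" "25031/50000"]) (simp_all add: power_divide)
  have n2: "tail_exp (338/100 / (111/200)^2) (3/5) \<le> 20161/100000"
    by (rule tail_exp_le_high[of _ "1001/10000" _ "3619/4000" "40929/50000" "2094/3125" "44901/100000"]) (simp_all add: power_divide)
  have n3: "tail_exp (338/100 / (111/200)^2) (7/10) \<le> 9623/50000"
    by (rule tail_exp_le_high[of _ "103/1000" _ "90213/100000" "10173/12500" "33117/50000" "4387/10000"]) (simp_all add: power_divide)
  have n4: "tail_exp (338/100 / (111/200)^2) (4/5) \<le> 583/2500"
    by (rule tail_exp_le_high[of _ "91/1000" _ "45651/50000" "83361/100000" "69491/100000" "4829/10000"]) (simp_all add: power_divide)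
  have n5: "tail_exp (338/100 / (111/200)^2) (17/20) \<le> 1431/5000"
    by (rule tail_exp_le_high[of _ "391/5000" _ "46239/50000" "42761/50000" "73141/100000" "53497/100000"]) (simp_all add: power_divide)
  have n6: "tail_exp (338/100 / (111/200)^2) (9/10) \<le> 19087/50000"
    by (rule tail_exp_le_high[of _ "301/5000" _ "47079/50000" "44329/50000" "78603/100000" "12357/20000"]) (simp_all add: power_divide)
  have n7: "tail_exp (338/100 / (111/200)^2) (19/20) \<le> 6983/12500"
    by (rule tail_exp_le_high[of _ "91/2500" _ "48213/50000" "4649/5000" "86453/100000" "37371/50000"]) (simp_all add: power_divide)
  have n8: "tail_exp (338/100 / (111/200)^2) (1) \<le> 22573/25000"
    by (rule tail_exp_le_high[of _ "4/625" _ "99363/100000" "98731/100000" "97479/100000" "47511/50000"]) (simp_all add: power_divide)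
  have E: "exp ((2327/1000)^2/2) \<le> (15041/1000::real)"
    by (rule exp_upper_chain[of "1693/10000" _ "5923/5000" "14033/10000" "19693/10000" "19391/5000"]) (simp_all add: power_divide)
  let ?ns = "[(23/50, 72723/250000), (1/2, 25063/100000), (3/5, 20161/100000), (7/10, 9623/50000), (4/5, 583/2500), (17/20, 1431/5000), (9/10, 19087/50000), (19/20, 6983/12500), (1, 22573/25000)]"
  have "tail_sum (103/200) (111/200) ?ns \<le> 1433/20000"
    by (simp add: tail_coeff_def cubic_tail_def kern_const_pi_def power2_eq_square)
  moreover have nodes: "tail_nodes (111/200) (23/50) ?ns" by (simp add: power2_eq_square)
  moreover have "main_poly (40787/10000) (103/200) \<le> 9967/20000" "main_poly (40787/10000) (111/200) \<le> 9967/20000"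
    by (simp_all add: main_poly_def kern_const_pi_def power2_eq_square)
  moreover have hs: "\<forall>(s, e)\<in>set ?ns. tail_exp (338/100 / (111/200)^2) s \<le> e"
    using n0 n1 n2 n3 n4 n5 n6 n7 n8 by simp
  ultimately show ?thesis
    by (intro cell[where D = "40787/10000", OF m _ _ _ _ E _ _ nodes hs]) (simp_all add: power_divide del: tail_sum.simps)
qed

lemma cell10:
  assumes m: "111/200 \<le> m" "m \<le> 123/200"
  shows "\<bar>prob {\<omega> \<in> space M. S \<omega> < x} - Phi x\<bar> \<le> 57/100 * m"
proof -
  have n0: "tail_exp (338/100 / (123/200)^2) (12/25) \<le> 172661/500000"
    by (rule tail_exp_le_low[of _ "337/5000" _ "93483/100000" "87391/100000" "19093/25000" "58327/100000" "34021/100000" "643/5000" "87933/100000" "77323/100000" "59789/100000" "8937/25000" "639/5000"]) (simp_all add: power_divide)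
  have n1: "tail_exp (338/100 / (123/200)^2) (1/2) \<le> 32427/100000"
    by (rule tail_exp_le_high[of _ "44/625" _ "93203/100000" "21717/25000" "75461/100000" "3559/6250"]) (simp_all add: power_divide)
  have n2: "tail_exp (338/100 / (123/200)^2) (3/5) \<le> 27151/100000"
    by (rule tail_exp_le_high[of _ "163/2000" _ "46087/50000" "84961/100000" "9023/12500" "26053/50000"]) (simp_all add: power_divide)
  have n3: "tail_exp (338/100 / (123/200)^2) (7/10) \<le> 26127/100000"
    by (rule tail_exp_le_high[of _ "839/10000" _ "91953/100000" "42277/50000" "35747/50000" "25557/50000"]) (simp_all add: power_divide)
  have n4: "tail_exp (338/100 / (123/200)^2) (4/5) \<le> 191/625"
    by (rule tail_exp_le_high[of _ "741/10000" _ "46429/50000" "86227/100000" "74351/100000" "55281/100000"]) (simp_all add: power_divide)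
  have n5: "tail_exp (338/100 / (123/200)^2) (17/20) \<le> 36093/100000"
    by (rule tail_exp_le_high[of _ "637/10000" _ "93829/100000" "88039/100000" "77509/100000" "60077/100000"]) (simp_all add: power_divide)
  have n6: "tail_exp (338/100 / (123/200)^2) (9/10) \<le> 4567/10000"
    by (rule tail_exp_le_high[of _ "49/1000" _ "95219/100000" "90667/100000" "41103/50000" "67579/100000"]) (simp_all add: power_divide)
  have n7: "tail_exp (338/100 / (123/200)^2) (19/20) \<le> 12437/20000"
    by (rule tail_exp_le_high[of _ "297/10000" _ "48537/50000" "47117/50000" "88801/100000" "78857/100000"]) (simp_all add: power_divide)
  have n8: "tail_exp (338/100 / (123/200)^2) (1) \<le> 2876/3125"
    by (rule tail_exp_le_high[of _ "13/2500" _ "49741/50000" "98967/100000" "19589/20000" "95933/100000"]) (simp_all add: power_divide)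
  have E: "exp ((2249/1000)^2/2) \<le> (3143/250::real)"
    by (rule exp_upper_chain[of "1581/10000" _ "5857/5000" "6861/5000" "1883/1000" "35457/10000"]) (simp_all add: power_divide)
  let ?ns = "[(12/25, 172661/500000), (1/2, 32427/100000), (3/5, 27151/100000), (7/10, 26127/100000), (4/5, 191/625), (17/20, 36093/100000), (9/10, 4567/10000), (19/20, 12437/20000), (1, 2876/3125)]"
  have "tail_sum (111/200) (123/200) ?ns \<le> 7623/100000"
    by (simp add: tail_coeff_def cubic_tail_def kern_const_pi_def power2_eq_square)
  moreover have nodes: "tail_nodes (123/200) (12/25) ?ns" by (simp add: power2_eq_square)
  moreover have "main_poly (7439/2000) (111/200) \<le> 49377/100000" "main_poly (7439/2000) (123/200) \<le> 49377/100000"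
    by (simp_all add: main_poly_def kern_const_pi_def power2_eq_square)
  moreover have hs: "\<forall>(s, e)\<in>set ?ns. tail_exp (338/100 / (123/200)^2) s \<le> e"
    using n0 n1 n2 n3 n4 n5 n6 n7 n8 by simp
  ultimately show ?thesis
    by (intro cell[where D = "7439/2000", OF m _ _ _ _ E _ _ nodes hs]) (simp_all add: power_divide del: tail_sum.simps)
qed

lemma cell11:
  assumes m: "123/200 \<le> m" "m \<le> 3/4"
  shows "\<bar>prob {\<omega> \<in> space M. S \<omega> < x} - Phi x\<bar> \<le> 57/100 * m"
proof -
  have n0: "tail_exp (338/100 / (3/4)^2) (497/1000) \<le> 7388/15625"
    by (rule tail_exp_le_low[of _ "47/1000" _ "95409/100000" "91029/100000" "82863/100000" "68663/100000" "47147/100000" "927/10000" "91147/100000" "41539/50000" "3451/5000" "23819/50000" "11347/50000"]) (simp_all add: power_divide)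
  have n1: "tail_exp (338/100 / (3/4)^2) (1/2) \<le> 2933/6250"
    by (rule tail_exp_le_high[of _ "473/10000" _ "95381/100000" "2843/3125" "82767/100000" "8563/12500"]) (simp_all add: power_divide)
  have n2: "tail_exp (338/100 / (3/4)^2) (3/5) \<le> 41621/100000"
    by (rule tail_exp_le_high[of _ "137/2500" _ "23667/25000" "89621/100000" "502/625" "32257/50000"]) (simp_all add: power_divide)
  have n3: "tail_exp (338/100 / (3/4)^2) (7/10) \<le> 4057/10000"
    by (rule tail_exp_le_high[of _ "141/2500" _ "94517/100000" "17867/20000" "2494/3125" "31847/50000"]) (simp_all add: power_divide)
  have n4: "tail_exp (338/100 / (3/4)^2) (4/5) \<le> 11271/25000"
    by (rule tail_exp_le_high[of _ "249/5000" _ "47571/50000" "90521/100000" "81941/100000" "8393/12500"]) (simp_all add: power_divide)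
  have n5: "tail_exp (338/100 / (3/4)^2) (17/20) \<le> 50429/100000"
    by (rule tail_exp_le_high[of _ "107/2500" _ "95811/100000" "45899/50000" "84269/100000" "71013/100000"]) (simp_all add: power_divide)
  have n6: "tail_exp (338/100 / (3/4)^2) (9/10) \<le> 59081/100000"
    by (rule tail_exp_le_high[of _ "329/10000" _ "24191/25000" "93633/100000" "10959/12500" "2402/3125"]) (simp_all add: power_divide)
  have n7: "tail_exp (338/100 / (3/4)^2) (19/20) \<le> 72741/100000"
    by (rule tail_exp_le_high[of _ "199/10000" _ "9803/10000" "96099/100000" "92351/100000" "10661/12500"]) (simp_all add: power_divide)
  have n8: "tail_exp (338/100 / (3/4)^2) (1) \<le> 11821/12500"
    by (rule tail_exp_le_high[of _ "7/2000" _ "99651/100000" "12413/12500" "98613/100000" "48623/50000"]) (simp_all add: power_divide)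
  have E: "exp ((421/200)^2/2) \<le> (91791/10000::real)"
    by (rule exp_upper_chain[of "277/2000" _ "5743/5000" "13193/10000" "8703/5000" "30297/10000"]) (simp_all add: power_divide)
  let ?ns = "[(497/1000, 7388/15625), (1/2, 2933/6250), (3/5, 41621/100000), (7/10, 4057/10000), (4/5, 11271/25000), (17/20, 50429/100000), (9/10, 59081/100000), (19/20, 72741/100000), (1, 11821/12500)]"
  have "tail_sum (123/200) (3/4) ?ns \<le> 8579/100000"
    by (simp add: tail_coeff_def cubic_tail_def kern_const_pi_def power2_eq_square)
  moreover have nodes: "tail_nodes (3/4) (497/1000) ?ns" by (simp add: power2_eq_square)
  moreover have "main_poly (15293/5000) (123/200) \<le> 48421/100000" "main_poly (15293/5000) (3/4) \<le> 48421/100000"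
    by (simp_all add: main_poly_def kern_const_pi_def power2_eq_square)
  moreover have hs: "\<forall>(s, e)\<in>set ?ns. tail_exp (338/100 / (3/4)^2) s \<le> e"
    using n0 n1 n2 n3 n4 n5 n6 n7 n8 by simp
  ultimately show ?thesis
    by (intro cell[where D = "15293/5000", OF m _ _ _ _ E _ _ nodes hs]) (simp_all add: power_divide del: tail_sum.simps)
qed

text \<open>The mesh starts beyond 1/2, so only the upper coefficient occurs. The ranges can stop at
  0.88 because 0.57 * 0.88 > 1/2.\<close>

lemma cell12:
  assumes m: "3/4 \<le> m" "m \<le> 22/25"
  shows "\<bar>prob {\<omega> \<in> space M. S \<omega> < x} - Phi x\<bar> \<le> 57/100 * m"
proof -
  have n0: "tail_exp (338/100 / (22/25)^2) (23/40) \<le> 26881/50000"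
    by (rule tail_exp_le_high[of _ "97/2500" _ "19239/20000" "18507/20000" "21407/25000" "36661/50000"]) (simp_all add: power_divide)
  have n1: "tail_exp (338/100 / (22/25)^2) (3/5) \<le> 52913/100000"
    by (rule tail_exp_le_high[of _ "199/5000" _ "96099/100000" "92351/100000" "10661/12500" "72741/100000"]) (simp_all add: power_divide)
  have n2: "tail_exp (338/100 / (22/25)^2) (7/10) \<le> 51983/100000"
    by (rule tail_exp_le_high[of _ "409/10000" _ "95993/100000" "92147/100000" "84911/100000" "72099/100000"]) (simp_all add: power_divide)
  have n3: "tail_exp (338/100 / (22/25)^2) (4/5) \<le> 28021/50000"
    by (rule tail_exp_le_high[of _ "181/5000" _ "19289/20000" "93017/100000" "43261/50000" "74861/100000"]) (simp_all add: power_divide)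
  have n4: "tail_exp (338/100 / (22/25)^2) (17/20) \<le> 60803/100000"
    by (rule tail_exp_le_high[of _ "311/10000" _ "48469/50000" "9397/10000" "5519/6250" "9747/12500"]) (simp_all add: power_divide)
  have n5: "tail_exp (338/100 / (22/25)^2) (9/10) \<le> 68233/100000"
    by (rule tail_exp_le_high[of _ "239/10000" _ "97639/100000" "47667/50000" "45443/50000" "82603/100000"]) (simp_all add: power_divide)
  have n6: "tail_exp (338/100 / (22/25)^2) (19/20) \<le> 79307/100000"
    by (rule tail_exp_le_high[of _ "29/2000" _ "98561/100000" "97143/100000" "2949/3125" "44527/50000"]) (simp_all add: power_divide)
  have n7: "tail_exp (338/100 / (22/25)^2) (1) \<le> 19219/20000"
    by (rule tail_exp_le_high[of _ "1/400" _ "99751/100000" "99503/100000" "99009/100000" "24507/25000"]) (simp_all add: power_divide)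
  have E: "exp ((499/250)^2/2) \<le> (36783/5000::real)"
    by (rule exp_upper_chain[of "623/5000" _ "708/625" "12833/10000" "16469/10000" "27123/10000"]) (simp_all add: power_divide)
  let ?ns = "[(23/40, 26881/50000), (3/5, 52913/100000), (7/10, 51983/100000), (4/5, 28021/50000), (17/20, 60803/100000), (9/10, 68233/100000), (19/20, 79307/100000), (1, 19219/20000)]"
  have "tail_sum (3/4) (22/25) ?ns \<le> 7079/100000"
    by (simp add: tail_coeff_def cubic_tail_def kern_const_pi_def power2_eq_square)
  moreover have nodes: "tail_nodes (22/25) (23/40) ?ns" by (simp add: power2_eq_square)
  moreover have "main_poly (1618/625) (3/4) \<le> 49921/100000" "main_poly (1618/625) (22/25) \<le> 49921/100000"
    by (simp_all add: main_poly_def kern_const_pi_def power2_eq_square)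
  moreover have hs: "\<forall>(s, e)\<in>set ?ns. tail_exp (338/100 / (22/25)^2) s \<le> e"
    using n0 n1 n2 n3 n4 n5 n6 n7 by simp
  ultimately show ?thesis
    by (intro cell[where D = "1618/625", OF m _ _ _ _ E _ _ nodes hs]) (simp_all add: power_divide del: tail_sum.simps)
qed

end

section \<open>Symmetric truncation\<close>

lemma borel_measurable_ident: "(\<lambda>y::real. y) \<in> borel_measurable borel" by simp

lemma Phi_bounds: "0 \<le> Phi x" "Phi x \<le> 1"
  using prob_space.prob_le_1[OF prob_space_normal_density[of 1 0]] by (simp_all add: Phi_def)

lemma Phi_diff:
  assumes "a \<le> b"
  shows "Phi b - Phi a = (\<integral>t. indicator {a..<b} t * std_normal_density t \<partial>lborel)"
proof -
  have "Phi b - Phi a = (\<integral>t. indicator {..<b} t * std_normal_density t - indicator {..<a} t * std_normal_density t \<partial>lborel)"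
    using integrable_indicator_normal[of "{..<b}"] integrable_indicator_normal[of "{..<a}"] by (simp add: Phi_integral)
  also have "\<dots> = (\<integral>t. indicator {a..<b} t * std_normal_density t \<partial>lborel)"
    using assms by (intro Bochner_Integration.integral_cong) (auto simp: indicator_def)
  finally show ?thesis .
qed

lemma Phi_mono: "a \<le> b \<Longrightarrow> Phi a \<le> Phi b"
  using Phi_diff[of a b] by (smt (verit, best) Bochner_Integration.integral_nonneg indicator_pos_le mult_nonneg_nonneg normal_density_nonneg)

lemma Phi_half: "Phi 0 = 1/2" using Phi_minus[of 0] by simp

text \<open>The maximum, at t = 1, is exp (-1/2) / sqrt (2 pi) = 0.24197...\<close>

lemma normal_density_mult_le: "0 < t \<Longrightarrow> t * std_normal_density t \<le> 243/1000"
proof -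
  assume t: "0 < t"
  have "t \<le> 1 + (t^2 - 1)/2" using zero_le_power2[of "t - 1"] by (simp add: power2_eq_square field_simps)
  also have "\<dots> \<le> exp ((t^2 - 1)/2)" by (rule exp_ge_add_one_self)
  finally have "t * exp (-(t^2)/2) \<le> exp ((t^2 - 1)/2) * exp (-(t^2)/2)" by (intro mult_right_mono) auto
  also have "\<dots> = exp (-1/2)" by (simp add: diff_divide_distrib flip: exp_add)
  finally have 1: "t * exp (-(t^2)/2) \<le> exp (-1/2)" .
  have "exp (-1/2) / sqrt (2 * pi) \<le> 243/1000"
  proof -
    have "exp (1/2::real) \<ge> 1 + (1/2) + (1/2)^2/2 + (1/2)^3/6 + (1/2)^4/24" by (rule exp_ge_taylor4) simp
    then have e: "1648/1000 \<le> exp (1/2::real)" by (simp add: power_divide)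
    have p: "2506/1000 \<le> sqrt (2 * pi)" using pi_lower by (intro real_le_rsqrt) (simp add: power_divide)
    have "1 \<le> 243/1000 * ((1648/1000) * (2506/1000::real))" by simp
    also have "\<dots> \<le> 243/1000 * (exp (1/2) * sqrt (2 * pi))" using e p by (intro mult_left_mono mult_mono) auto
    finally show ?thesis by (simp add: exp_minus field_simps)
  qed
  moreover have "t * std_normal_density t = t * exp (-(t^2)/2) / sqrt (2 * pi)" by (simp add: std_normal_density_def)
  moreover have "t * exp (-(t^2)/2) / sqrt (2 * pi) \<le> exp (-1/2) / sqrt (2 * pi)" using 1 by (intro divide_right_mono) auto
  ultimately show ?thesis by linarith
qed

text \<open>On [x, k x] the density is at most 0.243/x and the length is (k - 1) x, so x cancels;
  negative x follow by reflection.\<close>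

lemma Phi_scale:
  assumes k: "1 \<le> k"
  shows "\<bar>Phi (k * x) - Phi x\<bar> \<le> 243/1000 * (k - 1)"
proof -
  have pos: "\<bar>Phi (k * x) - Phi x\<bar> \<le> 243/1000 * (k - 1)" if x: "0 < x" for x
  proof -
    have kx: "x \<le> k * x" using x k by simp
    have "Phi (k * x) - Phi x = (\<integral>t. indicator {x..<k * x} t * std_normal_density t \<partial>lborel)" by (rule Phi_diff[OF kx])
    also have "\<dots> \<le> (\<integral>t. indicator {x..<k * x} t * (243/1000 / x) \<partial>lborel)"
    proof (rule integral_mono)
      show "integrable lborel (\<lambda>t. indicator {x..<k * x} t * std_normal_density t)" by (rule integrable_indicator_normal) simp
      show "integrable lborel (\<lambda>t. indicator {x..<k * x} t * (243/1000 / x))"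
        using kx by (intro integrable_mult_left) (simp add: integrable_indicator_iff)
      fix t
      show "indicator {x..<k * x} t * std_normal_density t \<le> indicator {x..<k * x} t * (243/1000 / x)"
      proof (cases "t \<in> {x..<k * x}")
        case True
        then have "x * std_normal_density t \<le> t * std_normal_density t" by (intro mult_right_mono) (auto intro: normal_density_nonneg)
        also have "\<dots> \<le> 243/1000" using True x by (intro normal_density_mult_le) auto
        finally show ?thesis using True x by (simp add: field_simps)
      qed auto
    qed
    also have "\<dots> = (k * x - x) * (243/1000 / x)" using kx by simp
    also have "\<dots> = 243/1000 * (k - 1)" using x by (simp add: field_simps)
    finally show ?thesis using Phi_mono[OF kx] by simp
  qed
  consider "0 < x" | "x = 0" | "x < 0" by linarith
  then show ?thesis
  proof cases
    case 3
    then show ?thesis using pos[of "-x"] by (simp add: Phi_minus abs_minus_commute)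
  qed (use pos k in auto)
qed

context indep_symmetric
begin

text \<open>Independence lifts the symmetry of the single variables to a simultaneous reflection of
  the whole family, as required for events that involve several of them. The product formula assumes
  a nonempty index set, hence the case split.\<close>

lemma joint_distr_minus:
  "distr M (PiM I (\<lambda>_. borel)) (\<lambda>\<omega>. \<lambda>i\<in>I. Y i \<omega>) = distr M (PiM I (\<lambda>_. borel)) (\<lambda>\<omega>. \<lambda>i\<in>I. - Y i \<omega>)"
proof (cases "I = {}")
  case False
  have "indep_vars (\<lambda>_. borel) (\<lambda>i \<omega>. - Y i \<omega>) I"
    by (rule indep_vars_compose2[OF indep]) auto
  then have "distr M (PiM I (\<lambda>_. borel)) (\<lambda>\<omega>. \<lambda>i\<in>I. - Y i \<omega>) = PiM I (\<lambda>i. distr M borel (\<lambda>\<omega>. - Y i \<omega>))"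
    using False by (subst (asm) indep_vars_iff_distr_eq_PiM') auto
  also have "\<dots> = PiM I (\<lambda>i. distr M borel (Y i))" by (intro PiM_cong) (simp_all add: symm)
  also have "\<dots> = distr M (PiM I (\<lambda>_. borel)) (\<lambda>\<omega>. \<lambda>i\<in>I. Y i \<omega>)"
    using indep False by (subst (asm) indep_vars_iff_distr_eq_PiM') auto
  finally show ?thesis ..
qed (simp add: restrict_def)

lemma prob_minus:
  fixes R :: "('i \<Rightarrow> real) \<Rightarrow> bool"
  assumes R: "Measurable.pred (PiM I (\<lambda>_. borel)) R"
  shows "prob {\<omega> \<in> space M. R (\<lambda>i\<in>I. - Y i \<omega>)} = prob {\<omega> \<in> space M. R (\<lambda>i\<in>I. Y i \<omega>)}"
proof -
  let ?P = "PiM I (\<lambda>_. borel :: real measure)"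
  have R': "{x \<in> space ?P. R x} \<in> sets ?P" using R by measurable
  have *: "measure (distr M ?P (\<lambda>\<omega>. \<lambda>i\<in>I. Z i \<omega>)) {x \<in> space ?P. R x} = prob {\<omega> \<in> space M. R (\<lambda>i\<in>I. Z i \<omega>)}"
    if [measurable]: "\<And>i. i \<in> I \<Longrightarrow> Z i \<in> borel_measurable M" for Z
  proof -
    have m: "(\<lambda>\<omega>. \<lambda>i\<in>I. Z i \<omega>) \<in> measurable M ?P" by measurable
    have "(\<lambda>\<omega>. \<lambda>i\<in>I. Z i \<omega>) -` {x \<in> space ?P. R x} \<inter> space M = {\<omega> \<in> space M. R (\<lambda>i\<in>I. Z i \<omega>)}"
      using measurable_space[OF m] by auto
    then show ?thesis by (simp add: measure_distr[OF m R'])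
  qed
  show ?thesis using *[of Y] *[of "\<lambda>i \<omega>. - Y i \<omega>"] joint_distr_minus by simp
qed

text \<open>Reflecting all variables preserves \<open>A\<close> and changes the sign of a sum of odd
  terms. For c <= 0 the events that the sum or its negative is below c are disjoint; for c > 0 they
  cover \<open>A\<close>.\<close>

lemma symmetric_half:
  fixes g :: "real \<Rightarrow> real" and c B :: real
  assumes g [measurable]: "g \<in> borel_measurable borel" and odd: "\<And>y. g (- y) = - g y"
  defines "A \<equiv> {\<omega> \<in> space M. \<exists>i\<in>I. B \<le> \<bar>Y i \<omega>\<bar>}"
  shows "c \<le> 0 \<Longrightarrow> prob {\<omega> \<in> A. (\<Sum>i\<in>I. g (Y i \<omega>)) < c} \<le> prob A / 2"
    and "0 < c \<Longrightarrow> prob A / 2 \<le> prob {\<omega> \<in> A. (\<Sum>i\<in>I. g (Y i \<omega>)) < c}"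
proof -
  let ?G = "\<lambda>\<omega>. \<Sum>i\<in>I. g (Y i \<omega>)"
  have [measurable]: "A \<in> events" unfolding A_def using finI by measurable
  have [measurable]: "?G \<in> borel_measurable M" by measurable
  have sets: "{\<omega> \<in> A. P (?G \<omega>)} \<in> events" if "Measurable.pred borel P" for P
  proof -
    have "{\<omega> \<in> A. P (?G \<omega>)} = {\<omega> \<in> space M. \<omega> \<in> A \<and> P (?G \<omega>)}" by (auto simp: A_def)
    also have "\<dots> \<in> events" using that by measurable
    finally show ?thesis .
  qed
  have flip: "prob {\<omega> \<in> A. P (- ?G \<omega>)} = prob {\<omega> \<in> A. P (?G \<omega>)}" if P: "Measurable.pred borel P" for P
  proof -
    let ?R = "\<lambda>x. (\<exists>i\<in>I. B \<le> \<bar>x i\<bar>) \<and> P (\<Sum>i\<in>I. g (x i))"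
    have "Measurable.pred (PiM I (\<lambda>_. borel)) ?R"
      using finI P by measurable
    from prob_minus[OF this] show ?thesis
      by (simp add: A_def odd sum_negf conj_assoc cong: conj_cong)
  qed
  show "prob {\<omega> \<in> A. ?G \<omega> < c} \<le> prob A / 2" if c: "c \<le> 0"
  proof -
    have "prob {\<omega> \<in> A. ?G \<omega> < c} + prob {\<omega> \<in> A. - ?G \<omega> < c} = prob ({\<omega> \<in> A. ?G \<omega> < c} \<union> {\<omega> \<in> A. - ?G \<omega> < c})"
      using c sets[of "\<lambda>y. y < c"] sets[of "\<lambda>y. - y < c"] by (intro finite_measure_Union[symmetric]) auto
    also have "\<dots> \<le> prob A" by (rule finite_measure_mono) auto
    finally show ?thesis using flip[of "\<lambda>y. y < c"] by simp
  qed
  show "prob A / 2 \<le> prob {\<omega> \<in> A. ?G \<omega> < c}" if c: "0 < c"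
  proof -
    have "prob A \<le> prob ({\<omega> \<in> A. ?G \<omega> < c} \<union> {\<omega> \<in> A. - ?G \<omega> < c})"
      using c sets[of "\<lambda>y. y < c"] sets[of "\<lambda>y. - y < c"] by (intro finite_measure_mono) auto
    also have "\<dots> \<le> prob {\<omega> \<in> A. ?G \<omega> < c} + prob {\<omega> \<in> A. - ?G \<omega> < c}"
      using sets[of "\<lambda>y. y < c"] sets[of "\<lambda>y. - y < c"] by (intro measure_Un_le) auto
    finally show ?thesis using flip[of "\<lambda>y. y < c"] by simp
  qed
qed

lemma prob_sub_Phi_le_half:
  assumes "I \<noteq> {}" and that: "c \<le> 0 \<longleftrightarrow> x \<le> 0"
  shows "\<bar>prob {\<omega> \<in> space M. S \<omega> < c} - Phi x\<bar> \<le> 1/2"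
proof -
  \<comment> \<open>With threshold 0 the event of \<open>symmetric_half\<close> is the whole space,
    the family being nonempty.\<close>
  have A: "{\<omega> \<in> space M. \<exists>i\<in>I. 0 \<le> \<bar>Y i \<omega>\<bar>} = space M" using assms by auto
  note h = symmetric_half[OF borel_measurable_ident refl, of c 0, unfolded A, folded S_def, unfolded prob_space]
  show ?thesis
  proof (cases "c \<le> 0")
    case True
    then have "prob {\<omega> \<in> space M. S \<omega> < c} \<le> 1/2" "Phi x \<le> 1/2" using h(1) Phi_mono[of x 0] that Phi_half by auto
    then show ?thesis using Phi_bounds(1)[of x] measure_nonneg[of M "{\<omega> \<in> space M. S \<omega> < c}"] by linarith
  next
    case False
    then have "1/2 \<le> prob {\<omega> \<in> space M. S \<omega> < c}" "1/2 \<le> Phi x" using h(2) Phi_mono[of 0 x] that Phi_half by auto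
    then show ?thesis using Phi_bounds(2)[of x] prob_le_1[of "{\<omega> \<in> space M. S \<omega> < c}"] by linarith
  qed
qed

text \<open>Values of modulus at least B are replaced by 0, which is an odd operation, so
  \<open>symmetric_half\<close> applies to both sums. On \<open>A\<close> both probabilities then
  lie in the same half of the interval from 0 to prob A; off \<open>A\<close> the sums
  agree.\<close>

lemma truncation_diff:
  fixes B c :: real
  defines "g \<equiv> \<lambda>y. if \<bar>y\<bar> < B then y else 0"
  shows "\<bar>prob {\<omega> \<in> space M. S \<omega> < c} - prob {\<omega> \<in> space M. (\<Sum>i\<in>I. g (Y i \<omega>)) < c}\<bar>
    \<le> prob {\<omega> \<in> space M. \<exists>i\<in>I. B \<le> \<bar>Y i \<omega>\<bar>} / 2"
proof -
  define A where "A = {\<omega> \<in> space M. \<exists>i\<in>I. B \<le> \<bar>Y i \<omega>\<bar>}"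
  have [measurable]: "A \<in> events" unfolding A_def using finI by measurable
  have g [measurable]: "g \<in> borel_measurable borel" unfolding g_def by measurable
  have odd: "g (- y) = - g y" for y by (simp add: g_def)
  have split: "prob {\<omega> \<in> space M. f \<omega> < c} = prob {\<omega> \<in> A. f \<omega> < c} + prob {\<omega> \<in> space M - A. f \<omega> < c}"
    if [measurable]: "f \<in> borel_measurable M" for f :: "'a \<Rightarrow> real"
  proof -
    have 1: "{\<omega> \<in> A. f \<omega> < c} = {\<omega> \<in> space M. \<omega> \<in> A \<and> f \<omega> < c}" by (auto simp: A_def)
    have 2: "{\<omega> \<in> space M - A. f \<omega> < c} = {\<omega> \<in> space M. \<omega> \<notin> A \<and> f \<omega> < c}" by auto
    have "prob {\<omega> \<in> space M. \<omega> \<in> A \<and> f \<omega> < c} + prob {\<omega> \<in> space M. \<omega> \<notin> A \<and> f \<omega> < c} = prob ({\<omega> \<in> space M. \<omega> \<in> A \<and> f \<omega> < c} \<union> {\<omega> \<in> space M. \<omega> \<notin> A \<and> f \<omega> < c})"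
      by (intro finite_measure_Union[symmetric]) auto
    also have "{\<omega> \<in> space M. \<omega> \<in> A \<and> f \<omega> < c} \<union> {\<omega> \<in> space M. \<omega> \<notin> A \<and> f \<omega> < c} = {\<omega> \<in> space M. f \<omega> < c}" by auto
    finally show ?thesis unfolding 1 2 by simp
  qed
  have "(\<Sum>i\<in>I. g (Y i \<omega>)) = S \<omega>" if "\<omega> \<in> space M - A" for \<omega>
    unfolding S_def using that by (intro sum.cong) (auto simp: A_def g_def)
  then have eq: "{\<omega> \<in> space M - A. (\<Sum>i\<in>I. g (Y i \<omega>)) < c} = {\<omega> \<in> space M - A. S \<omega> < c}" by auto
  have le: "prob {\<omega> \<in> A. f \<omega> < c} \<le> prob A" for f :: "'a \<Rightarrow> real" by (intro finite_measure_mono) auto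
  note h1 = symmetric_half[OF borel_measurable_ident refl, of c B, folded S_def A_def]
  note h2 = symmetric_half[OF g odd, of c B, folded A_def]
  have m: "(\<lambda>\<omega>. \<Sum>i\<in>I. g (Y i \<omega>)) \<in> borel_measurable M" by measurable
  have "\<bar>prob {\<omega> \<in> A. S \<omega> < c} - prob {\<omega> \<in> A. (\<Sum>i\<in>I. g (Y i \<omega>)) < c}\<bar> \<le> prob A / 2"
  proof (cases "c \<le> 0")
    case True
    then show ?thesis using h1(1) h2(1)
        measure_nonneg[of M "{\<omega> \<in> A. S \<omega> < c}"] measure_nonneg[of M "{\<omega> \<in> A. (\<Sum>i\<in>I. g (Y i \<omega>)) < c}"] by linarith
  next
    case False
    then have "0 < c" by simp
    from h1(2)[OF this] h2(2)[OF this] le[of S] le[of "\<lambda>\<omega>. \<Sum>i\<in>I. g (Y i \<omega>)"] show ?thesis by linarith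
  qed
  then show ?thesis
    unfolding split[OF S_measurable] split[OF m] eq A_def[symmetric] by simp
qed

end

context indep_symmetric3
begin

lemma m_pos: "0 < m"
proof (rule ccontr)
  assume "\<not> 0 < m"
  then have "m = 0" using m_nonneg by simp
  then have "b i = 0" if "i \<in> I" for i
    using that finI b_nonneg by (auto simp: m_def sum_nonneg_eq_0_iff)
  then have "v i = 0" if "i \<in> I" for i
    using lyapunov[OF that] that v_nonneg[of i] by (simp add: power_le_zero_eq)
  then have "(\<Sum>i\<in>I. v i) = 0" by simp
  then show False using var1 by (simp add: v_def)
qed

lemma berry_esseen: "\<bar>prob {\<omega> \<in> space M. S \<omega> < x} - Phi x\<bar> \<le> 57/100 * m"
proof (cases "m \<le> 22/25")
  case True
  note cells = cell_small cell1 cell2 cell3 cell4 cell5 cell6 cell7 cell8 cell9 cell10 cell11 cell12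
  show ?thesis
    using True m_pos cells by (meson linear)
next
  case False
  have "I \<noteq> {}" using var1 by auto
  then have "\<bar>prob {\<omega> \<in> space M. S \<omega> < x} - Phi x\<bar> \<le> 1/2" by (rule prob_sub_Phi_le_half) simp
  then show ?thesis using False by simp
qed

end

context indep_symmetric
begin

text \<open>The three terms stem from truncation, from the change of the normal scale from B to B
  \<sigma> with \<sigma>^2 = 1 - L, and from \<open>berry_esseen\<close> for the truncated variables
  divided by B \<sigma>, whose Lyapunov ratio is V / \<sigma>^3.\<close>

lemma truncated_berry_esseen:
  fixes B L V :: real and x :: real
  assumes B: "0 < B" and ne: "I \<noteq> {}"
    and sq: "\<And>i. i \<in> I \<Longrightarrow> integrable M (\<lambda>\<omega>. (Y i \<omega>)^2)"
    and var: "(\<Sum>i\<in>I. expectation (\<lambda>\<omega>. (Y i \<omega>)^2)) = B^2"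
  defines "L \<equiv> (\<Sum>i\<in>I. expectation (\<lambda>\<omega>. (Y i \<omega>)^2 * indicator {\<omega>. B \<le> \<bar>Y i \<omega>\<bar>} \<omega>)) / B^2"
    and "V \<equiv> (\<Sum>i\<in>I. expectation (\<lambda>\<omega>. \<bar>Y i \<omega>\<bar>^3 * indicator {\<omega>. \<bar>Y i \<omega>\<bar> < B} \<omega>)) / B^3"
  assumes L1: "L < 1"
  shows "\<bar>prob {\<omega> \<in> space M. S \<omega> < x * B} - Phi x\<bar> \<le> L / 2 + 243/1000 * (1 / sqrt (1 - L) - 1) + 57/100 * (V / sqrt (1 - L)^3)"
proof -
  define g where "g y = (if \<bar>y\<bar> < B then y else 0)" for y :: real
  have g [measurable]: "g \<in> borel_measurable borel" unfolding g_def by measurable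
  define \<sigma> where "\<sigma> = sqrt (1 - L)"
  have \<sigma>: "0 < \<sigma>" "\<sigma>^2 = 1 - L" using L1 by (simp_all add: \<sigma>_def)
  define Z where "Z i \<omega> = g (Y i \<omega>) / (B * \<sigma>)" for i \<omega>
  have sq': "integrable M (\<lambda>\<omega>. (Y i \<omega>)^2 * indicator {\<omega>. B \<le> \<bar>Y i \<omega>\<bar>} \<omega>)" if i: "i \<in> I" for i
  proof (rule Bochner_Integration.integrable_bound[OF sq[OF i]])
    have [measurable]: "Y i \<in> borel_measurable M" using i by simp
    have "(\<lambda>\<omega>. (Y i \<omega>)^2 * indicator {\<omega>. B \<le> \<bar>Y i \<omega>\<bar>} \<omega>) = (\<lambda>\<omega>. if B \<le> \<bar>Y i \<omega>\<bar> then (Y i \<omega>)^2 else 0)" by (auto simp: indicator_def)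
    then show "(\<lambda>\<omega>. (Y i \<omega>)^2 * indicator {\<omega>. B \<le> \<bar>Y i \<omega>\<bar>} \<omega>) \<in> borel_measurable M" by simp
  qed (auto simp: indicator_def)
  have gsq: "(g (Y i \<omega>))^2 = (Y i \<omega>)^2 - (Y i \<omega>)^2 * indicator {\<omega>. B \<le> \<bar>Y i \<omega>\<bar>} \<omega>" for i \<omega>
    by (auto simp: g_def indicator_def)
  have gcu: "\<bar>g (Y i \<omega>)\<bar>^3 = \<bar>Y i \<omega>\<bar>^3 * indicator {\<omega>. \<bar>Y i \<omega>\<bar> < B} \<omega>" for i \<omega>
    by (auto simp: g_def indicator_def)
  have L0: "0 \<le> L" unfolding L_def using B by (intro divide_nonneg_nonneg sum_nonneg Bochner_Integration.integral_nonneg) auto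
  interpret Z: indep_symmetric3 M I Z
  proof
    show "finite I" by (rule finI)
    show "indep_vars (\<lambda>_. borel) Z I"
      unfolding Z_def[abs_def] by (rule indep_vars_compose2[OF indep]) measurable
    fix i assume i: "i \<in> I"
    have [measurable]: "Y i \<in> borel_measurable M" using i by simp
    let ?h = "\<lambda>y. g y / (B * \<sigma>)"
    have "distr M borel (Z i) = distr (distr M borel (Y i)) borel ?h"
      by (subst distr_distr) (auto simp: comp_def Z_def[abs_def])
    also have "\<dots> = distr (distr M borel (\<lambda>\<omega>. - Y i \<omega>)) borel ?h" by (simp only: symm[OF i])
    also have "\<dots> = distr M borel (\<lambda>\<omega>. - Z i \<omega>)"
      by (subst distr_distr) (auto simp: comp_def Z_def[abs_def] g_def intro!: arg_cong[where f = "distr M borel"])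
    finally show "distr M borel (Z i) = distr M borel (\<lambda>\<omega>. - Z i \<omega>)" .
    have [measurable]: "Z i \<in> borel_measurable M" unfolding Z_def by measurable
    have "\<bar>g y\<bar> / (B * \<sigma>) \<le> B / (B * \<sigma>)" for y
      using B \<sigma> by (intro divide_right_mono) (auto simp: g_def)
    then have "\<bar>Z i \<omega>\<bar> \<le> B / (B * \<sigma>)" for \<omega>
      using B \<sigma> by (simp add: Z_def abs_mult)
    then have zb: "\<bar>Z i \<omega>\<bar>^k \<le> (B / (B * \<sigma>))^k" for \<omega> k by (intro power_mono) auto
    show "integrable M (\<lambda>\<omega>. (Z i \<omega>)^2)"
      using zb[of _ 2] by (intro integrable_const_bound[of _ "(B / (B * \<sigma>))^2"]) auto
    show "integrable M (\<lambda>\<omega>. \<bar>Z i \<omega>\<bar>^3)"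
      using zb[of _ 3] by (intro integrable_const_bound[of _ "(B / (B * \<sigma>))^3"]) auto
  next
    have "expectation (\<lambda>\<omega>. (Z i \<omega>)^2) = (expectation (\<lambda>\<omega>. (Y i \<omega>)^2) - expectation (\<lambda>\<omega>. (Y i \<omega>)^2 * indicator {\<omega>. B \<le> \<bar>Y i \<omega>\<bar>} \<omega>)) / (B * \<sigma>)^2"
      if "i \<in> I" for i
      using sq[OF that] sq'[OF that] by (simp add: Z_def power_divide gsq)
    then have "(\<Sum>i\<in>I. expectation (\<lambda>\<omega>. (Z i \<omega>)^2)) = (B^2 - L * B^2) / (B * \<sigma>)^2"
      using B var by (simp add: L_def sum_subtractf flip: sum_divide_distrib)
    also have "B^2 - L * B^2 = (B * \<sigma>)^2" by (simp add: power_mult_distrib \<sigma>(2) algebra_simps)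
    also have "(B * \<sigma>)^2 / (B * \<sigma>)^2 = 1" using B \<sigma> by simp
    finally show "(\<Sum>i\<in>I. expectation (\<lambda>\<omega>. (Z i \<omega>)^2)) = 1" .
  qed
  have "Z.b i = expectation (\<lambda>\<omega>. \<bar>Y i \<omega>\<bar>^3 * indicator {\<omega>. \<bar>Y i \<omega>\<bar> < B} \<omega>) / (B * \<sigma>)^3" for i
    using B \<sigma> by (simp add: Z.b_def Z_def power_divide abs_mult gcu)
  then have mZ: "Z.m = V / \<sigma>^3"
    using B by (simp add: Z.m_def V_def power_mult_distrib flip: sum_divide_distrib)
  have ZS: "{\<omega> \<in> space M. (\<Sum>i\<in>I. g (Y i \<omega>)) < x * B} = {\<omega> \<in> space M. Z.S \<omega> < x / \<sigma>}"
  proof -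
    have "Z.S \<omega> = (\<Sum>i\<in>I. g (Y i \<omega>)) / (B * \<sigma>)" for \<omega> by (simp add: Z.S_def Z_def sum_divide_distrib)
    moreover have "s / (B * \<sigma>) < x / \<sigma> \<longleftrightarrow> s < x * B" for s using B \<sigma> by (simp add: field_simps)
    ultimately show ?thesis by simp
  qed
  \<comment> \<open>Union bound together with Chebyshev's inequality restricted to the event itself,
    which yields the truncated second moments of L.\<close>
  have PA: "prob {\<omega> \<in> space M. \<exists>i\<in>I. B \<le> \<bar>Y i \<omega>\<bar>} \<le> L"
  proof -
    have ev: "{\<omega> \<in> space M. B \<le> \<bar>Y i \<omega>\<bar>} \<in> events" if "i \<in> I" for i
    proof -
      have [measurable]: "Y i \<in> borel_measurable M" using that by simp
      show ?thesis by measurable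
    qed
    have "{\<omega> \<in> space M. \<exists>i\<in>I. B \<le> \<bar>Y i \<omega>\<bar>} = (\<Union>i\<in>I. {\<omega> \<in> space M. B \<le> \<bar>Y i \<omega>\<bar>})" by auto
    then have "prob {\<omega> \<in> space M. \<exists>i\<in>I. B \<le> \<bar>Y i \<omega>\<bar>} \<le> (\<Sum>i\<in>I. prob {\<omega> \<in> space M. B \<le> \<bar>Y i \<omega>\<bar>})"
      using ev finI by (auto intro!: finite_measure_subadditive_finite)
    also have "\<dots> \<le> (\<Sum>i\<in>I. expectation (\<lambda>\<omega>. (Y i \<omega>)^2 * indicator {\<omega>. B \<le> \<bar>Y i \<omega>\<bar>} \<omega>) / B^2)"
    proof (rule sum_mono)
      fix i assume i: "i \<in> I"
      have "prob {\<omega> \<in> space M. B \<le> \<bar>Y i \<omega>\<bar>} = expectation (indicator {\<omega> \<in> space M. B \<le> \<bar>Y i \<omega>\<bar>})"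
        using ev[OF i] by simp
      also have "\<dots> \<le> expectation (\<lambda>\<omega>. (Y i \<omega>)^2 * indicator {\<omega>. B \<le> \<bar>Y i \<omega>\<bar>} \<omega> / B^2)"
      proof (rule integral_mono)
        show "integrable M (indicator {\<omega> \<in> space M. B \<le> \<bar>Y i \<omega>\<bar>} :: 'a \<Rightarrow> real)"
          using ev[OF i] by (simp add: integrable_indicator_iff less_top[symmetric])
        show "integrable M (\<lambda>\<omega>. (Y i \<omega>)^2 * indicator {\<omega>. B \<le> \<bar>Y i \<omega>\<bar>} \<omega> / B^2)" using sq'[OF i] by simp
        fix \<omega>
        have "B^2 \<le> (Y i \<omega>)^2" if "B \<le> \<bar>Y i \<omega>\<bar>" using power_mono[OF that, of 2] B by simp
        then show "indicator {\<omega> \<in> space M. B \<le> \<bar>Y i \<omega>\<bar>} \<omega> \<le> (Y i \<omega>)^2 * indicator {\<omega>. B \<le> \<bar>Y i \<omega>\<bar>} \<omega> / B^2"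
          using B by (auto simp: indicator_def)
      qed
      finally show "prob {\<omega> \<in> space M. B \<le> \<bar>Y i \<omega>\<bar>} \<le> expectation (\<lambda>\<omega>. (Y i \<omega>)^2 * indicator {\<omega>. B \<le> \<bar>Y i \<omega>\<bar>} \<omega>) / B^2" by simp
    qed
    also have "\<dots> = L" by (simp add: L_def sum_divide_distrib)
    finally show ?thesis .
  qed
  have "\<bar>prob {\<omega> \<in> space M. S \<omega> < x * B} - prob {\<omega> \<in> space M. Z.S \<omega> < x / \<sigma>}\<bar> \<le> L / 2"
    using truncation_diff[of "x * B" B] PA by (simp add: g_def[symmetric] ZS)
  moreover have "\<bar>prob {\<omega> \<in> space M. Z.S \<omega> < x / \<sigma>} - Phi (x / \<sigma>)\<bar> \<le> 57/100 * (V / \<sigma>^3)"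
    using Z.berry_esseen[of "x / \<sigma>"] by (simp add: mZ)
  moreover have "\<bar>Phi (x / \<sigma>) - Phi x\<bar> \<le> 243/1000 * (1 / \<sigma> - 1)"
  proof -
    have "\<sigma> \<le> 1" using L0 by (simp add: \<sigma>_def)
    then show ?thesis using Phi_scale[of "1 / \<sigma>" x] \<sigma> by (simp add: le_divide_eq)
  qed
  ultimately show ?thesis unfolding \<sigma>_def by linarith
qed

end

text \<open>Beyond the half spent on truncation, 1.0769 L must absorb the normal rescaling and the
  growth of 0.57 V to 0.57 V / (1 - L)^(3/2). That growth is about 0.57 V * (3/2) L to first order,
  so the bound on V implied by \<open>small\<close> is what makes it fit.\<close>

lemma final_arithmetic:
  fixes L V :: real
  assumes L: "0 \<le> L" and V: "0 \<le> V" and small: "5708/10000 * V + 15769/10000 * L < 1/2"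
  shows "L / 2 + 243/1000 * (1 / sqrt (1 - L) - 1) + 57/100 * (V / sqrt (1 - L)^3) \<le> 5708/10000 * V + 15769/10000 * L"
proof -
  define a where "a = 1 - L"
  have La: "L = 1 - a" "68/100 \<le> a" "a \<le> 1" using L V small by (auto simp: a_def)
  define s where "s = sqrt a"
  have s: "0 < s" "s^2 = a" using La by (simp_all add: s_def)
  \<comment> \<open>The arithmetic-geometric mean inequality s <= (1 + a)/2 removes the square root,
    since 1/s = s/a.\<close>
  have w: "1 / s \<le> (1 + a) / (2 * a)"
  proof -
    have "2 * s \<le> 1 + s^2" using zero_le_power2[of "s - 1"] by (simp add: power2_eq_square algebra_simps)
    then have "2 * s * s \<le> (1 + a) * s" using s by (simp add: mult_right_mono)
    then show ?thesis using s La by (simp add: field_simps power2_eq_square)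
  qed
  have w3: "1 / s^3 \<le> (1 + a) / (2 * a^2)"
  proof -
    have "1 / s^3 = 1 / s / a" using s by (simp add: power2_eq_square power3_eq_cube flip: s(2))
    also have "\<dots> \<le> (1 + a) / (2 * a) / a" using w La by (intro divide_right_mono) auto
    finally show ?thesis by (simp add: power2_eq_square)
  qed
  \<comment> \<open>0.876 is 0.5/0.5708 rounded up and 2.762 is 1.5769/0.5708 rounded down.\<close>
  have V': "V \<le> 876/1000 - 2762/1000 * L" using small L by simp
  have "57/100 * (V * ((1 + a) / (2 * a^2) - 1)) + 243/1000 * ((1 + a) / (2 * a) - 1) \<le> 10769/10000 * L"
  proof -
    have e1: "(1 + a) / (2 * a^2) - 1 = L * (3/2 - L) / a^2" unfolding La(1) using La(2) by (simp add: field_simps power2_eq_square)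
    have e2: "(1 + a) / (2 * a) - 1 = L / (2 * a)" unfolding La(1) using La(2) by (simp add: field_simps)
    have "0 \<le> 3/2 - L" using La by linarith
    then have "V * (3/2 - L) \<le> (876/1000 - 2762/1000 * L) * (3/2)"
      using L by (intro mult_mono V' order_trans[OF V V']) auto
    then have "V * (3/2 - L) \<le> 1314/1000 - 4143/1000 * L" by (simp add: left_diff_distrib)
    moreover have "1 - 2 * L \<le> a^2" by (simp add: a_def power2_eq_square algebra_simps)
    moreover have "57/100 * p + 1215/10000 * a \<le> 10769/10000 * q"
      if "p \<le> 1314/1000 - 4143/1000 * L" "1 - 2 * L \<le> q" for p q :: real
      using that La(1) L by linarith
    ultimately have "57/100 * (V * (3/2 - L)) + 1215/10000 * a \<le> 10769/10000 * a^2" by blast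
    then have "L / a^2 * (57/100 * (V * (3/2 - L)) + 1215/10000 * a) \<le> L / a^2 * (10769/10000 * a^2)"
      using L La by (intro mult_left_mono) auto
    moreover have "L / a^2 * (57/100 * (V * (3/2 - L)) + 1215/10000 * a) = 57/100 * (V * (L * (3/2 - L) / a^2)) + 243/1000 * (L / (2 * a))"
      using La(2) by (simp add: field_simps power2_eq_square)
    moreover have "L / a^2 * (10769/10000 * a^2) = 10769/10000 * L" using La(2) by simp
    ultimately show ?thesis unfolding e1 e2 by linarith
  qed
  moreover have "V * (1 / s^3) \<le> V * ((1 + a) / (2 * a^2))" using w3 V by (rule mult_left_mono)
  then have "V / s^3 \<le> V * ((1 + a) / (2 * a^2) - 1) + V" by (simp add: algebra_simps)
  moreover have "L / 2 + 243/1000 * (r - 1) + 57/100 * y \<le> 5708/10000 * V + 15769/10000 * L"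
    if "57/100 * t + 243/1000 * (q - 1) \<le> 10769/10000 * L" "y \<le> t + V" "r \<le> q" for r y t q :: real
    using that V by argo
  ultimately have "L / 2 + 243/1000 * (1 / s - 1) + 57/100 * (V / s^3) \<le> 5708/10000 * V + 15769/10000 * L"
    using w by blast
  then show ?thesis by (simp add: s_def a_def)
qed

theorem theorem3:
  fixes M :: "'a measure" and X :: "nat \<Rightarrow> 'a \<Rightarrow> real" and n :: nat
    and \<gamma>0 c :: real
  assumes "prob_space M"
    and rv: "\<And>i. i \<in> {1..n} \<Longrightarrow> X i \<in> borel_measurable M"
    and indep: "prob_space.indep_vars M (\<lambda>_. borel) X {1..n}"
    and symm: "\<And>i. i \<in> {1..n} \<Longrightarrow> distr M borel (X i) = distr M borel (\<lambda>\<omega>. - X i \<omega>)"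
    and sq_int: "\<And>i. i \<in> {1..n} \<Longrightarrow> integrable M (\<lambda>\<omega>. (X i \<omega>)\<^sup>2)"
    and sq_pos: "\<And>i. i \<in> {1..n} \<Longrightarrow> integral\<^sup>L M (\<lambda>\<omega>. (X i \<omega>)\<^sup>2) > 0"
    and L_pos: "Ln M X n 1 > 0"
    and pair: "(\<gamma>0, c) \<in> {(0, 1.5769), (0.1, 1.5749), (0.5, 1.4532), (1, 1.3033),
                          (2, 1.1115), (5, 0.8729), (10, 0.7433), (100, 0.5808)}"
    and gam: "Mn M X n 1 / Ln M X n 1 \<ge> \<gamma>0"
  shows "Delta_n M X n \<le> (1 + Mn M X n 1 / Ln M X n 1) * c * Ln M X n 1
       \<and> (1 + Mn M X n 1 / Ln M X n 1) * c * Ln M X n 1 = c * (Ln M X n 1 + Mn M X n 1)"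
proof
  interpret indep_symmetric M "{1..n}" X
    using assms(1) indep symm by (simp add: indep_symmetric_def indep_symmetric_axioms_def)
  define L V B where "L = Ln M X n 1" and "V = Mn M X n 1" and "B = Bn M X n"
  have n: "{1..n} \<noteq> {}" using L_pos by (cases "n = 0") (auto simp: Ln_def)
  have var: "0 < Bn2 M X n" unfolding Bn2_def using n sq_pos by (intro sum_pos) auto
  then have B: "0 < B" "B^2 = Bn2 M X n" by (simp_all add: B_def Bn_def)
  have L: "0 < L" using L_pos by (simp add: L_def)
  have L_eq: "L = (\<Sum>i\<in>{1..n}. expectation (\<lambda>\<omega>. (X i \<omega>)^2 * indicator {\<omega>. B \<le> \<bar>X i \<omega>\<bar>} \<omega>)) / B^2"
    by (simp add: L_def Ln_def B_def[symmetric] B(2))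
  have V_eq: "V = (\<Sum>i\<in>{1..n}. expectation (\<lambda>\<omega>. \<bar>X i \<omega>\<bar>^3 * indicator {\<omega>. \<bar>X i \<omega>\<bar> < B} \<omega>)) / B^3"
    by (simp add: V_def Mn_def B_def[symmetric])
  have V: "0 \<le> V" unfolding V_eq using B by (intro divide_nonneg_nonneg sum_nonneg Bochner_Integration.integral_nonneg) auto
  have SS: "Sn X n = S" by (rule ext) (simp only: Sn_def S_def)
  have gen: "\<bar>prob {\<omega> \<in> space M. S \<omega> < x * B} - Phi x\<bar> \<le> 5708/10000 * V + 15769/10000 * L" for x
  proof (cases "5708/10000 * V + 15769/10000 * L < 1/2")
    case True
    then have "L < 1" using V by simp
    have "(\<Sum>i\<in>{1..n}. expectation (\<lambda>\<omega>. (X i \<omega>)^2)) = B^2" by (simp add: B(2) Bn2_def)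
    from truncated_berry_esseen[OF B(1) n sq_int this, folded L_eq V_eq, OF _ \<open>L < 1\<close>, of x]
      final_arithmetic[OF less_imp_le[OF L] V True]
    show ?thesis by simp
  next
    case False
    have "x * B \<le> 0 \<longleftrightarrow> x \<le> 0" using B by (simp add: mult_le_0_iff)
    from prob_sub_Phi_le_half[OF n this] False show ?thesis by simp
  qed
  have \<gamma>: "\<gamma>0 * L \<le> V" using gam L by (simp add: L_def V_def field_simps)
  \<comment> \<open>What the list has to provide: as V >= \<gamma>0 L, the surplus (c - 0.5708) V
    pays for the missing part of 1.5769 L. This is an equality for \<gamma>0 = 0 and nearly one for
    \<gamma>0 = 100.\<close>
  have "5708/10000 \<le> c \<and> 15769/10000 \<le> c + (c - 5708/10000) * \<gamma>0"
    using pair unfolding insert_iff empty_iff prod.inject by (elim disjE conjE FalseE; hypsubst; simp)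
  then have c: "5708/10000 \<le> c" "15769/10000 \<le> c + (c - 5708/10000) * \<gamma>0" by auto
  have le: "5708/10000 * V + 15769/10000 * L \<le> c * (L + V)"
    using mult_left_mono[OF \<gamma>, of "c - 5708/10000"] mult_right_mono[OF c(2), of L] c(1) L by (simp add: algebra_simps)
  have "Delta_n M X n \<le> c * (L + V)"
    unfolding Delta_n_def SS B_def[symmetric] by (rule cSUP_least[OF UNIV_not_empty order_trans[OF gen le]])
  moreover show eq: "(1 + Mn M X n 1 / Ln M X n 1) * c * Ln M X n 1 = c * (Ln M X n 1 + Mn M X n 1)"
    using L_pos by (simp add: field_simps)
  ultimately show "Delta_n M X n \<le> (1 + Mn M X n 1 / Ln M X n 1) * c * Ln M X n 1"
    by (simp only: L_def V_def)
qed

end
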